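(* Let $M^m$ be a compact Kähler manifold of complex dimension $m$ with first Chern class $c_1(M)=0$, and let $g_{\alpha\bar\beta}(x,0)$ be a Kähler metric on $M$ with Ricci tensor $R_{\alpha\bar\beta}(x,0)$. Let $f$ be a real smooth function on $M$ with $f_{\alpha\bar\beta}=-R_{\alpha\bar\beta}(x,0)$, and let $\varphi(x,t)$ be a solution on $M\times[0,T)$, $0<T\le\infty$, of the complex Monge–Ampère flow $$\frac{\partial}{\partial t}\varphi(x,t)=\log\frac{\det(g_{\gamma\bar\delta}(x,t))}{\det(g_{\gamma\bar\delta}(x,0))}+f(x),\qquad g_{\alpha\bar\beta}(x,t)=g_{\alpha\bar\beta}(x,0)+\varphi_{\alpha\bar\beta}(x,t),$$ where $g_{\alpha\bar\beta}(x,t)$ is a Kähler metric for each $t$ (so that $g(t)$ solves the Kähler–Ricci flow $\partial_t g_{\alpha\bar\beta}=-R_{\alpha\bar\beta}$). Set $u=-\varphi_t=-\partial\varphi/\partial t$ and assume $u>0$. Then for all $t>0$, $$u_t-\frac{|\nabla u|^2}{u}+\frac{m}{t}\,u\ \ge\ 0,$$ where $|\nabla u|^2$ is computed with respect to $g(t)$. (No assumption on the sign of the curvature is made.)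
   Context: Conventions. In local holomorphic coordinates, $h_\alpha=\partial h/\partial z^\alpha$, $h_{\bar\beta}=\partial h/\partial\bar z^\beta$, $h_{\alpha\bar\beta}=\partial^2h/\partial z^\alpha\partial\bar z^\beta$ for a function $h$. The Ricci tensor of a Kähler metric $g$ is $R_{\alpha\bar\beta}=-\partial_\alpha\partial_{\bar\beta}\log\det(g_{\gamma\bar\delta})$; $R_{\alpha\bar\beta}(x,t)$ denotes that of $g(t)$. The gradient norm is $|\nabla u|^2=g^{\alpha\bar\beta}(x,t)u_\alpha u_{\bar\beta}$. *)

theory Defs
  imports "HOL-Analysis.Analysis"
begin

section \<open>Smooth maps\<close>

text \<open>
  Derivatives are taken within \<open>S\<close>, so that for a product \<open>U \<times> {0..<T}\<close> the derivative in the
  last variable is one-sided at \<open>0\<close>.  The notion is meant for sets on which such derivatives are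
  unique (open sets, and products of open sets with nondegenerate intervals).
\<close>

primrec C_k_on :: "nat \<Rightarrow> ('v::euclidean_space \<Rightarrow> 'w::real_normed_vector) \<Rightarrow> 'v set \<Rightarrow> bool" where
  "C_k_on 0 f S \<longleftrightarrow> continuous_on S f"
| "C_k_on (Suc k) f S \<longleftrightarrow>
     (\<exists>f'. (\<forall>x\<in>S. (f has_derivative f' x) (at x within S)) \<and>
           (\<forall>v. C_k_on k (\<lambda>x. f' x v) S))"

definition smooth_on :: "'v set \<Rightarrow> ('v::euclidean_space \<Rightarrow> 'w::real_normed_vector) \<Rightarrow> bool" where
  "smooth_on S f \<longleftrightarrow> (\<forall>k. C_k_on k f S)"

definition holomorphic_map_on ::
    "(complex^'m) set \<Rightarrow> (complex^'m \<Rightarrow> complex^'n) \<Rightarrow> bool" where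
  "holomorphic_map_on S f \<longleftrightarrow>
     (\<forall>z\<in>S. \<exists>D. (f has_derivative D) (at z) \<and> (\<forall>k v. D (k *s v) = k *s D v))"


section \<open>Complex manifolds\<close>

text \<open>
  A chart is a pair of its domain and its coordinate map; values of the map outside the domain
  are irrelevant.  Tensors are given, as in index notation, by their components in every chart of
  a fixed atlas, together with the transformation law on overlaps.
\<close>

type_synonym ('a, 'm) chart = "'a set \<times> ('a \<Rightarrow> complex^'m)"

definition chart_of :: "'a topology \<Rightarrow> ('a, 'm::finite) chart \<Rightarrow> bool" where
  "chart_of M c \<longleftrightarrow>
     openin M (fst c) \<and> open (snd c ` fst c) \<and>
     homeomorphic_map (subtopology M (fst c)) (top_of_set (snd c ` fst c)) (snd c)"

definition in_chart :: "('a, 'm) chart \<Rightarrow> ('a \<Rightarrow> 'b) \<Rightarrow> complex^'m \<Rightarrow> 'b" where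
  "in_chart c h = h \<circ> inv_into (fst c) (snd c)"

definition complex_manifold :: "'a topology \<Rightarrow> ('a, 'm::finite) chart set \<Rightarrow> bool" where
  "complex_manifold M A \<longleftrightarrow>
     Hausdorff_space M \<and> second_countable M \<and>
     (\<forall>c\<in>A. chart_of M c) \<and> \<Union> (fst ` A) = topspace M \<and>
     (\<forall>c\<in>A. \<forall>d\<in>A. holomorphic_map_on (snd c ` (fst c \<inter> fst d)) (in_chart c (snd d)))"

definition compact_complex_manifold :: "'a topology \<Rightarrow> ('a, 'm::finite) chart set \<Rightarrow> bool" where
  "compact_complex_manifold M A \<longleftrightarrow> complex_manifold M A \<and> compact_space M"

definition smooth_in_chart :: "('a, 'm::finite) chart \<Rightarrow> ('a \<Rightarrow> 'b::real_normed_vector) \<Rightarrow> bool" where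
  "smooth_in_chart c h \<longleftrightarrow> smooth_on (snd c ` fst c) (in_chart c h)"

definition smooth_function :: "('a, 'm::finite) chart set \<Rightarrow> ('a \<Rightarrow> 'b::real_normed_vector) \<Rightarrow> bool" where
  "smooth_function A h \<longleftrightarrow> (\<forall>c\<in>A. smooth_in_chart c h)"

definition time_interval :: "ereal \<Rightarrow> real set" where
  "time_interval T = {t. 0 \<le> t \<and> ereal t < T}"

definition smooth_in_spacetime ::
    "('a, 'm::finite) chart set \<Rightarrow> ereal \<Rightarrow> ('a \<Rightarrow> real \<Rightarrow> real) \<Rightarrow> bool" where
  "smooth_in_spacetime A T h \<longleftrightarrow>
     (\<forall>c\<in>A. smooth_on ((snd c ` fst c) \<times> time_interval T) (\<lambda>(z, t). in_chart c (\<lambda>x. h x t) z))"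

definition time_deriv :: "ereal \<Rightarrow> ('a \<Rightarrow> real \<Rightarrow> real) \<Rightarrow> 'a \<Rightarrow> real \<Rightarrow> real" where
  "time_deriv T h x t = vector_derivative (h x) (at t within time_interval T)"


section \<open>Derivatives in local coordinates\<close>

definition chart_deriv ::
    "('a, 'm::finite) chart \<Rightarrow> ('a \<Rightarrow> 'b::real_normed_vector) \<Rightarrow> 'a \<Rightarrow> complex^'m \<Rightarrow> 'b" where
  "chart_deriv c h x = frechet_derivative (in_chart c h) (at (snd c x))"

text \<open>The Wirtinger operators \<open>\<partial>/\<partial>z\<^sup>\<alpha>\<close> and \<open>\<partial>/\<partial>(cnj z\<^sup>\<alpha>)\<close>.\<close>

definition d_z :: "('a, 'm::finite) chart \<Rightarrow> 'm \<Rightarrow> ('a \<Rightarrow> complex) \<Rightarrow> 'a \<Rightarrow> complex" where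
  "d_z c \<alpha> h x =
     (chart_deriv c h x (axis \<alpha> 1) - \<i> * chart_deriv c h x (axis \<alpha> \<i>)) / 2"

definition d_zbar :: "('a, 'm::finite) chart \<Rightarrow> 'm \<Rightarrow> ('a \<Rightarrow> complex) \<Rightarrow> 'a \<Rightarrow> complex" where
  "d_zbar c \<alpha> h x =
     (chart_deriv c h x (axis \<alpha> 1) + \<i> * chart_deriv c h x (axis \<alpha> \<i>)) / 2"

text \<open>The entry in row \<open>\<alpha>\<close> and column \<open>\<beta>\<close> is the component with holomorphic index \<open>\<alpha>\<close> and antiholomorphic index \<open>\<beta>\<close>.\<close>

definition complex_hessian ::
    "('a, 'm::finite) chart \<Rightarrow> ('a \<Rightarrow> real) \<Rightarrow> 'a \<Rightarrow> complex^'m^'m" where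
  "complex_hessian c h x =
     (\<chi> \<alpha> \<beta>. d_z c \<alpha> (d_zbar c \<beta> (\<lambda>y. complex_of_real (h y))) x)"


section \<open>Differential forms and exterior derivatives\<close>

type_synonym ('a, 'm) form1 = "('a, 'm) chart \<Rightarrow> 'a \<Rightarrow> complex^'m \<Rightarrow> real"
type_synonym ('a, 'm) form2 = "('a, 'm) chart \<Rightarrow> 'a \<Rightarrow> complex^'m \<Rightarrow> complex^'m \<Rightarrow> real"

text \<open>
  \<open>chart_deriv c (snd d) x\<close> is the derivative of the transition map from \<open>c\<close> to \<open>d\<close>: it takes
  the coordinates of a tangent vector with respect to \<open>c\<close> to those with respect to \<open>d\<close>.
\<close>

definition one_form :: "('a, 'm::finite) chart set \<Rightarrow> ('a, 'm) form1 \<Rightarrow> bool" where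
  "one_form A \<eta> \<longleftrightarrow>
     (\<forall>c\<in>A. (\<forall>x\<in>fst c. linear (\<eta> c x)) \<and> (\<forall>v. smooth_in_chart c (\<lambda>x. \<eta> c x v))) \<and>
     (\<forall>c\<in>A. \<forall>d\<in>A. \<forall>x\<in>fst c \<inter> fst d. \<forall>v. \<eta> c x v = \<eta> d x (chart_deriv c (snd d) x v))"

definition two_form :: "('a, 'm::finite) chart set \<Rightarrow> ('a, 'm) form2 \<Rightarrow> bool" where
  "two_form A \<omega> \<longleftrightarrow>
     (\<forall>c\<in>A. (\<forall>x\<in>fst c. bilinear (\<omega> c x) \<and> (\<forall>v. \<omega> c x v v = 0)) \<and>
            (\<forall>v w. smooth_in_chart c (\<lambda>x. \<omega> c x v w))) \<and>
     (\<forall>c\<in>A. \<forall>d\<in>A. \<forall>x\<in>fst c \<inter> fst d. \<forall>v w.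
        \<omega> c x v w = \<omega> d x (chart_deriv c (snd d) x v) (chart_deriv c (snd d) x w))"

text \<open>The invariant formulas for \<open>d\<close>, evaluated on constant coordinate vector fields.\<close>

definition ext_deriv1 :: "('a, 'm::finite) form1 \<Rightarrow> ('a, 'm) form2" where
  "ext_deriv1 \<eta> c x v w =
     chart_deriv c (\<lambda>y. \<eta> c y w) x v - chart_deriv c (\<lambda>y. \<eta> c y v) x w"

definition ext_deriv2 ::
    "('a, 'm::finite) form2 \<Rightarrow> ('a, 'm) chart \<Rightarrow> 'a \<Rightarrow>
     complex^'m \<Rightarrow> complex^'m \<Rightarrow> complex^'m \<Rightarrow> real" where
  "ext_deriv2 \<omega> c x u v w =
     chart_deriv c (\<lambda>y. \<omega> c y v w) x u - chart_deriv c (\<lambda>y. \<omega> c y u w) x v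
     + chart_deriv c (\<lambda>y. \<omega> c y u v) x w"

definition closed_two_form :: "('a, 'm::finite) chart set \<Rightarrow> ('a, 'm) form2 \<Rightarrow> bool" where
  "closed_two_form A \<omega> \<longleftrightarrow>
     two_form A \<omega> \<and> (\<forall>c\<in>A. \<forall>x\<in>fst c. \<forall>u v w. ext_deriv2 \<omega> c x u v w = 0)"

definition exact_two_form :: "('a, 'm::finite) chart set \<Rightarrow> ('a, 'm) form2 \<Rightarrow> bool" where
  "exact_two_form A \<omega> \<longleftrightarrow>
     (\<exists>\<eta>. one_form A \<eta> \<and> (\<forall>c\<in>A. \<forall>x\<in>fst c. \<forall>v w. \<omega> c x v w = ext_deriv1 \<eta> c x v w))"

definition de_rham_class :: "('a, 'm::finite) chart set \<Rightarrow> ('a, 'm) form2 \<Rightarrow> ('a, 'm) form2 set" where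
  "de_rham_class A \<omega> =
     {\<omega>'. closed_two_form A \<omega>' \<and> exact_two_form A (\<lambda>c x v w. \<omega>' c x v w - \<omega> c x v w)}"


section \<open>Hermitian and Kaehler metrics\<close>

text \<open>
  \<open>g c x $ \<alpha> $ \<beta>\<close> is the component of \<open>g\<close> with holomorphic index \<open>\<alpha>\<close> and antiholomorphic index \<open>\<beta>\<close> in the chart \<open>c\<close> at \<open>x\<close>.
\<close>

type_synonym ('a, 'm) tensor11 = "('a, 'm) chart \<Rightarrow> 'a \<Rightarrow> complex^'m^'m"

definition sesq_form :: "complex^'m^'m \<Rightarrow> complex^'m \<Rightarrow> complex^'m \<Rightarrow> complex" where
  "sesq_form H v w = (\<Sum>\<alpha>\<in>UNIV. \<Sum>\<beta>\<in>UNIV. H $ \<alpha> $ \<beta> * v $ \<alpha> * cnj (w $ \<beta>))"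

definition hermitian_metric :: "('a, 'm::finite) chart set \<Rightarrow> ('a, 'm) tensor11 \<Rightarrow> bool" where
  "hermitian_metric A g \<longleftrightarrow>
     (\<forall>c\<in>A. smooth_in_chart c (g c) \<and>
        (\<forall>x\<in>fst c. (\<forall>\<alpha> \<beta>. g c x $ \<beta> $ \<alpha> = cnj (g c x $ \<alpha> $ \<beta>)) \<and>
                   (\<forall>v. v \<noteq> 0 \<longrightarrow> 0 < Re (sesq_form (g c x) v v)))) \<and>
     (\<forall>c\<in>A. \<forall>d\<in>A. \<forall>x\<in>fst c \<inter> fst d. \<forall>v w.
        sesq_form (g c x) v w =
        sesq_form (g d x) (chart_deriv c (snd d) x v) (chart_deriv c (snd d) x w))"

text \<open>
  The real form \<open>\<i> \<Sum> h\<^sub>\<alpha>\<^sub>\<beta> dz\<^sup>\<alpha> \<and> d(cnj z\<^sup>\<beta>)\<close> of a Hermitian \<open>h\<close>, where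
  \<open>(dz\<^sup>\<alpha> \<and> d(cnj z\<^sup>\<beta>))(v, w) = v\<^sup>\<alpha> cnj w\<^sup>\<beta> - w\<^sup>\<alpha> cnj v\<^sup>\<beta>\<close>; since \<open>sesq_form h w v\<close> is the conjugate of
  \<open>sesq_form h v w\<close>, the value on \<open>(v, w)\<close> is \<open>\<i> * (2 * \<i> * Im (sesq_form h v w))\<close>.
\<close>

definition real_form11 :: "('a, 'm::finite) tensor11 \<Rightarrow> ('a, 'm) form2" where
  "real_form11 h c x v w = - 2 * Im (sesq_form (h c x) v w)"

definition kahler_metric :: "('a, 'm::finite) chart set \<Rightarrow> ('a, 'm) tensor11 \<Rightarrow> bool" where
  "kahler_metric A g \<longleftrightarrow> hermitian_metric A g \<and> closed_two_form A (real_form11 g)"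

text \<open>The determinant of a Hermitian matrix is real, hence the real part below.\<close>

definition metric_det :: "('a, 'm::finite) tensor11 \<Rightarrow> ('a, 'm) chart \<Rightarrow> 'a \<Rightarrow> real" where
  "metric_det g c x = Re (det (g c x))"

definition ricci :: "('a, 'm::finite) tensor11 \<Rightarrow> ('a, 'm) tensor11" where
  "ricci g c x = - complex_hessian c (\<lambda>y. ln (metric_det g c y)) x"

text \<open>
  By Chern--Weil theory the real first Chern class is represented by the (Chern--)Ricci form of
  any Hermitian metric, divided by \<open>2\<pi>\<close>.  The class does not depend on the metric, so the union
  is a single de Rham class.
\<close>

definition first_chern_class :: "('a, 'm::finite) chart set \<Rightarrow> ('a, 'm) form2 set" where
  "first_chern_class A =
     (\<Union>h\<in>{h. hermitian_metric A h}.
        de_rham_class A (\<lambda>c x v w. real_form11 (ricci h) c x v w / (2 * pi)))"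

text \<open>
  The inverse \<open>g\<^sup>\<alpha>\<^sup>\<beta>\<close> is defined by \<open>\<Sum>\<^sub>\<beta> g\<^sup>\<alpha>\<^sup>\<beta> g\<^sub>\<gamma>\<^sub>\<beta> = \<delta>\<close> (barred second indices), which makes it the
  inverse of the transposed matrix.  The sum below is real for real \<open>u\<close>.
\<close>

definition grad_norm2 ::
    "('a, 'm::finite) tensor11 \<Rightarrow> ('a, 'm) chart \<Rightarrow> ('a \<Rightarrow> real) \<Rightarrow> 'a \<Rightarrow> real" where
  "grad_norm2 g c u x =
     Re (\<Sum>\<alpha>\<in>UNIV. \<Sum>\<beta>\<in>UNIV. matrix_inv (transpose (g c x)) $ \<alpha> $ \<beta> *
           d_z c \<alpha> (\<lambda>y. complex_of_real (u y)) x *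
           d_zbar c \<beta> (\<lambda>y. complex_of_real (u y)) x)"

end

theory Submission
  imports Defs
begin

text \<open>
  The proof is a maximum principle for \<open>F = t (u\<^sub>t - |\<nabla>u|\<^sup>2 / u) + m u\<close>, a form of the
  differential Harnack quantity for which \<open>F\<^sub>t - \<Delta>F \<ge> P F / m\<close> with
  \<open>P = u\<^sub>t / u - |\<nabla>u|\<^sup>2 / u\<^sup>2\<close>; at a negative minimum both \<open>P\<close> and \<open>F\<close> are negative, which is
  absurd.  The curvature term of the Bochner formula cancels because the complex
  Hessian of \<open>u\<close> is the Ricci tensor of \<open>g(t)\<close>.

  Neither covariant derivatives nor normal coordinates are needed: \<open>F\<close> is the minimum over tangent
  vectors \<open>V\<close> of \<open>t (u\<^sub>t - D\<^sub>V u + u |V|\<^sup>2) + m u\<close>, so at a minimum of \<open>F\<close> one may differentiate this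
  expression along any vector field through \<open>\<nabla>u / u\<close>.  For each vector \<open>e\<close> of a unitary frame, a field
  that is affine in \<open>\<zeta>\<close> along the complex line \<open>z + \<zeta> e\<close> suffices.

  To stay inside the open time interval, \<open>t\<close> is replaced by \<open>t - \<epsilon>\<close> on \<open>[\<epsilon>, t\<^sub>1]\<close>, and
  \<open>\<epsilon> \<rightarrow> 0\<close> at the end.
\<close>

section \<open>Smooth functions and directional derivatives\<close>

text \<open>The number m enters through a single inequality. Since u solves the heat equation u_t =
  \<Delta>u of g(t), the quantity P is \<Delta> ln u, the trace of the complex Hessian B of ln u,
  and P^2 <= m |B|^2 by Cauchy-Schwarz. With \<tau> the time elapsed since \<epsilon>, the tests at
  a minimum combine to P + \<tau> |B|^2 <= 0, while F < 0 means \<tau> P + m < 0; the trace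
  inequality excludes both at once. The square |B|^2 appears because the barrier is quadratic in the
  slope of the affine field, and the best slope completes the square. The first derivatives of the
  metric that remain are not invariant; they cancel against those in the derivative of the heat
  equation and in the formula for the Ricci tensor. The value Ric(V, V) occurs twice: in the time
  derivative of |V|^2, because g_t = -Ric, and in the trace of the second space derivatives of
  |V|^2. The minimum is taken on the manifold but the calculus lives in charts; the bridge is the
  description of |\<nabla>u|^2 as the maximum of D_W u - |W|^2 over tangent vectors W.\<close>

lemma C_k_on_cong:
  assumes "C_k_on k f S" "\<And>x. x \<in> S \<Longrightarrow> f x = g x"
  shows "C_k_on k g S"
proof (cases k)
  case 0
  then show ?thesis using assms by (simp cong: continuous_on_cong)
next
  case (Suc n)
  then obtain f' where f': "\<And>x. x \<in> S \<Longrightarrow> (f has_derivative f' x) (at x within S)"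
    and C: "\<And>v. C_k_on n (\<lambda>x. f' x v) S" using assms by auto
  have "(g has_derivative f' x) (at x within S)" if "x \<in> S" for x
    using has_derivative_transform[OF that _ f'[OF that], of g] assms(2) by auto
  then show ?thesis using Suc C by auto
qed

lemma C_k_on_SucE:
  assumes "C_k_on (Suc k) f S"
  obtains f' where "\<And>x. x \<in> S \<Longrightarrow> (f has_derivative f' x) (at x within S)"
    "\<And>v. C_k_on k (\<lambda>x. f' x v) S"
  using assms by auto

lemma C_k_on_Suc_imp: "C_k_on (Suc k) f S \<Longrightarrow> C_k_on k f S"
proof (induction k arbitrary: f)
  case 0
  then show ?case
    by (auto simp: continuous_on_eq_continuous_within intro: has_derivative_continuous)
next
  case (Suc k)
  then obtain f' where "\<And>x. x \<in> S \<Longrightarrow> (f has_derivative f' x) (at x within S)"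
    "\<And>v. C_k_on (Suc k) (\<lambda>x. f' x v) S" by (auto simp only: C_k_on.simps)
  then show ?case using Suc.IH by (subst C_k_on.simps) blast
qed

lemma C_k_on_subset: "C_k_on k f S \<Longrightarrow> R \<subseteq> S \<Longrightarrow> C_k_on k f R"
proof (induction k arbitrary: f)
  case 0
  then show ?case by (auto intro: continuous_on_subset)
next
  case (Suc k)
  then obtain f' where "\<And>x. x \<in> S \<Longrightarrow> (f has_derivative f' x) (at x within S)"
    "\<And>v. C_k_on k (\<lambda>x. f' x v) S" by auto
  then show ?case using Suc.IH Suc.prems(2)
    by (auto intro!: exI[of _ f'] has_derivative_subset[where s = S and t = R])
qed

lemma C_k_on_const: "C_k_on k (\<lambda>x. a) S"
proof (induction k arbitrary: a)
  case (Suc k)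
  then show ?case by (auto intro!: exI[of _ "\<lambda>x v. 0"] derivative_eq_intros)
qed auto

lemma C_k_on_add: "C_k_on k f S \<Longrightarrow> C_k_on k g S \<Longrightarrow> C_k_on k (\<lambda>x. f x + g x) S"
proof (induction k arbitrary: f g)
  case 0
  then show ?case by (auto intro: continuous_intros)
next
  case (Suc k)
  obtain f' where "\<And>x. x \<in> S \<Longrightarrow> (f has_derivative f' x) (at x within S)"
    "\<And>v. C_k_on k (\<lambda>x. f' x v) S" using Suc.prems(1) by (rule C_k_on_SucE) blast
  moreover obtain g' where "\<And>x. x \<in> S \<Longrightarrow> (g has_derivative g' x) (at x within S)"
    "\<And>v. C_k_on k (\<lambda>x. g' x v) S" using Suc.prems(2) by (rule C_k_on_SucE) blast
  ultimately show ?case using Suc.IH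
    by (auto intro!: exI[of _ "\<lambda>x v. f' x v + g' x v"] derivative_eq_intros)
qed

lemma C_k_on_bilinear:
  assumes b: "bounded_bilinear b"
  shows "C_k_on k f S \<Longrightarrow> C_k_on k g S \<Longrightarrow> C_k_on k (\<lambda>x. b (f x) (g x)) S"
proof (induction k arbitrary: f g)
  case 0
  then show ?case by (auto intro: bounded_bilinear.continuous_on[OF b])
next
  case (Suc k)
  obtain f' where "\<And>x. x \<in> S \<Longrightarrow> (f has_derivative f' x) (at x within S)"
    "\<And>v. C_k_on k (\<lambda>x. f' x v) S" using Suc.prems(1) by (rule C_k_on_SucE) blast
  moreover obtain g' where "\<And>x. x \<in> S \<Longrightarrow> (g has_derivative g' x) (at x within S)"
    "\<And>v. C_k_on k (\<lambda>x. g' x v) S" using Suc.prems(2) by (rule C_k_on_SucE) blast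
  \<comment> \<open>The product rule keeps one factor undifferentiated, and the induction hypothesis
    needs it at order \<open>k\<close> only.\<close>
  ultimately show ?case using Suc.IH C_k_on_Suc_imp[OF Suc.prems(1)] C_k_on_Suc_imp[OF Suc.prems(2)]
    by (auto intro!: exI[of _ "\<lambda>x v. b (f x) (g' x v) + b (f' x v) (g x)"]
        bounded_bilinear.FDERIV[OF b] C_k_on_add)
qed

lemma C_k_on_linear:
  assumes L: "bounded_linear L"
  shows "C_k_on k f S \<Longrightarrow> C_k_on k (\<lambda>x. L (f x)) S"
proof (induction k arbitrary: f)
  case 0
  then show ?case by (auto intro: bounded_linear.continuous_on[OF L])
next
  case (Suc k)
  then obtain f' where "\<And>x. x \<in> S \<Longrightarrow> (f has_derivative f' x) (at x within S)"
    "\<And>v. C_k_on k (\<lambda>x. f' x v) S" by auto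
  then show ?case using Suc.IH
    by (auto intro!: exI[of _ "\<lambda>x v. L (f' x v)"] bounded_linear.has_derivative[OF L])
qed

text \<open>The linear map of interest is the projection from space-time to space, along which
  time-independent functions are pulled back.\<close>

lemma C_k_on_compose_linear:
  assumes L: "bounded_linear L" and sub: "L ` R \<subseteq> S"
  shows "C_k_on k f S \<Longrightarrow> C_k_on k (\<lambda>x. f (L x)) R"
proof (induction k arbitrary: f)
  case 0
  then show ?case using sub
    by (auto intro!: continuous_on_compose2[of S f R L] linear_continuous_on[OF L])
next
  case (Suc k)
  then obtain f' where f': "\<And>x. x \<in> S \<Longrightarrow> (f has_derivative f' x) (at x within S)"
    "\<And>v. C_k_on k (\<lambda>x. f' x v) S" by auto
  have "((\<lambda>x. f (L x)) has_derivative (\<lambda>v. f' (L x) (L v))) (at x within R)" if "x \<in> R" for x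
    using has_derivative_subset[OF f'(1) sub, of "L x"] sub that
    by (intro has_derivative_in_compose[OF bounded_linear_imp_has_derivative[OF L]]) auto
  then show ?case using Suc.IH f'(2)
    by (auto intro!: exI[of _ "\<lambda>x v. f' (L x) (L v)"])
qed

text \<open>The derivative is a product of \<open>f'\<close> with inverses of \<open>f\<close>, so
  order \<open>k\<close> of the inverse yields order \<open>k + 1\<close>.\<close>

lemma C_k_on_inverse:
  fixes f :: "'v::euclidean_space \<Rightarrow> 'w::real_normed_field"
  assumes nz: "\<And>x. x \<in> S \<Longrightarrow> f x \<noteq> 0"
  shows "C_k_on k f S \<Longrightarrow> C_k_on k (\<lambda>x. inverse (f x)) S"
proof (induction k)
  case 0
  then show ?case using nz by (auto intro: continuous_intros)
next
  case (Suc k)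
  then obtain f' where f': "\<And>x. x \<in> S \<Longrightarrow> (f has_derivative f' x) (at x within S)"
    "\<And>v. C_k_on k (\<lambda>x. f' x v) S" by auto
  have "((\<lambda>x. inverse (f x)) has_derivative (\<lambda>v. - (inverse (f x) * f' x v * inverse (f x)))) (at x within S)"
    if "x \<in> S" for x
    using nz[OF that] f'(1)[OF that] by (auto intro!: derivative_eq_intros)
  moreover have "C_k_on k (\<lambda>x. - (inverse (f x) * f' x v * inverse (f x))) S" for v
    using Suc.IH[OF C_k_on_Suc_imp[OF Suc.prems]] f'(2)
    by (intro C_k_on_linear[OF bounded_linear_minus[OF bounded_linear_ident]]
        C_k_on_bilinear[OF bounded_bilinear_mult]) auto
  ultimately show ?case
    by (auto intro!: exI[of _ "\<lambda>x v. - (inverse (f x) * f' x v * inverse (f x))"])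
qed

text \<open>No induction on the logarithm is required: its derivative involves only
  \<open>f'\<close> and the inverse of \<open>f\<close>.\<close>

lemma C_k_on_ln:
  fixes f :: "'v::euclidean_space \<Rightarrow> real"
  assumes pos: "\<And>x. x \<in> S \<Longrightarrow> 0 < f x" and C: "C_k_on k f S"
  shows "C_k_on k (\<lambda>x. ln (f x)) S"
proof (cases k)
  case 0
  then show ?thesis using assms by (auto intro!: continuous_intros dest: pos)
next
  case (Suc n)
  then obtain f' where f': "\<And>x. x \<in> S \<Longrightarrow> (f has_derivative f' x) (at x within S)"
    "\<And>v. C_k_on n (\<lambda>x. f' x v) S" using C by auto
  have "((\<lambda>x. ln (f x)) has_derivative (\<lambda>v. f' x v * inverse (f x))) (at x within S)"
    if "x \<in> S" for x
    using pos[OF that] f'(1)[OF that] by (auto intro!: derivative_eq_intros simp: divide_inverse)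
  moreover have "C_k_on n (\<lambda>x. f' x v * inverse (f x)) S" for v
    using C_k_on_Suc_imp[of n f S] C Suc f'(2) pos
    by (intro C_k_on_inverse C_k_on_bilinear[OF bounded_bilinear_mult]) (auto dest: pos)
  ultimately show ?thesis unfolding Suc
    by (auto intro!: exI[of _ "\<lambda>x v. f' x v * inverse (f x)"])
qed

lemma smooth_on_cong: "smooth_on S f \<Longrightarrow> (\<And>x. x \<in> S \<Longrightarrow> f x = g x) \<Longrightarrow> smooth_on S g"
  unfolding smooth_on_def by (blast intro: C_k_on_cong)

lemma smooth_on_subset: "smooth_on S f \<Longrightarrow> R \<subseteq> S \<Longrightarrow> smooth_on R f"
  unfolding smooth_on_def by (blast intro: C_k_on_subset)

lemma smooth_on_const: "smooth_on S (\<lambda>x. a)"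
  by (simp add: smooth_on_def C_k_on_const)

lemma smooth_on_add: "smooth_on S f \<Longrightarrow> smooth_on S g \<Longrightarrow> smooth_on S (\<lambda>x. f x + g x)"
  by (simp add: smooth_on_def C_k_on_add)

lemma smooth_on_linear: "bounded_linear L \<Longrightarrow> smooth_on S f \<Longrightarrow> smooth_on S (\<lambda>x. L (f x))"
  by (simp add: smooth_on_def C_k_on_linear)

lemma smooth_on_minus: "smooth_on S f \<Longrightarrow> smooth_on S (\<lambda>x. - f x)"
  by (rule smooth_on_linear[OF bounded_linear_minus[OF bounded_linear_ident]])

lemma smooth_on_diff: "smooth_on S f \<Longrightarrow> smooth_on S g \<Longrightarrow> smooth_on S (\<lambda>x. f x - g x)"
  using smooth_on_add[OF _ smooth_on_minus, of S f g] by simp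

lemma smooth_on_mult:
  fixes f g :: "'v::euclidean_space \<Rightarrow> 'w::real_normed_algebra"
  shows "smooth_on S f \<Longrightarrow> smooth_on S g \<Longrightarrow> smooth_on S (\<lambda>x. f x * g x)"
  by (simp add: smooth_on_def C_k_on_bilinear[OF bounded_bilinear_mult])

lemma smooth_on_sum:
  "(\<And>i. i \<in> I \<Longrightarrow> smooth_on S (f i)) \<Longrightarrow> smooth_on S (\<lambda>x. \<Sum>i\<in>I. f i x)"
  by (induction I rule: infinite_finite_induct) (auto intro: smooth_on_const smooth_on_add)

lemma smooth_on_prod:
  fixes f :: "'i \<Rightarrow> 'v::euclidean_space \<Rightarrow> 'w::real_normed_field"
  shows "(\<And>i. i \<in> I \<Longrightarrow> smooth_on S (f i)) \<Longrightarrow> smooth_on S (\<lambda>x. \<Prod>i\<in>I. f i x)"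
  by (induction I rule: infinite_finite_induct) (auto intro: smooth_on_const smooth_on_mult)

lemma smooth_on_compose_linear:
  "bounded_linear L \<Longrightarrow> L ` R \<subseteq> S \<Longrightarrow> smooth_on S f \<Longrightarrow> smooth_on R (\<lambda>x. f (L x))"
  unfolding smooth_on_def by (blast intro: C_k_on_compose_linear)

lemma smooth_on_ln:
  fixes f :: "'v::euclidean_space \<Rightarrow> real"
  shows "(\<And>x. x \<in> S \<Longrightarrow> 0 < f x) \<Longrightarrow> smooth_on S f \<Longrightarrow> smooth_on S (\<lambda>x. ln (f x))"
  by (simp add: smooth_on_def C_k_on_ln)

lemma smooth_on_continuous: "smooth_on S f \<Longrightarrow> continuous_on S f"
  unfolding smooth_on_def using C_k_on.simps(1) by blast

lemmas smooth_on_of_real = smooth_on_linear[OF bounded_linear_of_real]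
lemmas smooth_on_Re = smooth_on_linear[OF bounded_linear_Re]
lemmas smooth_on_Im = smooth_on_linear[OF bounded_linear_Im]

lemmas smooth_on_intros = smooth_on_const smooth_on_add smooth_on_minus smooth_on_diff
  smooth_on_mult smooth_on_sum smooth_on_prod smooth_on_of_real smooth_on_Re smooth_on_Im

text \<open>The point comes last, so that \<open>dir_deriv X f\<close> is again a function and
  derivatives can be iterated. The derivative is two-sided, which is why everything below takes
  place on open sets.\<close>

definition dir_deriv :: "'v::real_normed_vector \<Rightarrow> ('v \<Rightarrow> 'w::real_normed_vector) \<Rightarrow> 'v \<Rightarrow> 'w" where
  "dir_deriv X f x = frechet_derivative f (at x) X"

lemma dir_deriv_eq: "(f has_derivative f') (at x) \<Longrightarrow> dir_deriv X f x = f' X"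
  unfolding dir_deriv_def by (metis frechet_derivative_at)

lemma smooth_on_has_derivative:
  assumes "smooth_on S f" "open S" "x \<in> S"
  shows "(f has_derivative (\<lambda>X. dir_deriv X f x)) (at x)"
proof -
  have "C_k_on (Suc 0) f S" using assms(1) unfolding smooth_on_def by blast
  then obtain f' where "(f has_derivative f' x) (at x within S)" using assms(3) by auto
  then have "(f has_derivative f' x) (at x)" using at_within_open[OF assms(3,2)] by simp
  moreover from this have "(\<lambda>X. dir_deriv X f x) = f' x" by (auto intro: dir_deriv_eq)
  ultimately show ?thesis by simp
qed

lemma smooth_on_dir_deriv:
  assumes "smooth_on S f" "open S"
  shows "smooth_on S (dir_deriv X f)"
  unfolding smooth_on_def
proof
  fix k
  have "C_k_on (Suc k) f S" using assms(1) unfolding smooth_on_def by blast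
  then obtain f' where f': "\<And>x. x \<in> S \<Longrightarrow> (f has_derivative f' x) (at x within S)"
    and C: "C_k_on k (\<lambda>x. f' x X) S" by auto
  show "C_k_on k (dir_deriv X f) S"
    using C_k_on_cong[OF C, of "dir_deriv X f"] f' at_within_open[OF _ assms(2)] dir_deriv_eq by metis
qed

context
  fixes S :: "'v::euclidean_space set" and x :: 'v
  assumes S: "open S" "x \<in> S"
begin

lemma dir_deriv_linear: "smooth_on S f \<Longrightarrow> linear (\<lambda>X. dir_deriv X f x)"
  using smooth_on_has_derivative[OF _ S] has_derivative_linear by blast

lemma dir_deriv_cong:
  assumes f: "smooth_on S f" and "\<And>y. y \<in> S \<Longrightarrow> f y = g y"
  shows "dir_deriv X g x = dir_deriv X f x"
  using has_derivative_transform_within_open[OF smooth_on_has_derivative[OF f S] S, of g] assms(2)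
  by (intro dir_deriv_eq) auto

lemma dir_deriv_const: "dir_deriv X (\<lambda>y. a) x = 0"
  by (simp add: dir_deriv_def)

lemma dir_deriv_add:
  assumes "smooth_on S f" "smooth_on S g"
  shows "dir_deriv X (\<lambda>y. f y + g y) x = dir_deriv X f x + dir_deriv X g x"
  by (rule dir_deriv_eq[OF has_derivative_add[OF smooth_on_has_derivative[OF assms(1) S]
        smooth_on_has_derivative[OF assms(2) S]]])

lemma dir_deriv_bounded_linear:
  assumes "bounded_linear L" "smooth_on S f"
  shows "dir_deriv X (\<lambda>y. L (f y)) x = L (dir_deriv X f x)"
  by (rule dir_deriv_eq[OF bounded_linear.has_derivative[OF assms(1)
        smooth_on_has_derivative[OF assms(2) S]]])

lemma dir_deriv_minus:
  assumes "smooth_on S f"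
  shows "dir_deriv X (\<lambda>y. - f y) x = - dir_deriv X f x"
  by (rule dir_deriv_eq[OF has_derivative_minus[OF smooth_on_has_derivative[OF assms S]]])

lemma dir_deriv_diff:
  assumes "smooth_on S f" "smooth_on S g"
  shows "dir_deriv X (\<lambda>y. f y - g y) x = dir_deriv X f x - dir_deriv X g x"
  by (rule dir_deriv_eq[OF has_derivative_diff[OF smooth_on_has_derivative[OF assms(1) S]
        smooth_on_has_derivative[OF assms(2) S]]])

lemma dir_deriv_mult:
  fixes f g :: "'v \<Rightarrow> 'w::real_normed_algebra"
  assumes "smooth_on S f" "smooth_on S g"
  shows "dir_deriv X (\<lambda>y. f y * g y) x = f x * dir_deriv X g x + dir_deriv X f x * g x"
  by (rule dir_deriv_eq[OF has_derivative_mult[OF smooth_on_has_derivative[OF assms(1) S]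
        smooth_on_has_derivative[OF assms(2) S]]])

lemma dir_deriv_sum:
  assumes "\<And>i. i \<in> I \<Longrightarrow> smooth_on S (f i)"
  shows "dir_deriv X (\<lambda>y. \<Sum>i\<in>I. f i y) x = (\<Sum>i\<in>I. dir_deriv X (f i) x)"
  by (rule dir_deriv_eq[OF has_derivative_sum[OF smooth_on_has_derivative[OF assms S]]])

lemma dir_deriv_ln:
  fixes f :: "'v \<Rightarrow> real"
  assumes "smooth_on S f" "0 < f x"
  shows "dir_deriv X (\<lambda>y. ln (f y)) x = dir_deriv X f x * inverse (f x)"
proof (rule dir_deriv_eq)
  have "(f has_derivative (\<lambda>X. dir_deriv X f x)) (at x)"
    using smooth_on_has_derivative assms S by blast
  then show "((\<lambda>y. ln (f y)) has_derivative (\<lambda>X. dir_deriv X f x * inverse (f x))) (at x)"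
    using assms(2) by (auto intro!: derivative_eq_intros simp: divide_inverse)
qed

end

lemma smooth_on_along_line:
  assumes "smooth_on S f" "open S" "x + s *\<^sub>R X \<in> S"
  shows "((\<lambda>s. f (x + s *\<^sub>R X)) has_vector_derivative dir_deriv X f (x + s *\<^sub>R X)) (at s within R)"
proof -
  have f: "(f has_derivative (\<lambda>Y. dir_deriv Y f (x + s *\<^sub>R X))) (at (x + s *\<^sub>R X))"
    using smooth_on_has_derivative assms by blast
  have "((\<lambda>s. x + s *\<^sub>R X) has_derivative (\<lambda>h. h *\<^sub>R X)) (at s within R)"
    by (auto intro!: derivative_eq_intros)
  from has_derivative_compose[OF this] f
  have "((\<lambda>s. f (x + s *\<^sub>R X)) has_derivative (\<lambda>h. dir_deriv (h *\<^sub>R X) f (x + s *\<^sub>R X))) (at s within R)" .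
  moreover have "dir_deriv (h *\<^sub>R X) f (x + s *\<^sub>R X) = h *\<^sub>R dir_deriv X f (x + s *\<^sub>R X)" for h
    using linear_cmul[OF dir_deriv_linear[OF assms(2,3,1)]] by simp
  ultimately show ?thesis by (simp add: has_vector_derivative_def)
qed

text \<open>Schwarz: both mixed derivatives are limits of the same second difference quotient.\<close>

lemma second_difference:
  fixes f :: "'v::euclidean_space \<Rightarrow> real"
  assumes f: "smooth_on S f" "open S" and h: "0 < h"
    and sub: "\<And>a b. 0 \<le> a \<Longrightarrow> a \<le> h \<Longrightarrow> 0 \<le> b \<Longrightarrow> b \<le> h \<Longrightarrow> x + a *\<^sub>R X + b *\<^sub>R Y \<in> S"
  shows "\<exists>a b. 0 < a \<and> a < h \<and> 0 < b \<and> b < h \<and>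
    f (x + h *\<^sub>R X + h *\<^sub>R Y) - f (x + h *\<^sub>R X) - f (x + h *\<^sub>R Y) + f x
      = h * h * dir_deriv Y (dir_deriv X f) (x + a *\<^sub>R X + b *\<^sub>R Y)"
proof -
  \<comment> \<open>The mean value theorem is applied twice: in the direction \<open>X\<close> to
    the increment of \<open>f\<close> over \<open>h *\<^sub>R Y\<close>, then in the direction
    \<open>Y\<close> to the derivative along \<open>X\<close>.\<close>
  let ?q = "\<lambda>a. f (x + a *\<^sub>R X + h *\<^sub>R Y) - f (x + a *\<^sub>R X)"
  have q: "(?q has_real_derivative (dir_deriv X f (x + a *\<^sub>R X + h *\<^sub>R Y) - dir_deriv X f (x + a *\<^sub>R X))) (at a)"
    if "0 \<le> a" "a \<le> h" for a
  proof -
    have "x + a *\<^sub>R X + h *\<^sub>R Y \<in> S" "x + a *\<^sub>R X \<in> S"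
      using sub[OF that, of h] sub[OF that, of 0] h by auto
    then have "((\<lambda>a. f (x + h *\<^sub>R Y + a *\<^sub>R X) - f (x + a *\<^sub>R X)) has_vector_derivative
        (dir_deriv X f (x + h *\<^sub>R Y + a *\<^sub>R X) - dir_deriv X f (x + a *\<^sub>R X))) (at a)"
      by (intro has_vector_derivative_diff smooth_on_along_line[OF f]) (simp_all add: ac_simps)
    then show ?thesis
      by (simp add: has_real_derivative_iff_has_vector_derivative ac_simps)
  qed
  obtain a where a: "0 < a" "a < h" and
    "?q h - ?q 0 = (h - 0) * (dir_deriv X f (x + a *\<^sub>R X + h *\<^sub>R Y) - dir_deriv X f (x + a *\<^sub>R X))"
    using MVT2[OF h q] by blast
  moreover
  let ?r = "\<lambda>b. dir_deriv X f (x + a *\<^sub>R X + b *\<^sub>R Y)"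
  have r: "(?r has_real_derivative dir_deriv Y (dir_deriv X f) (x + a *\<^sub>R X + b *\<^sub>R Y)) (at b)"
    if "0 \<le> b" "b \<le> h" for b
    using smooth_on_along_line[OF smooth_on_dir_deriv[OF f, of X] f(2), of "x + a *\<^sub>R X" b Y UNIV]
      sub[of a b] that a by (auto simp: has_real_derivative_iff_has_vector_derivative)
  obtain b where "0 < b" "b < h" "?r h - ?r 0 = (h - 0) * dir_deriv Y (dir_deriv X f) (x + a *\<^sub>R X + b *\<^sub>R Y)"
    using MVT2[OF h r] by blast
  ultimately show ?thesis by (intro exI[of _ a] exI[of _ b]) (simp add: algebra_simps)
qed

lemma dir_deriv_commute_real:
  fixes f :: "'v::euclidean_space \<Rightarrow> real"
  assumes f: "smooth_on S f" "open S" "x \<in> S"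
  shows "dir_deriv X (dir_deriv Y f) x = dir_deriv Y (dir_deriv X f) x"
proof (rule ccontr)
  let ?A = "dir_deriv X (dir_deriv Y f)" and ?B = "dir_deriv Y (dir_deriv X f)"
  assume ne: "?A x \<noteq> ?B x"
  \<comment> \<open>Half of the gap: two values within \<open>e\<close> of the two limits cannot
    coincide.\<close>
  define e where "e = \<bar>?A x - ?B x\<bar> / 2"
  have e: "0 < e" using ne by (simp add: e_def)
  have cont: "continuous (at x) ?A" "continuous (at x) ?B"
    using smooth_on_continuous[OF smooth_on_dir_deriv[OF smooth_on_dir_deriv[OF f(1,2)] f(2)]] f(2,3)
    by (auto simp: continuous_on_eq_continuous_at)
  obtain d1 where d1: "0 < d1" "\<And>y. dist y x < d1 \<Longrightarrow> \<bar>?A y - ?A x\<bar> < e"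
    using cont(1) e unfolding continuous_at_eps_delta by (metis dist_real_def dist_norm)
  obtain d2 where d2: "0 < d2" "\<And>y. dist y x < d2 \<Longrightarrow> \<bar>?B y - ?B x\<bar> < e"
    using cont(2) e unfolding continuous_at_eps_delta by (metis dist_real_def dist_norm)
  obtain d3 where d3: "0 < d3" "ball x d3 \<subseteq> S" using f(2,3) openE by blast
  define d where "d = min d1 (min d2 d3)"
  \<comment> \<open>The parallelogram with sides \<open>h *\<^sub>R X\<close> and
    \<open>h *\<^sub>R Y\<close> then stays within distance \<open>d\<close> of \<open>x\<close>;
    the summand 1 keeps the denominator positive when both vectors vanish.\<close>
  define h where "h = d / (2 * (norm X + norm Y + 1))"
  have N: "0 < norm X + norm Y + 1" by (simp add: add_nonneg_pos)
  have h: "0 < h" using d1 d2 d3 N by (simp add: h_def d_def)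
  have near: "dist (x + a *\<^sub>R X + b *\<^sub>R Y) x < d" if "0 \<le> a" "a \<le> h" "0 \<le> b" "b \<le> h" for a b
  proof -
    have "norm (a *\<^sub>R X + b *\<^sub>R Y) \<le> a * norm X + b * norm Y"
      using norm_triangle_ineq[of "a *\<^sub>R X" "b *\<^sub>R Y"] that by simp
    also have "\<dots> \<le> h * norm X + h * norm Y" using that by (intro add_mono mult_right_mono) auto
    also have "\<dots> < 2 * (h * (norm X + norm Y + 1))"
      using h mult_nonneg_nonneg[of h "norm X"] mult_nonneg_nonneg[of h "norm Y"]
      by (simp add: distrib_left add_nonneg_pos add.assoc)
    also have "\<dots> = d" using N unfolding h_def by (simp only: times_divide_eq_right times_divide_eq_left divide_eq_eq) simp
    finally show ?thesis by (simp add: dist_norm add.assoc)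
  qed
  have sub: "x + a *\<^sub>R X + b *\<^sub>R Y \<in> S" if "0 \<le> a" "a \<le> h" "0 \<le> b" "b \<le> h" for a b
    using near[OF that] d3(2) by (auto simp: d_def dist_commute subset_iff)
  have sub': "x + a *\<^sub>R Y + b *\<^sub>R X \<in> S" if "0 \<le> a" "a \<le> h" "0 \<le> b" "b \<le> h" for a b
    using sub[of b a] that by (simp add: algebra_simps)
  obtain a b where ab: "0 < a" "a < h" "0 < b" "b < h" "f (x + h *\<^sub>R X + h *\<^sub>R Y) - f (x + h *\<^sub>R X) - f (x + h *\<^sub>R Y) + f x
      = h * h * ?B (x + a *\<^sub>R X + b *\<^sub>R Y)"
    using second_difference[OF f(1,2) h sub] by blast
  obtain a' b' where ab': "0 < a'" "a' < h" "0 < b'" "b' < h" "f (x + h *\<^sub>R Y + h *\<^sub>R X) - f (x + h *\<^sub>R Y) - f (x + h *\<^sub>R X) + f x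
      = h * h * ?A (x + a' *\<^sub>R Y + b' *\<^sub>R X)"
    using second_difference[OF f(1,2) h sub'] by blast
  have sw: "x + h *\<^sub>R Y + h *\<^sub>R X = x + h *\<^sub>R X + h *\<^sub>R Y" "x + a' *\<^sub>R Y + b' *\<^sub>R X = x + b' *\<^sub>R X + a' *\<^sub>R Y"
    by simp_all
  have "h * h * ?B (x + a *\<^sub>R X + b *\<^sub>R Y) = h * h * ?A (x + b' *\<^sub>R X + a' *\<^sub>R Y)"
    using ab(5) ab'(5) unfolding sw by linarith
  then have "?B (x + a *\<^sub>R X + b *\<^sub>R Y) = ?A (x + b' *\<^sub>R X + a' *\<^sub>R Y)" using h by simp
  moreover have "\<bar>?B (x + a *\<^sub>R X + b *\<^sub>R Y) - ?B x\<bar> < e"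
    using near[of a b] ab by (intro d2(2)) (simp add: d_def)
  moreover have "\<bar>?A (x + b' *\<^sub>R X + a' *\<^sub>R Y) - ?A x\<bar> < e"
    using near[of b' a'] ab' by (intro d1(2)) (simp add: d_def)
  ultimately have "\<bar>?A x - ?B x\<bar> < e + e" by linarith
  then show False by (simp add: e_def)
qed

lemma dir_deriv_commute:
  fixes f :: "'v::euclidean_space \<Rightarrow> 'w::euclidean_space"
  assumes f: "smooth_on S f" "open S" "x \<in> S"
  shows "dir_deriv X (dir_deriv Y f) x = dir_deriv Y (dir_deriv X f) x"
proof (rule euclidean_eqI)
  fix b :: 'w
  note bl = bounded_linear_inner_left[of b]
  have c: "dir_deriv X (dir_deriv Y f) x \<bullet> b = dir_deriv X (dir_deriv Y (\<lambda>y. f y \<bullet> b)) x" for X Y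
  proof -
    have "dir_deriv X (dir_deriv Y (\<lambda>y. f y \<bullet> b)) x = dir_deriv X (\<lambda>y. dir_deriv Y f y \<bullet> b) x"
      using f by (intro dir_deriv_cong[OF f(2,3)])
        (auto intro!: smooth_on_linear[OF bl] smooth_on_dir_deriv simp: dir_deriv_bounded_linear[OF _ _ bl])
    then show ?thesis using dir_deriv_bounded_linear[OF f(2,3) bl] smooth_on_dir_deriv[OF f(1,2)] by simp
  qed
  show "dir_deriv X (dir_deriv Y f) x \<bullet> b = dir_deriv Y (dir_deriv X f) x \<bullet> b"
    using dir_deriv_commute_real[OF smooth_on_linear[OF bl f(1)] f(2,3)] by (simp only: c)
qed

section \<open>Determinants and Hermitian forms\<close>

lemma smooth_on_det:
  fixes K :: "'m::finite \<Rightarrow> 'm \<Rightarrow> 'v::euclidean_space \<Rightarrow> complex"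
  assumes "\<And>i j. smooth_on S (K i j)"
  shows "smooth_on S (\<lambda>x. det (\<chi> i j. K i j x))"
  unfolding det_def by (simp, intro smooth_on_intros assms)

text \<open>Every monomial of the Leibniz formula has one factor from each row, so the product rule
  differentiates one row at a time. In this form the right side is again a sum of determinants and
  can be differentiated once more.\<close>

lemma dir_deriv_det:
  fixes K :: "'m::finite \<Rightarrow> 'm \<Rightarrow> 'v::euclidean_space \<Rightarrow> complex"
  assumes K: "\<And>i j. smooth_on S (K i j)" and S: "open S" "x \<in> S"
  shows "dir_deriv X (\<lambda>x. det (\<chi> i j. K i j x)) x
    = (\<Sum>k\<in>UNIV. det (\<chi> i j. if i = k then dir_deriv X (K i j) x else K i j x))"
proof -
  have prod: "dir_deriv X (\<lambda>x. \<Prod>i\<in>UNIV. K i (p i) x) x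
      = (\<Sum>k\<in>UNIV. dir_deriv X (K k (p k)) x * (\<Prod>j\<in>UNIV - {k}. K j (p j) x))" for p
    by (rule dir_deriv_eq[OF has_derivative_prod[OF smooth_on_has_derivative[OF K S]]])
  have row: "(\<Prod>i\<in>UNIV. if i = k then a i else b i) = a k * (\<Prod>i\<in>UNIV - {k}. b i)"
    for k :: 'm and a b :: "'m \<Rightarrow> complex"
    by (subst prod.remove[of _ k]) (auto intro!: prod.cong)
  have "dir_deriv X (\<lambda>x. det (\<chi> i j. K i j x)) x
    = (\<Sum>p | p permutes UNIV. of_int (sign p) * dir_deriv X (\<lambda>x. \<Prod>i\<in>UNIV. K i (p i) x) x)"
    unfolding det_def
    by (simp, subst dir_deriv_sum[OF S], (intro smooth_on_intros K)[1],
      intro sum.cong[OF refl], subst dir_deriv_mult[OF S])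
      (auto intro!: smooth_on_intros K simp: dir_deriv_const[OF S])
  also have "\<dots> = (\<Sum>k\<in>UNIV. \<Sum>p | p permutes UNIV. of_int (sign p) *
      (dir_deriv X (K k (p k)) x * (\<Prod>j\<in>UNIV - {k}. K j (p j) x)))"
    by (subst sum.swap) (simp add: prod sum_distrib_left)
  also have "\<dots> = (\<Sum>k\<in>UNIV. det (\<chi> i j. if i = k then dir_deriv X (K i j) x else K i j x))"
    unfolding det_def by (simp add: row)
  finally show ?thesis .
qed

text \<open>The new row is a combination of the rows of the identity, and Cramer's lemma reads off
  the coefficient of row \<open>k\<close>.\<close>

lemma det_replace_row_identity:
  fixes r :: "'m::finite \<Rightarrow> complex"
  shows "det (\<chi> i j. if i = k then r j else if i = j then 1 else 0) = r k"
proof -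
  have "det (\<chi> i. if i = k then \<Sum>l\<in>UNIV. (\<chi> j. r j) $ l *s row l (mat 1) else row i (mat 1)) = r k"
    by (subst cramer_lemma_transpose) simp
  also have "(\<chi> i. if i = k then \<Sum>l\<in>UNIV. (\<chi> j. r j) $ l *s row l (mat 1) else row i (mat 1))
      = (\<chi> i j. if i = k then r j else if i = j then 1 else 0)"
    by (simp add: vec_eq_iff row_def mat_def if_distrib cong: if_cong)
  finally show ?thesis .
qed

text \<open>Cramer's lemma applies again, now to the matrix \<open>A q\<close> that has only row
  \<open>l\<close> replaced. Its coefficients can be written without division when
  \<open>q l = 1\<close>; linearity in row \<open>l\<close> gives the general case.\<close>

lemma det_replace_two_rows_identity:
  fixes r s :: "'m::finite \<Rightarrow> complex"
  assumes "k \<noteq> l"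
  shows "det (\<chi> i j. if i = k then r j else if i = l then s j else if i = j then 1 else 0)
    = r k * s l - r l * s k"
proof -
  define M where "M q = (\<chi> i j. if i = k then r j else if i = l then q j else if i = j then 1 else 0)"
    for q :: "'m \<Rightarrow> complex"
  define A where "A q = (\<chi> i j. if i = l then q j else if i = j then 1 else (0::complex))"
    for q :: "'m \<Rightarrow> complex"
  have unit: "det (M q) = r k - r l * q k" if "q l = 1" for q
  proof -
    \<comment> \<open>In column \<open>l\<close> only row \<open>l\<close> of \<open>A q\<close> is
      nonzero, with entry 1, so its coefficient must be \<open>r l\<close>; the unit rows correct
      the other columns.\<close>
    define c where "c = (\<chi> i. if i = l then r l else r i - r l * q i)"
    have comb: "(\<Sum>i\<in>UNIV. c $ i * A q $ i $ j) = r j" for j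
    proof -
      have "(\<Sum>i\<in>UNIV. c $ i * A q $ i $ j)
          = r l * q j + (\<Sum>i\<in>UNIV - {l}. if i = j then r i - r l * q i else 0)"
        unfolding sum.remove[OF finite UNIV_I, of _ l]
        by (intro arg_cong2[where f = "(+)"] sum.cong) (auto simp: c_def A_def)
      also have "\<dots> = r j" using that by (cases "j = l") (simp_all add: sum.delta)
      finally show ?thesis .
    qed
    have "M q = (\<chi> i. if i = k then \<Sum>i\<in>UNIV. c $ i *s row i (A q) else row i (A q))"
      using comb by (simp add: vec_eq_iff row_def M_def) (simp add: A_def)
    then have "det (M q) = c $ k * det (A q)"
      using cramer_lemma_transpose[of k c "A q"] by simp
    also have "det (A q) = 1" unfolding A_def using that by (simp add: det_replace_row_identity)
    finally show ?thesis using assms by (simp add: c_def)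
  qed
  define b where "b j = (if l = j then 1 else 0 :: complex)" for j
  \<comment> \<open>A multiple of the unit row \<open>b\<close> is added to \<open>s\<close> so that
    entry \<open>l\<close> becomes 1.\<close>
  let ?q = "\<lambda>j. s j + (1 - s l) * b j"
  have "det (M ?q) = det (M s) + (1 - s l) * det (M b)"
  proof -
    have swap: "M q = (\<chi> i. if i = l then (\<chi> j. q j) else (\<chi> j. if i = k then r j else if i = j then 1 else 0))" for q
      using assms by (auto simp: M_def vec_eq_iff)
    have "(\<chi> j. s j + (1 - s l) * b j) = (\<chi> j. s j) + (1 - s l) *s (\<chi> j. b j)"
      by (simp add: vec_eq_iff algebra_simps)
    then show ?thesis unfolding swap
      by (simp only: det_row_add det_row_mul)
  qed
  moreover have "det (M ?q) = r k - r l * s k" "det (M b) = r k"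
    using assms by (simp_all add: unit b_def)
  ultimately have "r k - r l * s k = det (M s) + (1 - s l) * r k" by simp
  then show ?thesis by (simp add: M_def algebra_simps)
qed

lemma dir_deriv_det_identity:
  fixes K :: "'m::finite \<Rightarrow> 'm \<Rightarrow> 'v::euclidean_space \<Rightarrow> complex"
  assumes K: "\<And>i j. smooth_on S (K i j)" and S: "open S" "x \<in> S"
    and I: "\<And>i j. K i j x = (if i = j then 1 else 0)"
  shows "dir_deriv X (\<lambda>x. det (\<chi> i j. K i j x)) x = (\<Sum>k\<in>UNIV. dir_deriv X (K k k) x)"
  unfolding dir_deriv_det[OF K S] I
proof (rule sum.cong[OF refl])
  fix k
  have "(\<chi> i j. if i = k then dir_deriv X (K i j) x else if i = j then 1 else 0)
      = (\<chi> i j. if i = k then dir_deriv X (K k j) x else if i = j then 1 else 0)"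
    by (auto simp: vec_eq_iff)
  then show "det (\<chi> i j. if i = k then dir_deriv X (K i j) x else if i = j then 1 else 0)
      = dir_deriv X (K k k) x" by (simp add: det_replace_row_identity)
qed

text \<open>Two derivatives on the same row give the trace of the second derivative; on different
  rows they give the 2x2 minors of the two first derivatives.\<close>

lemma dir_deriv2_det_identity:
  fixes K :: "'m::finite \<Rightarrow> 'm \<Rightarrow> 'v::euclidean_space \<Rightarrow> complex"
  assumes K: "\<And>i j. smooth_on S (K i j)" and S: "open S" "x \<in> S"
    and I: "\<And>i j. K i j x = (if i = j then 1 else 0)"
  shows "dir_deriv Y (dir_deriv X (\<lambda>x. det (\<chi> i j. K i j x))) x
    = (\<Sum>k\<in>UNIV. dir_deriv Y (dir_deriv X (K k k)) x)
      + (\<Sum>k\<in>UNIV. dir_deriv X (K k k) x) * (\<Sum>k\<in>UNIV. dir_deriv Y (K k k) x)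
      - (\<Sum>k\<in>UNIV. \<Sum>l\<in>UNIV. dir_deriv X (K k l) x * dir_deriv Y (K l k) x)"
proof -
  define R where "R k i j = (\<lambda>y. if i = k then dir_deriv X (K i j) y else K i j y)" for k i j
  have R: "smooth_on S (R k i j)" for k i j
    using K smooth_on_dir_deriv[OF K S(1)] by (cases "i = k") (simp_all add: R_def)
  \<comment> \<open>For \<open>l = k\<close> the last bracket vanishes, so one formula covers both
    cases and the sums may run over all pairs.\<close>
  have det_l: "det (\<chi> i j. if i = l then dir_deriv Y (R k i j) x else R k i j x)
      = (if l = k then dir_deriv Y (dir_deriv X (K k k)) x else 0)
        + (dir_deriv X (K k k) x * dir_deriv Y (K l l) x - dir_deriv X (K k l) x * dir_deriv Y (K l k) x)" for k l
  proof (cases "l = k")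
    case True
    have "(\<chi> i j. if i = l then dir_deriv Y (R k i j) x else R k i j x)
        = (\<chi> i j. if i = k then dir_deriv Y (dir_deriv X (K k j)) x else if i = j then 1 else 0)"
      using True by (auto simp: vec_eq_iff R_def I)
    then show ?thesis using True by (simp add: det_replace_row_identity)
  next
    case False
    have "(\<chi> i j. if i = l then dir_deriv Y (R k i j) x else R k i j x)
        = (\<chi> i j. if i = k then dir_deriv X (K k j) x else if i = l then dir_deriv Y (K l j) x
             else if i = j then 1 else 0)"
      using False by (auto simp: vec_eq_iff R_def I)
    then show ?thesis using False det_replace_two_rows_identity[of k l] by simp
  qed
  have "dir_deriv Y (dir_deriv X (\<lambda>x. det (\<chi> i j. K i j x))) x
      = dir_deriv Y (\<lambda>y. \<Sum>k\<in>UNIV. det (\<chi> i j. R k i j y)) x"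
    by (rule dir_deriv_cong[OF S])
      (auto simp: R_def dir_deriv_det[OF K S(1)] intro!: smooth_on_sum smooth_on_det R[unfolded R_def])
  also have "\<dots> = (\<Sum>k\<in>UNIV. \<Sum>l\<in>UNIV. det (\<chi> i j. if i = l then dir_deriv Y (R k i j) x else R k i j x))"
    by (subst dir_deriv_sum[OF S smooth_on_det[OF R]]) (simp add: dir_deriv_det[OF R S])
  also have "\<dots> = (\<Sum>k\<in>UNIV. dir_deriv Y (dir_deriv X (K k k)) x)
      + (\<Sum>k\<in>UNIV. dir_deriv X (K k k) x) * (\<Sum>k\<in>UNIV. dir_deriv Y (K k k) x)
      - (\<Sum>k\<in>UNIV. \<Sum>l\<in>UNIV. dir_deriv X (K k l) x * dir_deriv Y (K l k) x)"
    unfolding det_l sum.distrib sum_subtractf sum_product by simp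
  finally show ?thesis .
qed

text \<open>Differentiating the identity \<open>D\<^sub>X ln d * d = D\<^sub>X d\<close> avoids derivatives of the inverse.\<close>

lemma dir_deriv2_ln_det_identity:
  fixes K :: "'m::finite \<Rightarrow> 'm \<Rightarrow> 'v::euclidean_space \<Rightarrow> complex"
  assumes K: "\<And>i j. smooth_on S (K i j)" and S: "open S" "x \<in> S"
    and I: "\<And>i j. K i j x = (if i = j then 1 else 0)"
    and pos: "\<And>y. y \<in> S \<Longrightarrow> 0 < Re (det (\<chi> i j. K i j y))"
    and real: "\<And>y k. y \<in> S \<Longrightarrow> Im (K k k y) = 0"
  defines "L \<equiv> \<lambda>y. ln (Re (det (\<chi> i j. K i j y)))"
  shows "dir_deriv X L x = Re (\<Sum>k\<in>UNIV. dir_deriv X (K k k) x)"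
    and "dir_deriv Y (dir_deriv X L) x = Re ((\<Sum>k\<in>UNIV. dir_deriv Y (dir_deriv X (K k k)) x)
      - (\<Sum>k\<in>UNIV. \<Sum>l\<in>UNIV. dir_deriv X (K k l) x * dir_deriv Y (K l k) x))"
proof -
  let ?D = "\<lambda>y. det (\<chi> i j. K i j y)"
  define d where "d y = Re (?D y)" for y
  have D: "smooth_on S ?D" by (intro smooth_on_det K)
  then have d: "smooth_on S d" unfolding d_def by (intro smooth_on_Re)
  have L: "smooth_on S L" unfolding L_def by (intro smooth_on_ln smooth_on_Re D pos)
  have "(\<chi> i j. K i j x) = mat 1" by (simp add: vec_eq_iff mat_def I)
  then have dx: "d x = 1" by (simp add: d_def det_I)
  have dX: "dir_deriv X d y = Re (dir_deriv X ?D y)" if "y \<in> S" for X y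
    unfolding d_def by (rule dir_deriv_bounded_linear[OF S(1) that bounded_linear_Re D])
  have LX: "dir_deriv X L y * d y = dir_deriv X d y" if "y \<in> S" for X y
    using dir_deriv_ln[OF S(1) that d] pos[OF that] by (simp add: L_def d_def[abs_def])
  show first: "dir_deriv X L x = Re (\<Sum>k\<in>UNIV. dir_deriv X (K k k) x)" for X
    using LX[OF S(2)] dX[OF S(2)] dx dir_deriv_det_identity[OF K S I] by simp
  \<comment> \<open>With a real trace, the real part of a product of two traces is the product of
    their real parts.\<close>
  have im: "Im (\<Sum>k\<in>UNIV. dir_deriv X (K k k) x) = 0" for X
  proof -
    have "Im (dir_deriv X (K k k) x) = 0" for k
      using dir_deriv_bounded_linear[OF S bounded_linear_Im K, of X k k]
        dir_deriv_cong[OF S smooth_on_const[of S "0::real"], where g = "\<lambda>y. Im (K k k y)" and X = X] real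
      by (simp add: dir_deriv_const[OF S])
    then show ?thesis by (simp add: Im_sum)
  qed
  have "dir_deriv Y (\<lambda>y. dir_deriv X L y * d y) x = dir_deriv Y (dir_deriv X d) x"
    by (rule dir_deriv_cong[OF S]) (auto simp: LX smooth_on_dir_deriv[OF d S(1)])
  moreover have "dir_deriv Y (\<lambda>y. dir_deriv X L y * d y) x
      = dir_deriv X L x * dir_deriv Y d x + dir_deriv Y (dir_deriv X L) x"
    using dir_deriv_mult[OF S smooth_on_dir_deriv[OF L S(1)] d, of Y X] dx by simp
  moreover have "dir_deriv Y (dir_deriv X d) x = Re (dir_deriv Y (dir_deriv X ?D) x)"
    using dir_deriv_cong[OF S smooth_on_Re[OF smooth_on_dir_deriv[OF D S(1)]], where g = "dir_deriv X d" and X = Y] dX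
      dir_deriv_bounded_linear[OF S bounded_linear_Re smooth_on_dir_deriv[OF D S(1)], of Y X] by simp
  ultimately have "dir_deriv Y (dir_deriv X L) x = Re (dir_deriv Y (dir_deriv X ?D) x)
      - Re (\<Sum>k\<in>UNIV. dir_deriv X (K k k) x) * Re (\<Sum>k\<in>UNIV. dir_deriv Y (K k k) x)"
    using first[of X] dX[OF S(2), of Y] dir_deriv_det_identity[OF K S I, of Y] by simp
  then show "dir_deriv Y (dir_deriv X L) x = Re ((\<Sum>k\<in>UNIV. dir_deriv Y (dir_deriv X (K k k)) x)
      - (\<Sum>k\<in>UNIV. \<Sum>l\<in>UNIV. dir_deriv X (K k l) x * dir_deriv Y (K l k) x))"
    unfolding dir_deriv2_det_identity[OF K S I] using im[of X] by simp
qed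

section \<open>Hermitian forms and unitary frames\<close>

lemma sesq_form_add_left: "sesq_form H (v + v') w = sesq_form H v w + sesq_form H v' w"
  by (simp add: sesq_form_def algebra_simps sum.distrib)

lemma sesq_form_add_right: "sesq_form H v (w + w') = sesq_form H v w + sesq_form H v w'"
  by (simp add: sesq_form_def algebra_simps sum.distrib)

lemma sesq_form_scale_left: "sesq_form H (a *s v) w = a * sesq_form H v w"
  by (simp add: sesq_form_def sum_distrib_left mult_ac)

lemma sesq_form_scale_right: "sesq_form H v (a *s w) = cnj a * sesq_form H v w"
  by (simp add: sesq_form_def sum_distrib_left mult_ac)

lemma sesq_form_zero_left: "sesq_form H 0 w = 0"
  by (simp add: sesq_form_def)

lemma sesq_form_zero_right: "sesq_form H v 0 = 0"
  by (simp add: sesq_form_def)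

lemma sesq_form_sum_left: "sesq_form H (\<Sum>i\<in>I. v i) w = (\<Sum>i\<in>I. sesq_form H (v i) w)"
  by (induction I rule: infinite_finite_induct) (auto simp: sesq_form_add_left sesq_form_zero_left)

lemma sesq_form_sum_right: "sesq_form H v (\<Sum>i\<in>I. w i) = (\<Sum>i\<in>I. sesq_form H v (w i))"
  by (induction I rule: infinite_finite_induct) (auto simp: sesq_form_add_right sesq_form_zero_right)

lemma scaleR_eq_vector_scalar_mult: "r *\<^sub>R (v::complex^'m) = complex_of_real r *s v"
  unfolding vec_eq_iff vector_scaleR_component vector_smult_component
  by (simp add: scaleR_conv_of_real)

text \<open>The pointwise content of \<open>hermitian_metric\<close>, isolated so that the linear
  algebra is free of charts.\<close>

definition hermitian_positive :: "complex^'m^'m \<Rightarrow> bool" where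
  "hermitian_positive H \<longleftrightarrow> (\<forall>\<alpha> \<beta>. H $ \<beta> $ \<alpha> = cnj (H $ \<alpha> $ \<beta>)) \<and>
     (\<forall>v. v \<noteq> 0 \<longrightarrow> 0 < Re (sesq_form H v v))"

lemma sesq_form_cnj:
  assumes "hermitian_positive H"
  shows "sesq_form H w v = cnj (sesq_form H v w)"
proof -
  have H: "H $ \<beta> $ \<alpha> = cnj (H $ \<alpha> $ \<beta>)" for \<alpha> \<beta>
    using assms unfolding hermitian_positive_def by blast
  have "sesq_form H w v = (\<Sum>\<beta>\<in>UNIV. \<Sum>\<alpha>\<in>UNIV. H $ \<alpha> $ \<beta> * w $ \<alpha> * cnj (v $ \<beta>))"
    unfolding sesq_form_def by (rule sum.swap)
  also have "\<dots> = cnj (sesq_form H v w)"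
    unfolding sesq_form_def cnj_sum complex_cnj_mult complex_cnj_cnj
  proof (intro sum.cong refl)
    fix \<alpha> \<beta>
    show "H $ \<alpha> $ \<beta> * w $ \<alpha> * cnj (v $ \<beta>) = cnj (H $ \<beta> $ \<alpha>) * cnj (v $ \<beta>) * w $ \<alpha>"
      using H[of \<beta> \<alpha>] by simp
  qed
  finally show ?thesis .
qed

text \<open>Gram--Schmidt: a vector outside the span of a short orthonormal family extends it.\<close>

lemma exists_unitary_family:
  fixes H :: "complex^'m^'m::finite"
  assumes H: "hermitian_positive H"
  shows "n \<le> CARD('m) \<Longrightarrow>
    \<exists>e. \<forall>i<n. \<forall>j<n. sesq_form H (e i) (e j) = (if i = j then 1 else 0)"
proof (induction n)
  case 0
  then show ?case by simp
next
  case (Suc n)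
  then obtain e where e: "\<And>i j. i < n \<Longrightarrow> j < n \<Longrightarrow> sesq_form H (e i) (e j) = (if i = j then 1 else 0)"
    by auto
  have "vec.dim (e ` {..<n}) \<le> card (e ` {..<n})" by (intro vec.dim_le_card') simp
  also have "\<dots> \<le> n" using card_image_le[of "{..<n}" e] by simp
  also have "n < vec.dim (UNIV :: (complex^'m) set)" using Suc.prems by (simp add: vec.dim_UNIV card_cart_basis)
  finally have "vec.span (e ` {..<n}) \<noteq> UNIV" by (metis vec.dim_span less_irrefl)
  then obtain w where w: "w \<notin> vec.span (e ` {..<n})" by auto
  define p where "p = w - (\<Sum>i<n. sesq_form H w (e i) *s e i)"
  have "(\<Sum>i<n. sesq_form H w (e i) *s e i) \<in> vec.span (e ` {..<n})"
    by (intro vec.span_sum vec.span_scale vec.span_base) auto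
  then have "p \<noteq> 0" using w by (auto simp: p_def)
  then have pos: "0 < Re (sesq_form H p p)" using H by (simp add: hermitian_positive_def)
  have "sesq_form H p p = of_real (Re (sesq_form H p p))"
    using sesq_form_cnj[OF H, of p p] by (simp add: complex_eq_iff)
  moreover define c where "c = 1 / sqrt (Re (sesq_form H p p))"
  moreover have "c * c * Re (sesq_form H p p) = 1" using pos by (simp add: c_def)
  ultimately have cc: "of_real c * of_real c * sesq_form H p p = 1"
    by (metis of_real_1 of_real_mult)
  have pj: "sesq_form H p (e j) = 0" if "j < n" for j
  proof -
    have "sesq_form H (\<Sum>i<n. sesq_form H w (e i) *s e i) (e j) = (\<Sum>i<n. if i = j then sesq_form H w (e i) else 0)"
      unfolding sesq_form_sum_left sesq_form_scale_left using that e by (intro sum.cong) auto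
    also have "\<dots> = sesq_form H w (e j)" using that by (simp add: sum.delta)
    moreover have "w = p + (\<Sum>i<n. sesq_form H w (e i) *s e i)" by (simp add: p_def)
    ultimately show ?thesis using sesq_form_add_left[of H p] by (metis add_cancel_left_left)
  qed
  have jp: "sesq_form H (e j) p = 0" if "j < n" for j
    using pj[OF that] sesq_form_cnj[OF H, of "e j" p] by simp
  show ?case
    using e pj jp cc
    by (intro exI[of _ "e(n := of_real c *s p)"])
      (auto simp: less_Suc_eq sesq_form_scale_left sesq_form_scale_right mult_ac)
qed

lemma exists_unitary_frame:
  fixes H :: "complex^'m^'m::finite"
  assumes H: "hermitian_positive H"
  obtains e :: "'m \<Rightarrow> complex^'m" where "\<And>i j. sesq_form H (e i) (e j) = (if i = j then 1 else 0)"
proof -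
  obtain f where f: "\<And>i j. i < CARD('m) \<Longrightarrow> j < CARD('m) \<Longrightarrow> sesq_form H (f i) (f j) = (if i = j then 1 else 0)"
    using exists_unitary_family[OF H order_refl] by blast
  obtain h where h: "bij_betw h (UNIV::'m set) {..<CARD('m)}"
    using ex_bij_betw_finite_nat[of "UNIV::'m set"] by (auto simp: atLeast0LessThan)
  then have h: "h i < CARD('m)" "(h i = h j) = (i = j)" for i j
    by (auto simp: bij_betw_def inj_on_def)
  show ?thesis by (rule that[of "\<lambda>i. f (h i)"]) (simp add: f h)
qed

lemma det_cnj: "det (\<chi> i j. cnj (A $ i $ j)) = cnj (det (A::complex^'m^'m::finite))"
  by (simp add: det_def)

text \<open>With the vectors \<open>e i\<close> as the rows of a matrix E, the Gram matrix is E H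
  times the conjugate transpose of E.\<close>

lemma det_sesq_form:
  "det (\<chi> i j. sesq_form H (e i) (e j)) = of_real ((norm (det (\<chi> i j. e i $ j)))\<^sup>2) * det (H::complex^'m^'m::finite)"
proof -
  let ?E = "\<chi> i j. e i $ j"
  have "(\<chi> i j. sesq_form H (e i) (e j)) = ?E ** (H ** transpose (\<chi> i j. cnj (?E $ i $ j)))"
    by (simp add: vec_eq_iff sesq_form_def matrix_matrix_mult_def transpose_def sum_distrib_left mult_ac)
  then have "det (\<chi> i j. sesq_form H (e i) (e j)) = det ?E * (det H * cnj (det ?E))"
    by (simp only: det_mul det_transpose det_cnj)
  then show ?thesis by (simp only: complex_norm_square mult_ac)
qed

lemma det_unitary_frame:
  fixes e :: "'m::finite \<Rightarrow> complex^'m"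
  assumes "\<And>i j. sesq_form H (e i) (e j) = (if i = j then 1 else 0)"
  shows "(norm (det (\<chi> i j. e i $ j)))\<^sup>2 * Re (det H) = 1"
proof -
  have "(\<chi> i j. sesq_form H (e i) (e j)) = mat 1" using assms by (simp add: mat_def)
  then have "of_real ((norm (det (\<chi> i j. e i $ j)))\<^sup>2) * det H = 1"
    using det_sesq_form[of H e] by (simp only: det_I)
  then have "Re (of_real ((norm (det (\<chi> i j. e i $ j)))\<^sup>2) * det H) = 1" by simp
  then show ?thesis by (simp only: Re_complex_of_real Im_complex_of_real mult_zero_left times_complex.simps diff_zero)
qed

text \<open>The Gram determinant of a unitary frame is 1, so the determinant of \<open>H\<close> is
  the reciprocal of a square.\<close>

lemma Re_det_pos:
  assumes "hermitian_positive (H::complex^'m^'m::finite)"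
  shows "0 < Re (det H)"
proof -
  obtain e :: "'m \<Rightarrow> complex^'m" where e: "\<And>i j. sesq_form H (e i) (e j) = (if i = j then 1 else 0)"
    using exists_unitary_frame[OF assms] by metis
  from det_unitary_frame[of H e, OF e]
  have "0 < (norm (det (\<chi> i j. e i $ j)))\<^sup>2 * Re (det H)" by simp
  then show ?thesis by (simp add: zero_less_mult_iff)
qed

text \<open>Orthonormality says that \<open>?F\<close> is a right inverse of \<open>?E\<close>; the
  expansion is the statement that it is a left inverse, applied to \<open>v\<close> as a row
  vector.\<close>

lemma unitary_frame_expansion:
  fixes H :: "complex^'m^'m::finite" and e :: "'m \<Rightarrow> complex^'m"
  assumes e: "\<And>i j. sesq_form H (e i) (e j) = (if i = j then 1 else 0)"
  shows "v = (\<Sum>i\<in>UNIV. sesq_form H v (e i) *s e i)"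
proof -
  let ?E = "\<chi> i j. e i $ j" and ?F = "\<chi> i j. \<Sum>\<beta>\<in>UNIV. H $ i $ \<beta> * cnj (e j $ \<beta>)"
  have "?E ** ?F = mat 1"
    using e by (simp add: vec_eq_iff matrix_matrix_mult_def mat_def sesq_form_def sum_distrib_left mult_ac)
  then have FE: "?F ** ?E = mat 1" using matrix_left_right_inverse by blast
  have "v = v v* (?F ** ?E)" unfolding FE by (simp add: vector_matrix_mult_def mat_def vec_eq_iff if_distrib cong: if_cong)
  also have "\<dots> = (v v* ?F) v* ?E" by (simp only: vector_matrix_mul_assoc)
  also have "\<dots> = (\<Sum>i\<in>UNIV. sesq_form H v (e i) *s e i)"
    by (simp add: vec_eq_iff vector_matrix_mult_def sesq_form_def sum_distrib_left mult_ac)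
  finally show ?thesis .
qed

text \<open>If \<open>c < 0\<close>, then \<open>f'\<close> is negative just to the right of its
  zero at 0, and the mean value theorem pushes \<open>f\<close> below its minimum.\<close>

lemma second_derivative_nonneg:
  fixes f f' :: "real \<Rightarrow> real"
  assumes d: "0 < d" and min: "\<And>s. \<bar>s\<bar> < d \<Longrightarrow> f 0 \<le> f s"
    and f': "\<And>s. \<bar>s\<bar> < d \<Longrightarrow> (f has_real_derivative f' s) (at s)"
    and f'': "(f' has_real_derivative c) (at 0)"
  shows "0 \<le> c"
proof (rule ccontr)
  assume "\<not> 0 \<le> c"
  have "f' 0 = 0"
    by (rule DERIV_local_min[OF f'[of 0] d]) (use d min in auto)
  then obtain e where e: "0 < e" "\<And>h. 0 < h \<Longrightarrow> h < e \<Longrightarrow> f' h < 0"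
    using DERIV_neg_dec_right[OF f''] \<open>\<not> 0 \<le> c\<close> by auto
  define h where "h = min d e / 2"
  have h: "0 < h" "h < d" "h < e" using d e by (auto simp: h_def)
  obtain z where "0 < z" "z < h" "f h - f 0 = (h - 0) * f' z"
    using MVT2[OF h(1), of f f'] f' h by auto
  then have "f h < f 0" using h e(2)[of z] mult_pos_neg[of h "f' z"] by simp
  then show False using min[of h] h by simp
qed

section \<open>Wirtinger derivatives on space-time\<close>

text \<open>Wirtinger derivatives along an arbitrary constant vector, complex linear in it for
  \<open>dz\<close> and conjugate linear for \<open>dzb\<close>. A unitary frame at a point can thus
  replace the coordinate axes.\<close>

definition dz :: "complex^'m \<Rightarrow> ((complex^'m::finite) \<times> real \<Rightarrow> complex) \<Rightarrow> (complex^'m) \<times> real \<Rightarrow> complex" where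
  "dz v H p = (dir_deriv (v, 0) H p - \<i> * dir_deriv (\<i> *s v, 0) H p) / 2"

definition dzb :: "complex^'m \<Rightarrow> ((complex^'m::finite) \<times> real \<Rightarrow> complex) \<Rightarrow> (complex^'m) \<times> real \<Rightarrow> complex" where
  "dzb v H p = (dir_deriv (v, 0) H p + \<i> * dir_deriv (\<i> *s v, 0) H p) / 2"

lemma dir_deriv_eq_dz: "dir_deriv (v, 0) H p = dz v H p + dzb v H p"
  by (simp add: dz_def dzb_def field_simps)

lemma dir_deriv_i_eq_dz: "dir_deriv (\<i> *s v, 0) H p = \<i> * (dz v H p - dzb v H p)"
  by (simp add: dz_def dzb_def field_simps)

lemma smooth_on_dz: "open S \<Longrightarrow> smooth_on S H \<Longrightarrow> smooth_on S (dz v H)"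
  unfolding dz_def[abs_def] divide_inverse
  by (intro smooth_on_intros smooth_on_dir_deriv) auto

lemma smooth_on_dzb: "open S \<Longrightarrow> smooth_on S H \<Longrightarrow> smooth_on S (dzb v H)"
  unfolding dzb_def[abs_def] divide_inverse
  by (intro smooth_on_intros smooth_on_dir_deriv) auto

context
  fixes S :: "((complex^'m::finite) \<times> real) set" and p
  assumes S: "open S" "p \<in> S"
begin

lemma dir_deriv_cmult:
  fixes H :: "_ \<Rightarrow> complex"
  assumes "smooth_on S H"
  shows "dir_deriv X (\<lambda>p. a * H p) p = a * dir_deriv X H p"
  using dir_deriv_mult[OF S smooth_on_const assms, of X a] by (simp add: dir_deriv_const[OF S])

lemma dir_deriv_lincomb:
  fixes H K :: "_ \<Rightarrow> complex"
  assumes H: "smooth_on S H" and K: "smooth_on S K"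
  shows "dir_deriv X (\<lambda>p. a * H p + b * K p) p = a * dir_deriv X H p + b * dir_deriv X K p"
  using dir_deriv_add[OF S smooth_on_mult[OF smooth_on_const H] smooth_on_mult[OF smooth_on_const K], of X a b]
  by (simp only: dir_deriv_cmult[OF H] dir_deriv_cmult[OF K])

lemma dir_deriv_dz:
  assumes "smooth_on S H"
  shows "dir_deriv X (dz v H) p = dz v (dir_deriv X H) p"
proof -
  have "dz v H = (\<lambda>p. (1/2) * dir_deriv (v, 0) H p + (- (\<i>/2)) * dir_deriv (\<i> *s v, 0) H p)"
    by (simp add: dz_def[abs_def] field_simps)
  then have "dir_deriv X (dz v H) p
      = (1/2) * dir_deriv X (dir_deriv (v, 0) H) p + (- (\<i>/2)) * dir_deriv X (dir_deriv (\<i> *s v, 0) H) p"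
    by (simp only: dir_deriv_lincomb smooth_on_dir_deriv[OF assms S(1)])
  then show ?thesis
    by (simp add: dz_def dir_deriv_commute[OF assms S, of X] field_simps)
qed

lemma dir_deriv_dzb:
  assumes "smooth_on S H"
  shows "dir_deriv X (dzb v H) p = dzb v (dir_deriv X H) p"
proof -
  have "dzb v H = (\<lambda>p. (1/2) * dir_deriv (v, 0) H p + (\<i>/2) * dir_deriv (\<i> *s v, 0) H p)"
    by (simp add: dzb_def[abs_def] field_simps)
  then have "dir_deriv X (dzb v H) p
      = (1/2) * dir_deriv X (dir_deriv (v, 0) H) p + (\<i>/2) * dir_deriv X (dir_deriv (\<i> *s v, 0) H) p"
    by (simp only: dir_deriv_lincomb smooth_on_dir_deriv[OF assms S(1)])
  then show ?thesis
    by (simp add: dzb_def dir_deriv_commute[OF assms S, of X] field_simps)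
qed

lemma dz_dzb_expand:
  assumes "smooth_on S H"
  shows "dz v (dzb w H) p = (dir_deriv (v, 0) (dir_deriv (w, 0) H) p + dir_deriv (\<i> *s v, 0) (dir_deriv (\<i> *s w, 0) H) p
    + \<i> * (dir_deriv (v, 0) (dir_deriv (\<i> *s w, 0) H) p - dir_deriv (\<i> *s v, 0) (dir_deriv (w, 0) H) p)) / 4"
  unfolding dz_def dir_deriv_dzb[OF assms]
  unfolding dzb_def by (simp add: dir_deriv_commute[OF assms S, of "(w, 0)"]
      dir_deriv_commute[OF assms S, of "(\<i> *s w, 0)"] field_simps)

text \<open>The mixed terms cancel by the symmetry of second derivatives, even for complex-valued
  \<open>H\<close>. What remains is a quarter of the Laplacian of the real plane spanned by
  \<open>v\<close> and \<open>\<i> *s v\<close>; this is why second-order tests are later added over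
  such pairs of directions.\<close>

lemma dz_dzb_same:
  assumes "smooth_on S H"
  shows "dz v (dzb v H) p = (dir_deriv (v, 0) (dir_deriv (v, 0) H) p
    + dir_deriv (\<i> *s v, 0) (dir_deriv (\<i> *s v, 0) H) p) / 4"
  unfolding dz_dzb_expand[OF assms] by (simp add: dir_deriv_commute[OF assms S, of "(\<i> *s v, 0)" "(v, 0)"])

lemma dz_cong:
  assumes "smooth_on S H" "\<And>y. y \<in> S \<Longrightarrow> H y = H' y"
  shows "dz v H' p = dz v H p"
proof -
  have "dir_deriv X H' p = dir_deriv X H p" for X
    by (rule dir_deriv_cong[OF S]) (use assms in auto)
  then show ?thesis by (simp add: dz_def)
qed

lemma dzb_cong:
  assumes "smooth_on S H" "\<And>y. y \<in> S \<Longrightarrow> H y = H' y"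
  shows "dzb v H' p = dzb v H p"
proof -
  have "dir_deriv X H' p = dir_deriv X H p" for X
    by (rule dir_deriv_cong[OF S]) (use assms in auto)
  then show ?thesis by (simp add: dzb_def)
qed

lemma dz_dzb_commute:
  assumes "smooth_on S H"
  shows "dz v (dzb w H) p = dzb w (dz v H) p"
proof -
  note sm = smooth_on_dir_deriv[OF assms S(1)]
  show ?thesis
    unfolding dzb_def[of w "dz v H"] dir_deriv_dz[OF assms]
    unfolding dz_dzb_expand[OF assms] by (simp add: dz_def field_simps)
qed

text \<open>Additivity is that of the real derivative. Complex homogeneity comes from the way
  \<open>dz\<close> combines \<open>v\<close> with \<open>\<i> *s v\<close>, once the scalar is
  split into real and imaginary part.\<close>

lemma dz_linear:
  assumes "smooth_on S H"
  shows "dz (\<Sum>i\<in>I. a i *s v i) H p = (\<Sum>i\<in>I. a i * dz (v i) H p)"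
proof -
  note l = dir_deriv_linear[OF S assms]
  have add: "dir_deriv (v + w, 0) H p = dir_deriv (v, 0) H p + dir_deriv (w, 0) H p" for v w
    using linear_add[OF l, of "(v, 0)" "(w, 0)"] by simp
  have sc: "dir_deriv (of_real r *s v, 0) H p = of_real r * dir_deriv (v, 0) H p" for r v
    using linear_cmul[OF l, of r "(v, 0)"] by (simp add: scaleR_eq_vector_scalar_mult[symmetric] scaleR_conv_of_real)
  have mul: "dz (a *s v) H p = a * dz v H p" for a v
  proof -
    obtain r s where a: "a = of_real r + \<i> * of_real s" using complex_eq by blast
    have "a *s v = of_real r *s v + of_real s *s (\<i> *s v)"
      "\<i> *s (a *s v) = of_real r *s (\<i> *s v) + of_real (-s) *s v"
      by (simp_all add: a vec_eq_iff algebra_simps)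
    then show ?thesis unfolding dz_def by (simp only: add sc) (simp add: a algebra_simps)
  qed
  have "dz (v + w) H p = dz v H p + dz w H p" for v w
    by (simp add: dz_def add vector_add_ldistrib field_simps)
  moreover have "dz 0 H p = 0" using mul[of 0 0] by simp
  ultimately show ?thesis
    by (induction I rule: infinite_finite_induct) (auto simp: mul)
qed

lemma dzb_cnj:
  assumes "smooth_on S H"
  shows "dzb v (\<lambda>p. cnj (H p)) p = cnj (dz v H p)"
  unfolding dz_def dzb_def dir_deriv_bounded_linear[OF S bounded_linear_cnj assms] by simp

lemma dz_cnj:
  assumes "smooth_on S H"
  shows "dz v (\<lambda>p. cnj (H p)) p = cnj (dzb v H p)"
  unfolding dz_def dzb_def dir_deriv_bounded_linear[OF S bounded_linear_cnj assms] by simp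

lemma dir_deriv_of_real:
  assumes "smooth_on S f"
  shows "dir_deriv X (\<lambda>p. complex_of_real (f p)) p = of_real (dir_deriv X f p)"
  by (rule dir_deriv_bounded_linear[OF S bounded_linear_of_real assms])

lemma dir_deriv_Re:
  assumes "smooth_on S H"
  shows "dir_deriv X (\<lambda>p. Re (H p)) p = Re (dir_deriv X H p)"
  by (rule dir_deriv_bounded_linear[OF S bounded_linear_Re assms])

end

section \<open>Second derivatives, for which the first-order rules are used at all points of
  \<open>S\<close>\<close>

context
  fixes S :: "((complex^'m::finite) \<times> real) set" and p
  assumes S: "open S" "p \<in> S"
begin

lemma dir_deriv2_of_real:
  assumes f: "smooth_on S f"
  shows "dir_deriv Y (dir_deriv X (\<lambda>p. complex_of_real (f p))) p = of_real (dir_deriv Y (dir_deriv X f) p)"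
proof -
  have "dir_deriv Y (dir_deriv X (\<lambda>p. complex_of_real (f p))) p = dir_deriv Y (\<lambda>p. complex_of_real (dir_deriv X f p)) p"
    by (rule dir_deriv_cong[OF S])
      (auto intro!: smooth_on_of_real smooth_on_dir_deriv f S simp: dir_deriv_of_real[OF S(1) _ f])
  then show ?thesis using dir_deriv_of_real[OF S smooth_on_dir_deriv[OF f S(1)]] by simp
qed

lemma dir_deriv2_Re:
  assumes H: "smooth_on S H"
  shows "dir_deriv Y (dir_deriv X (\<lambda>p. Re (H p))) p = Re (dir_deriv Y (dir_deriv X H) p)"
proof -
  have "dir_deriv Y (dir_deriv X (\<lambda>p. Re (H p))) p = dir_deriv Y (\<lambda>p. Re (dir_deriv X H p)) p"
    by (rule dir_deriv_cong[OF S])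
      (auto intro!: smooth_on_Re smooth_on_dir_deriv H S simp: dir_deriv_Re[OF S(1) _ H])
  then show ?thesis using dir_deriv_Re[OF S smooth_on_dir_deriv[OF H S(1)]] by simp
qed

lemma dir_deriv2_mult:
  fixes f k :: "_ \<Rightarrow> real"
  assumes f: "smooth_on S f" and k: "smooth_on S k"
  shows "dir_deriv X (dir_deriv X (\<lambda>p. f p * k p)) p = f p * dir_deriv X (dir_deriv X k) p
    + 2 * dir_deriv X f p * dir_deriv X k p + dir_deriv X (dir_deriv X f) p * k p"
proof -
  note df = smooth_on_dir_deriv[OF f S(1), of X] and dk = smooth_on_dir_deriv[OF k S(1), of X]
  have "dir_deriv X (dir_deriv X (\<lambda>p. f p * k p)) p = dir_deriv X (\<lambda>p. f p * dir_deriv X k p + dir_deriv X f p * k p) p"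
    by (rule dir_deriv_cong[OF S]) (auto intro!: smooth_on_intros f k df dk simp: dir_deriv_mult[OF S(1) _ f k])
  also have "\<dots> = dir_deriv X (\<lambda>p. f p * dir_deriv X k p) p + dir_deriv X (\<lambda>p. dir_deriv X f p * k p) p"
    by (rule dir_deriv_add[OF S]) (intro smooth_on_intros f k df dk)+
  finally show ?thesis using dir_deriv_mult[OF S f dk, of X] dir_deriv_mult[OF S df k, of X] by simp
qed

lemma dir_deriv2_add:
  assumes f: "smooth_on S f" and k: "smooth_on S k"
  shows "dir_deriv Y (dir_deriv X (\<lambda>p. f p + k p)) p = dir_deriv Y (dir_deriv X f) p + dir_deriv Y (dir_deriv X k) p"
proof -
  note df = smooth_on_dir_deriv[OF f S(1), of X] and dk = smooth_on_dir_deriv[OF k S(1), of X]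
  have "dir_deriv Y (dir_deriv X (\<lambda>p. f p + k p)) p = dir_deriv Y (\<lambda>p. dir_deriv X f p + dir_deriv X k p) p"
    by (rule dir_deriv_cong[OF S]) (auto intro!: smooth_on_intros df dk simp: dir_deriv_add[OF S(1) _ f k])
  then show ?thesis using dir_deriv_add[OF S df dk] by simp
qed

lemma dir_deriv2_cmult:
  fixes f :: "_ \<Rightarrow> real"
  assumes f: "smooth_on S f"
  shows "dir_deriv Y (dir_deriv X (\<lambda>p. a * f p)) p = a * dir_deriv Y (dir_deriv X f) p"
proof -
  note df = smooth_on_dir_deriv[OF f S(1), of X]
  have c: "dir_deriv X (\<lambda>p. a * f p) q = a * dir_deriv X f q" if "q \<in> S" "smooth_on S f" for q X f
    using dir_deriv_mult[OF S(1) that(1) smooth_on_const that(2), of X a] by (simp add: dir_deriv_const[OF S(1) that(1)])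
  have "dir_deriv Y (dir_deriv X (\<lambda>p. a * f p)) p = dir_deriv Y (\<lambda>p. a * dir_deriv X f p) p"
    by (rule dir_deriv_cong[OF S]) (auto intro!: smooth_on_intros df simp: c f)
  then show ?thesis using c[OF S(2) df] by simp
qed

text \<open>The second derivative at \<open>0\<close> of \<open>a + s b + s\<^sup>2 c\<close> along a line is \<open>a'' + 2 b' + 2 c\<close>.\<close>

lemma barrier_second_deriv:
  fixes a b c :: "_ \<Rightarrow> real"
  assumes a: "smooth_on S a" and b: "smooth_on S b" and c: "smooth_on S c"
    and min: "\<And>s. p + s *\<^sub>R X \<in> S \<Longrightarrow>
      a p \<le> a (p + s *\<^sub>R X) + s * b (p + s *\<^sub>R X) + s^2 * c (p + s *\<^sub>R X)"
  shows "0 \<le> dir_deriv X (dir_deriv X a) p + 2 * dir_deriv X b p + 2 * c p"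
proof -
  obtain r where r: "0 < r" "ball p r \<subseteq> S" using S openE by blast
  define d where "d = r / (norm X + 1)"
  have d: "0 < d" using r by (simp add: d_def add_nonneg_pos)
  have inS: "p + s *\<^sub>R X \<in> S" if "\<bar>s\<bar> < d" for s
  proof -
    have "\<bar>s\<bar> * norm X \<le> \<bar>s\<bar> * (norm X + 1)" by (intro mult_left_mono) auto
    also have "\<dots> < r" using that by (simp add: d_def pos_less_divide_eq add_nonneg_pos)
    finally have "p + s *\<^sub>R X \<in> ball p r" by (simp add: dist_norm)
    then show ?thesis using r(2) by blast
  qed
  have line: "((\<lambda>s. h (p + s *\<^sub>R X)) has_real_derivative dir_deriv X h (p + s *\<^sub>R X)) (at s)"
    if "\<bar>s\<bar> < d" "smooth_on S h" for s h
    using smooth_on_along_line[OF that(2) S(1) inS[OF that(1)], of UNIV]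
    by (simp add: has_real_derivative_iff_has_vector_derivative)
  let ?L = "\<lambda>h s. h (p + s *\<^sub>R X) :: real"
  let ?f = "\<lambda>s. ?L a s + s * ?L b s + s^2 * ?L c s"
  let ?f' = "\<lambda>s. ?L (dir_deriv X a) s + (?L b s + s * ?L (dir_deriv X b) s) + (2 * s * ?L c s + s^2 * ?L (dir_deriv X c) s)"
  show ?thesis
  proof (rule second_derivative_nonneg[OF d, of ?f ?f'])
    show "?f 0 \<le> ?f s" if "\<bar>s\<bar> < d" for s using min[OF inS[OF that]] by simp
    show "(?f has_real_derivative ?f' s) (at s)" if "\<bar>s\<bar> < d" for s
      by (rule derivative_eq_intros line[OF that] a b c refl | simp add: algebra_simps)+
    have "\<bar>0::real\<bar> < d" using d by simp
    note line0 = line[OF this]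
    show "(?f' has_real_derivative (dir_deriv X (dir_deriv X a) p + 2 * dir_deriv X b p + 2 * c p)) (at 0)"
      by (rule derivative_eq_intros line0 a b c smooth_on_dir_deriv S refl | simp add: algebra_simps)+
  qed
qed

end

section \<open>The local computation at a minimum\<close>

text \<open>Here \<open>A\<close> is the slope of the vector field, \<open>\<gamma>\<close> a first
  derivative of the metric, \<open>h\<close> an entry of the Hessian of u, and \<open>c\<close> a
  product of two first derivatives of ln u. The assumption is the optimal choice of the slope. Of
  the right side only the square of \<open>A + \<gamma>\<close> survives in the end.\<close>

lemma complete_square:
  fixes A \<gamma> c h :: complex and U :: real
  assumes "h = of_real U * (A + \<gamma> + c)"
  shows "- 2 * Re (A * cnj h) + 2 * Re (of_real U * (cnj c * \<gamma>)) + 2 * Re (of_real U * (c * cnj A))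
      + 2 * U * Re (cnj A * \<gamma>) + U * (cmod A)\<^sup>2
    = 2 * Re (h * cnj \<gamma>) - U * (cmod (A + \<gamma>))\<^sup>2 - U * (cmod \<gamma>)\<^sup>2"
  unfolding assms cmod_power2 by (simp add: power2_eq_square algebra_simps)

text \<open>Cauchy-Schwarz on the diagonal, after which imaginary parts and off-diagonal entries are
  added for free. The dimension constant of the Harnack inequality originates here.\<close>

lemma trace_square_le:
  fixes B :: "'m::finite \<Rightarrow> 'm \<Rightarrow> complex"
  shows "(\<Sum>i\<in>UNIV. Re (B i i))\<^sup>2 \<le> real CARD('m) * (\<Sum>i\<in>UNIV. \<Sum>j\<in>UNIV. (cmod (B i j))\<^sup>2)"
proof -
  have "(\<Sum>i\<in>UNIV. Re (B i i))\<^sup>2 \<le> (\<Sum>i\<in>UNIV. (Re (B i i))\<^sup>2) * (\<Sum>i\<in>(UNIV::'m set). 1\<^sup>2)"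
    using Cauchy_Schwarz_ineq_sum[of "\<lambda>i. Re (B i i)" "\<lambda>i. 1" UNIV] by simp
  also have "\<dots> = real CARD('m) * (\<Sum>i\<in>UNIV. (Re (B i i))\<^sup>2)" by simp
  also have "\<dots> \<le> real CARD('m) * (\<Sum>i\<in>UNIV. \<Sum>j\<in>UNIV. (cmod (B i j))\<^sup>2)"
  proof (intro mult_left_mono sum_mono)
    fix i
    have "(Re (B i i))\<^sup>2 \<le> (cmod (B i i))\<^sup>2" by (simp add: cmod_power2)
    also have "\<dots> \<le> (\<Sum>j\<in>UNIV. (cmod (B i j))\<^sup>2)" by (rule member_le_sum) auto
    finally show "(Re (B i i))\<^sup>2 \<le> (\<Sum>j\<in>UNIV. (cmod (B i j))\<^sup>2)" .
  qed simp
  finally show ?thesis .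
qed

text \<open>The algebra at a negative minimum, in a unitary frame: \<open>h\<close> is the complex
  Hessian of u, \<open>y\<close> the components of V = \<nabla>u / u, \<open>\<gamma>\<close> the
  derivative of the metric, and \<open>q\<close>, \<open>r\<close>, \<open>k\<close> are diagonal
  entries of the Hessians of u_t, D_V u and |V|^2 with V held constant. The matrix
  \<open>A + \<gamma>\<close> is the complex Hessian of ln u, with trace \<open>P\<close> and
  squared norm \<open>Q\<close>. Summing \<open>space\<close> over the frame and using
  \<open>time\<close> gives \<open>P + \<tau> * Q \<le> 0\<close>, whereas \<open>neg\<close> gives
  \<open>\<tau> * P + n < 0\<close>.\<close>

lemma minimum_inequalities_inconsistent:
  fixes h \<gamma> :: "'m::finite \<Rightarrow> 'm \<Rightarrow> complex" and y :: "'m \<Rightarrow> complex" and q r k :: "'m \<Rightarrow> real"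
  assumes U: "0 < U" and \<tau>: "0 < \<tau>"
  defines "n \<equiv> real CARD('m)" and "A \<equiv> \<lambda>i j. h i j / of_real U - \<gamma> i j - cnj (y i) * y j"
    and "N \<equiv> (\<Sum>j\<in>UNIV. (cmod (y j))\<^sup>2)"
  assumes space: "\<And>i. 0 \<le> \<tau> * (q i - r i + U * k i + 2 * Re (of_real U * (y i * (\<Sum>j\<in>UNIV. cnj (y j) * \<gamma> i j)))
      + Re (h i i) * N) + n * Re (h i i)
      + \<tau> * (- 2 * Re (\<Sum>j\<in>UNIV. A i j * cnj (h i j)) + 2 * U * Re (\<Sum>j\<in>UNIV. cnj (A i j) * \<gamma> i j)
      + 2 * Re (of_real U * (cnj (y i) * (\<Sum>j\<in>UNIV. cnj (A i j) * y j))))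
      + \<tau> * (U * (\<Sum>j\<in>UNIV. (cmod (A i j))\<^sup>2))"
    and time: "ut - 2 * U * N + U * N + \<tau> * (utt - utV + (ut * N - U * uVV)) + n * ut \<le> 0"
    and E1: "ut = Re (\<Sum>i\<in>UNIV. h i i)"
    and E2: "(\<Sum>i\<in>UNIV. q i) \<le> utt"
    and E3: "utV = (\<Sum>i\<in>UNIV. r i) - 2 * Re (\<Sum>i\<in>UNIV. \<Sum>j\<in>UNIV. \<gamma> i j * cnj (h i j))"
    and E4: "uVV = (\<Sum>i\<in>UNIV. \<Sum>j\<in>UNIV. (cmod (\<gamma> i j))\<^sup>2) - (\<Sum>i\<in>UNIV. k i)"
    and neg: "\<tau> * (ut - U * N) + n * U < 0"
  shows False
proof -
  let ?B = "\<lambda>i j. A i j + \<gamma> i j"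
  define Q where "Q = (\<Sum>i\<in>UNIV. \<Sum>j\<in>UNIV. (cmod (?B i j))\<^sup>2)"
  have term_ij: "- 2 * Re (A i j * cnj (h i j)) + 2 * Re (of_real U * (y i * (cnj (y j) * \<gamma> i j)))
      + 2 * Re (of_real U * (cnj (y i) * (cnj (A i j) * y j))) + 2 * U * Re (cnj (A i j) * \<gamma> i j)
      + U * (cmod (A i j))\<^sup>2
    = 2 * Re (\<gamma> i j * cnj (h i j)) - U * (cmod (?B i j))\<^sup>2 - U * (cmod (\<gamma> i j))\<^sup>2" for i j
  proof -
    have "h i j = of_real U * (A i j + \<gamma> i j + cnj (y i) * y j)"
      using U by (simp add: A_def)
    note complete_square[OF this]
    moreover have "Re (h i j * cnj (\<gamma> i j)) = Re (\<gamma> i j * cnj (h i j))" by simp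
    ultimately show ?thesis by (simp only: complex_cnj_mult complex_cnj_cnj mult_ac)
  qed
  have "0 \<le> \<tau> * (q i - r i + U * k i + Re (h i i) * N) + n * Re (h i i)
      + \<tau> * (\<Sum>j\<in>UNIV. 2 * Re (\<gamma> i j * cnj (h i j)) - U * (cmod (?B i j))\<^sup>2 - U * (cmod (\<gamma> i j))\<^sup>2)" for i
    using space[of i] unfolding term_ij[symmetric]
    by (simp add: sum.distrib sum_distrib_left sum_negf sum_subtractf algebra_simps Re_sum del: times_complex.sel)
  then have "0 \<le> (\<Sum>i\<in>UNIV. \<tau> * (q i - r i + U * k i + Re (h i i) * N) + n * Re (h i i)
      + \<tau> * (\<Sum>j\<in>UNIV. 2 * Re (\<gamma> i j * cnj (h i j)) - U * (cmod (?B i j))\<^sup>2 - U * (cmod (\<gamma> i j))\<^sup>2))"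
    by (intro sum_nonneg) auto
  also have "\<dots> = \<tau> * ((\<Sum>i\<in>UNIV. q i) - (\<Sum>i\<in>UNIV. r i) + U * (\<Sum>i\<in>UNIV. k i) + ut * N) + n * ut
      + \<tau> * (2 * Re (\<Sum>i\<in>UNIV. \<Sum>j\<in>UNIV. \<gamma> i j * cnj (h i j)) - U * Q
      - U * (\<Sum>i\<in>UNIV. \<Sum>j\<in>UNIV. (cmod (\<gamma> i j))\<^sup>2))"
    unfolding E1 Q_def Re_sum
    by (simp only: sum.distrib sum_subtractf sum_distrib_left[symmetric] sum_distrib_right[symmetric])
  \<comment> \<open>\<open>E3\<close> and \<open>E4\<close> absorb exactly the
    \<open>\<gamma>\<close> terms left by the completed square; the dependence on coordinates ends
    here.\<close>
  also have "\<dots> = \<tau> * ((\<Sum>i\<in>UNIV. q i) - utV - U * uVV + ut * N) + n * ut - \<tau> * U * Q"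
    unfolding E3 E4 by (simp add: algebra_simps)
  also have "\<dots> \<le> \<tau> * (utt - utV - U * uVV + ut * N) + n * ut - \<tau> * U * Q"
    using E2 \<tau> by (intro add_right_mono diff_right_mono mult_left_mono) auto
  also have "\<dots> \<le> U * N - ut - \<tau> * U * Q" using time by (simp add: algebra_simps)
  finally have le: "ut - U * N + \<tau> * U * Q \<le> 0" by simp
  define P where "P = (\<Sum>i\<in>UNIV. Re (?B i i))"
  have UP: "U * P = ut - U * N"
  proof -
    have "U * Re (?B i i) = Re (h i i) - U * (cmod (y i))\<^sup>2" for i
      unfolding cmod_power2 using U by (simp add: A_def power2_eq_square field_simps)
    then show ?thesis unfolding P_def E1 N_def sum_distrib_left Re_sum by (simp add: sum_subtractf)
  qed
  have "U * (P + \<tau> * Q) = U * P + \<tau> * U * Q" "U * (\<tau> * P + n) = \<tau> * (U * P) + n * U"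
    by (simp_all add: algebra_simps)
  then have "U * (P + \<tau> * Q) \<le> 0" "U * (\<tau> * P + n) < 0"
    using le neg unfolding UP by simp_all
  then have PQ: "P + \<tau> * Q \<le> 0" "\<tau> * P + n < 0"
    using U by (auto simp: mult_le_0_iff mult_less_0_iff)
  have n: "0 < n" by (simp add: n_def)
  have "P < 0" using PQ(2) n \<tau> by (smt (verit) mult_nonneg_nonneg)
  \<comment> \<open>Multiplying by the negative number \<open>P\<close> produces a square, which the
    trace inequality bounds by \<open>n * Q\<close>.\<close>
  then have "0 < P * (\<tau> * P + n)" using PQ(2) by (simp add: mult_neg_neg)
  also have "\<dots> = \<tau> * P\<^sup>2 + n * P" by (simp add: power2_eq_square algebra_simps)
  also have "\<dots> \<le> \<tau> * (n * Q) + n * P"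
    using trace_square_le[of ?B] \<tau> by (simp add: P_def Q_def n_def)
  also have "\<dots> = n * (P + \<tau> * Q)" by (simp add: algebra_simps)
  also have "\<dots> \<le> 0" using PQ(1) n by (simp add: mult_le_0_iff)
  finally show False by simp
qed

text \<open>\<open>kahler\<close> is the symmetry of the first derivatives of a Kaehler metric, and
  \<open>flow\<close> is the evolution of the metric. \<open>time\<close> and \<open>ricci\<close>
  express that u + ln det g has vanishing time derivative and vanishing complex Hessian;
  \<open>ricci\<close> states the latter as a Laplacian on each complex line.\<close>

locale local_kahler_flow =
  fixes S :: "((complex^'m::finite) \<times> real) set"
    and u :: "(complex^'m) \<times> real \<Rightarrow> real" and G :: "(complex^'m) \<times> real \<Rightarrow> complex^'m^'m"
  assumes S: "open S" and u: "smooth_on S u" and G: "\<And>\<alpha> \<beta>. smooth_on S (\<lambda>p. G p $ \<alpha> $ \<beta>)"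
    and herm: "\<And>p. p \<in> S \<Longrightarrow> hermitian_positive (G p)"
    and kahler: "\<And>p a v w. p \<in> S \<Longrightarrow>
      dz a (\<lambda>p. sesq_form (G p) v w) p = dz v (\<lambda>p. sesq_form (G p) a w) p"
    and flow: "\<And>p v w. p \<in> S \<Longrightarrow>
      dir_deriv (0, 1) (\<lambda>p. sesq_form (G p) v w) p = - dz v (dzb w (\<lambda>p. of_real (u p))) p"
    and time: "\<And>p. p \<in> S \<Longrightarrow>
      dir_deriv (0, 1) u p = - dir_deriv (0, 1) (\<lambda>p. ln (Re (det (G p)))) p"
    and ricci: "\<And>p v. p \<in> S \<Longrightarrow>
      dir_deriv (v, 0) (dir_deriv (v, 0) u) p + dir_deriv (\<i> *s v, 0) (dir_deriv (\<i> *s v, 0) u) p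
      = - (dir_deriv (v, 0) (dir_deriv (v, 0) (\<lambda>p. ln (Re (det (G p))))) p
         + dir_deriv (\<i> *s v, 0) (dir_deriv (\<i> *s v, 0) (\<lambda>p. ln (Re (det (G p))))) p)"
begin

abbreviation g where "g v w \<equiv> \<lambda>p. sesq_form (G p) v w"
abbreviation cu where "cu \<equiv> \<lambda>p. complex_of_real (u p)"
abbreviation ld where "ld \<equiv> \<lambda>p. ln (Re (det (G p)))"

lemma smooth_g: "smooth_on S (g v w)"
  unfolding sesq_form_def by (intro smooth_on_intros G)

lemma smooth_cu: "smooth_on S cu"
  by (intro smooth_on_of_real u)

lemma smooth_ld: "smooth_on S ld"
proof (rule smooth_on_ln)
  have "(\<chi> i j. G p $ i $ j) = G p" for p by (simp add: vec_eq_iff)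
  then show "smooth_on S (\<lambda>p. Re (det (G p)))"
    using smooth_on_Re[OF smooth_on_det[of S "\<lambda>i j p. G p $ i $ j", OF G]] by simp
qed (simp add: herm Re_det_pos)

lemma g_cnj: "p \<in> S \<Longrightarrow> g w v p = cnj (g v w p)"
  using sesq_form_cnj[OF herm] .

lemma dzb_g: assumes p: "p \<in> S" shows "dzb a (g v w) p = cnj (dz a (g w v) p)"
proof -
  have "dzb a (g v w) p = dzb a (\<lambda>p. cnj (g w v p)) p"
    by (rule dzb_cong[OF S p smooth_on_linear[OF bounded_linear_cnj smooth_g]]) (rule g_cnj[symmetric])
  then show ?thesis using dzb_cnj[OF S p smooth_g] by simp
qed

lemma kahler_bar: "p \<in> S \<Longrightarrow> dzb a (g v w) p = dzb w (g v a) p"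
  using kahler[of p a w v] by (simp add: dzb_g)

lemma dir_deriv_dz_dzb:
  assumes H: "smooth_on S H" and p: "p \<in> S"
  shows "dir_deriv X (dz v (dzb w H)) p = dz v (dzb w (dir_deriv X H)) p"
  unfolding dir_deriv_dz[OF S p smooth_on_dzb[OF S H]]
  by (rule dz_cong[OF S p])
    (auto intro!: smooth_on_dzb S smooth_on_dir_deriv H simp: dir_deriv_dzb[OF S _ H])

lemma dz_dzb_cong:
  assumes "smooth_on S H" "\<And>y. y \<in> S \<Longrightarrow> H y = H' y" and p: "p \<in> S"
  shows "dz v (dzb w H') p = dz v (dzb w H) p"
  by (rule dz_cong[OF S p]) (auto intro!: smooth_on_dzb S assms simp: dzb_cong[OF S _ assms(1,2)])

lemma dir_deriv_dz_dzb_of_real: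
  assumes f: "smooth_on S f" and p: "p \<in> S"
  shows "dir_deriv X (dz v (dzb w (\<lambda>p. complex_of_real (f p)))) p
    = dz v (dzb w (\<lambda>p. complex_of_real (dir_deriv X f p))) p"
  unfolding dir_deriv_dz_dzb[OF smooth_on_of_real[OF f] p]
  by (rule dz_dzb_cong[OF _ _ p])
    (auto intro!: smooth_on_of_real smooth_on_dir_deriv f S simp: dir_deriv_of_real[OF S _ f])

lemma Re_dz_dzb_of_real:
  assumes f: "smooth_on S f" and p: "p \<in> S"
  shows "Re (dz v (dzb w (\<lambda>p. complex_of_real (f p))) p)
    = (dir_deriv (v, 0) (dir_deriv (w, 0) f) p + dir_deriv (\<i> *s v, 0) (dir_deriv (\<i> *s w, 0) f) p) / 4"
  unfolding dz_dzb_expand[OF S p smooth_on_of_real[OF f]] dir_deriv2_of_real[OF S p f] by simp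

lemma dir_deriv2_time:
  assumes p: "p \<in> S"
  shows "dir_deriv X (dir_deriv (0, 1) u) p = - dir_deriv X (dir_deriv (0, 1) ld) p"
proof -
  have "dir_deriv X (dir_deriv (0, 1) u) p = dir_deriv X (\<lambda>p. - dir_deriv (0, 1) ld p) p"
    by (rule dir_deriv_cong[OF S p])
      (auto intro!: smooth_on_minus smooth_on_dir_deriv S smooth_ld simp: time)
  then show ?thesis using dir_deriv_minus[OF S p smooth_on_dir_deriv[OF smooth_ld S]] by simp
qed

lemma dz_g_sum_right:
  assumes p: "p \<in> S"
  shows "dz b (g v (\<Sum>j\<in>I. a j *s w j)) p = (\<Sum>j\<in>I. cnj (a j) * dz b (g v (w j)) p)"
proof -
  have "dir_deriv X (g v (\<Sum>j\<in>I. a j *s w j)) p = (\<Sum>j\<in>I. cnj (a j) * dir_deriv X (g v (w j)) p)" for X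
    unfolding sesq_form_sum_right sesq_form_scale_right
    by (subst dir_deriv_sum[OF S p]) (auto intro!: smooth_on_intros smooth_g simp: dir_deriv_cmult[OF S p smooth_g])
  then show ?thesis unfolding dz_def
    by (simp add: sum_distrib_left sum_subtractf[symmetric] sum_divide_distrib algebra_simps)
qed

text \<open>By \<open>flow\<close> the Hessian is minus the time derivative of a Hermitian matrix,
  so its symmetry is inherited from the metric.\<close>

lemma hess_hermitian:
  assumes p: "p \<in> S"
  shows "dz v (dzb w cu) p = cnj (dz w (dzb v cu) p)"
proof -
  have "dir_deriv (0, 1) (g v w) p = dir_deriv (0, 1) (\<lambda>p. cnj (g w v p)) p"
    by (rule dir_deriv_cong[OF S p]) (auto intro!: smooth_on_linear[OF bounded_linear_cnj] smooth_g simp: g_cnj[of _ v w])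
  also have "\<dots> = cnj (dir_deriv (0, 1) (g w v) p)"
    by (rule dir_deriv_bounded_linear[OF S p bounded_linear_cnj smooth_g])
  finally show ?thesis by (simp add: flow[OF p])
qed

lemma dir_deriv_time_g:
  assumes p: "p \<in> S"
  shows "dir_deriv X (dir_deriv (0, 1) (g v w)) p = - dz v (dzb w (\<lambda>p. of_real (dir_deriv X u p))) p"
proof -
  have "dir_deriv X (dir_deriv (0, 1) (g v w)) p = dir_deriv X (\<lambda>p. - dz v (dzb w cu) p) p"
    by (rule dir_deriv_cong[OF S p]) (auto intro!: smooth_on_minus smooth_on_dz smooth_on_dzb S smooth_cu simp: flow)
  then show ?thesis
    by (simp add: dir_deriv_minus[OF S p smooth_on_dz[OF S smooth_on_dzb[OF S smooth_cu]]]
        dir_deriv_dz_dzb_of_real[OF u p])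
qed

context
  fixes p and e :: "'m \<Rightarrow> complex^'m"
  assumes p: "p \<in> S" and e: "\<And>i j. sesq_form (G p) (e i) (e j) = (if i = j then 1 else 0)"
begin

text \<open>The vectors \<open>e i\<close> are constant and unitary at \<open>p\<close> only. Their
  Gram determinant is a constant multiple of the determinant of \<open>G\<close>, so both logarithms
  have the same derivatives, and at \<open>p\<close> the Gram matrix is the identity.\<close>

lemma ld_frame:
  "dir_deriv X ld p = Re (\<Sum>k\<in>UNIV. dir_deriv X (g (e k) (e k)) p)"
  "dir_deriv Y (dir_deriv X ld) p = Re ((\<Sum>k\<in>UNIV. dir_deriv Y (dir_deriv X (g (e k) (e k))) p)
     - (\<Sum>k\<in>UNIV. \<Sum>l\<in>UNIV. dir_deriv X (g (e k) (e l)) p * dir_deriv Y (g (e l) (e k)) p))"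
proof -
  let ?D = "\<lambda>q. det (\<chi> i j. g (e i) (e j) q)"
  let ?L = "\<lambda>q. ln (Re (?D q))"
  define c where "c = (norm (det (\<chi> i j. e i $ j)))\<^sup>2"
  have "c * Re (det (G p)) = 1" unfolding c_def by (rule det_unitary_frame[OF e])
  then have c: "0 < c" by (metis c_def mult_zero_left order_le_less zero_le_power2 zero_neq_one)
  have D: "Re (?D q) = c * Re (det (G q))" for q
    unfolding det_sesq_form c_def by simp
  have L: "?L q + - ln c = ld q" if "q \<in> S" for q
    unfolding D using c Re_det_pos[OF herm[OF that]] by (simp add: ln_mult)
  have pos: "0 < Re (?D q)" if "q \<in> S" for q
    unfolding D using c Re_det_pos[OF herm[OF that]] by simp
  have im: "Im (g (e k) (e k) q) = 0" if "q \<in> S" for q k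
    using g_cnj[OF that, of "e k" "e k"] by (simp add: complex_eq_iff)
  have smL: "smooth_on S ?L"
    by (intro smooth_on_ln smooth_on_Re smooth_on_det smooth_g pos)
  have dL: "dir_deriv X ld q = dir_deriv X ?L q" if "q \<in> S" for q X
  proof -
    have "dir_deriv X ld q = dir_deriv X (\<lambda>q. ?L q + - ln c) q"
      by (rule dir_deriv_cong[OF S that smooth_on_add[OF smL smooth_on_const] L])
    then show ?thesis
      using dir_deriv_add[OF S that smL smooth_on_const, of X "- ln c"] by (simp add: dir_deriv_const[OF S that])
  qed
  have ddL: "dir_deriv Y (dir_deriv X ld) p = dir_deriv Y (dir_deriv X ?L) p"
    by (rule dir_deriv_cong[OF S p]) (auto intro!: smooth_on_dir_deriv smL S simp: dL)
  note * = dir_deriv2_ln_det_identity[of S "\<lambda>i j. g (e i) (e j)" p, OF smooth_g S p e pos im]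
  show "dir_deriv X ld p = Re (\<Sum>k\<in>UNIV. dir_deriv X (g (e k) (e k)) p)"
    unfolding dL[OF p] by (rule *(1))
  show "dir_deriv Y (dir_deriv X ld) p = Re ((\<Sum>k\<in>UNIV. dir_deriv Y (dir_deriv X (g (e k) (e k))) p)
     - (\<Sum>k\<in>UNIV. \<Sum>l\<in>UNIV. dir_deriv X (g (e k) (e l)) p * dir_deriv Y (g (e l) (e k)) p))"
    unfolding ddL by (rule *(2))
qed

text \<open>By \<open>time\<close> and the derivative of ln det g, this is the trace of
  \<open>flow\<close>.\<close>

lemma heat: "dir_deriv (0, 1) u p = Re (\<Sum>i\<in>UNIV. dz (e i) (dzb (e i) cu) p)"
  unfolding time[OF p] ld_frame(1) flow[OF p] by (simp add: sum_negf)

text \<open>The metric inside the Laplacian moves by minus the Hessian of u, which adds the squared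
  norm of that Hessian to the right side; only its sign is kept.\<close>

lemma heat_deriv_time:
  "(\<Sum>i\<in>UNIV. Re (dz (e i) (dzb (e i) (\<lambda>p. of_real (dir_deriv (0, 1) u p))) p))
    \<le> dir_deriv (0, 1) (dir_deriv (0, 1) u) p"
proof -
  have "dz (e k) (dzb (e l) cu) p * dz (e l) (dzb (e k) cu) p = of_real ((cmod (dz (e k) (dzb (e l) cu) p))\<^sup>2)" for k l
    using hess_hermitian[OF p, of "e l" "e k"] by (simp only: complex_norm_square)
  then have "0 \<le> Re (\<Sum>k\<in>UNIV. \<Sum>l\<in>UNIV. dz (e k) (dzb (e l) cu) p * dz (e l) (dzb (e k) cu) p)"
    by (simp add: sum_nonneg)
  then show ?thesis
    unfolding dir_deriv2_time[OF p] ld_frame(2) dir_deriv_time_g[OF p] flow[OF p] by (simp add: sum_negf)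
qed

text \<open>The heat equation is differentiated along a constant vector. The correction is the
  derivative of the metric inside the Laplacian, which the Kaehler symmetry splits into
  \<open>\<gamma>\<close> and its conjugate transpose.\<close>

lemma heat_deriv_space:
  fixes V
  defines "\<gamma> \<equiv> \<lambda>i j. dz (e i) (g V (e j)) p"
  shows "dir_deriv (V, 0) (dir_deriv (0, 1) u) p
    = (\<Sum>i\<in>UNIV. Re (dz (e i) (dzb (e i) (\<lambda>p. of_real (dir_deriv (V, 0) u p))) p))
      - 2 * Re (\<Sum>i\<in>UNIV. \<Sum>j\<in>UNIV. \<gamma> i j * cnj (dz (e i) (dzb (e j) cu) p))"
proof -
  define h where "h i j = dz (e i) (dzb (e j) cu) p" for i j
  have h: "h i j = cnj (h j i)" for i j unfolding h_def by (rule hess_hermitian[OF p])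
  have D: "dir_deriv (V, 0) (g (e l) (e k)) p = \<gamma> l k + cnj (\<gamma> k l)" for k l
    unfolding dir_deriv_eq_dz dzb_g[OF p] \<gamma>_def kahler[OF p, of V] ..
  have "Re (\<Sum>k\<in>UNIV. \<Sum>l\<in>UNIV. h k l * (\<gamma> l k + cnj (\<gamma> k l)))
      = (\<Sum>k\<in>UNIV. \<Sum>l\<in>UNIV. Re (\<gamma> l k * cnj (h l k))) + (\<Sum>k\<in>UNIV. \<Sum>l\<in>UNIV. Re (\<gamma> k l * cnj (h k l)))"
    unfolding Re_sum sum.distrib[symmetric]
  proof (intro sum.cong refl)
    fix k l
    show "Re (h k l * (\<gamma> l k + cnj (\<gamma> k l))) = Re (\<gamma> l k * cnj (h l k)) + Re (\<gamma> k l * cnj (h k l))"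
      unfolding h[of k l] by (simp add: algebra_simps)
  qed
  also have "\<dots> = 2 * Re (\<Sum>i\<in>UNIV. \<Sum>j\<in>UNIV. \<gamma> i j * cnj (h i j))"
    by (subst sum.swap) (simp only: Re_sum mult_2)
  finally show ?thesis
    unfolding dir_deriv2_time[OF p] ld_frame(2) dir_deriv_time_g[OF p] flow[OF p] D
    by (simp add: sum_negf h_def[symmetric] del: times_complex.sel)
qed

text \<open>Ric(V, V) in two guises: the left side enters the time derivative of |V|^2, and the last
  sum enters the second-order test in space. Their cancellation makes the argument independent of
  the sign of the curvature.\<close>

lemma hess_eq_ricci:
  fixes V
  defines "\<gamma> \<equiv> \<lambda>i j. dz (e i) (g V (e j)) p"
  shows "Re (dz V (dzb V cu) p) = (\<Sum>i\<in>UNIV. \<Sum>j\<in>UNIV. (cmod (\<gamma> i j))\<^sup>2)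
    - (\<Sum>i\<in>UNIV. Re (dz (e i) (dzb (e i) (g V V)) p))"
proof -
  have "dz V (g (e k) (e l)) p = \<gamma> k l" for k l unfolding \<gamma>_def by (rule kahler[OF p])
  moreover have "dzb V (g (e k) (e l)) p = cnj (\<gamma> l k)" for k l
    unfolding dzb_g[OF p] \<gamma>_def by (subst kahler[OF p]) simp
  ultimately have sq: "dir_deriv (V, 0) (g (e k) (e l)) p * dir_deriv (V, 0) (g (e l) (e k)) p
      + dir_deriv (\<i> *s V, 0) (g (e k) (e l)) p * dir_deriv (\<i> *s V, 0) (g (e l) (e k)) p
      = of_real (2 * (cmod (\<gamma> k l))\<^sup>2 + 2 * (cmod (\<gamma> l k))\<^sup>2)" for k l
    unfolding dir_deriv_i_eq_dz unfolding dir_deriv_eq_dz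
    by (simp add: complex_norm_square algebra_simps del: of_real_power)
  \<comment> \<open>The Kaehler symmetry, applied once to the barred and once to the unbarred index,
    exchanges the directions of differentiation with the arguments of the metric.\<close>
  have four: "dz V (dzb V (g (e k) (e k))) p = dz (e k) (dzb (e k) (g V V)) p" for k
  proof -
    have "dz V (dzb V (g (e k) (e k))) p = dz V (dzb (e k) (g (e k) V)) p"
      by (rule dz_cong[OF S p]) (auto intro!: smooth_on_dzb S smooth_g kahler_bar)
    also have "\<dots> = dzb (e k) (dz V (g (e k) V)) p" by (rule dz_dzb_commute[OF S p smooth_g])
    also have "\<dots> = dzb (e k) (dz (e k) (g V V)) p"
      by (rule dzb_cong[OF S p]) (auto intro!: smooth_on_dz S smooth_g kahler)
    also have "\<dots> = dz (e k) (dzb (e k) (g V V)) p" by (rule dz_dzb_commute[OF S p smooth_g, symmetric])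
    finally show ?thesis .
  qed
  have sw: "(\<Sum>k\<in>UNIV. \<Sum>l\<in>UNIV. (cmod (\<gamma> l k))\<^sup>2) = (\<Sum>k\<in>UNIV. \<Sum>l\<in>UNIV. (cmod (\<gamma> k l))\<^sup>2)"
    by (rule sum.swap)
  have "dir_deriv (V, 0) (dir_deriv (V, 0) ld) p + dir_deriv (\<i> *s V, 0) (dir_deriv (\<i> *s V, 0) ld) p
    = Re ((\<Sum>k\<in>UNIV. dir_deriv (V, 0) (dir_deriv (V, 0) (g (e k) (e k))) p
            + dir_deriv (\<i> *s V, 0) (dir_deriv (\<i> *s V, 0) (g (e k) (e k))) p)
     - (\<Sum>k\<in>UNIV. \<Sum>l\<in>UNIV. dir_deriv (V, 0) (g (e k) (e l)) p * dir_deriv (V, 0) (g (e l) (e k)) p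
          + dir_deriv (\<i> *s V, 0) (g (e k) (e l)) p * dir_deriv (\<i> *s V, 0) (g (e l) (e k)) p))"
    unfolding ld_frame(2) by (simp add: sum.distrib)
  also have "\<dots> = 4 * (\<Sum>k\<in>UNIV. Re (dz V (dzb V (g (e k) (e k))) p))
      - (\<Sum>k\<in>UNIV. \<Sum>l\<in>UNIV. 2 * (cmod (\<gamma> k l))\<^sup>2 + 2 * (cmod (\<gamma> l k))\<^sup>2)"
    unfolding sq dz_dzb_same[OF S p smooth_g] by (simp add: sum_distrib_left add_divide_distrib)
  also have "\<dots> = 4 * ((\<Sum>k\<in>UNIV. Re (dz (e k) (dzb (e k) (g V V)) p)) - (\<Sum>k\<in>UNIV. \<Sum>l\<in>UNIV. (cmod (\<gamma> k l))\<^sup>2))"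
    unfolding four sum.distrib sum_distrib_left[symmetric] sw by simp
  finally show ?thesis
    unfolding Re_dz_dzb_of_real[OF u p] ricci[OF p] by simp
qed

end

end

section \<open>First- and second-order tests at a minimum of the barrier\<close>

context local_kahler_flow
begin

text \<open>
  Minimising over \<open>V\<close> turns \<open>- D\<^sub>V u + u |V|\<^sup>2\<close> into \<open>- |\<nabla>u|\<^sup>2 / u\<close>.
\<close>

definition barrier :: "real \<Rightarrow> (complex^'m) \<times> real \<Rightarrow> complex^'m \<Rightarrow> real" where
  "barrier \<epsilon> p V = (snd p - \<epsilon>) * (dir_deriv (0, 1) u p - dir_deriv (V, 0) u p + u p * Re (g V V p))
     + real CARD('m) * u p"

text \<open>\<open>grad\<close> says that \<open>V\<close> is \<nabla>u / u at \<open>p\<close>. In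
  \<open>min\<close> the vector \<open>W\<close> may vary with the point, which is the freedom to
  choose slopes; only times up to that of \<open>p\<close> are compared, since \<open>p\<close> may
  lie at the end of the time interval.\<close>

context
  fixes p :: "(complex^'m) \<times> real" and V :: "complex^'m" and \<epsilon> :: real
  assumes p: "p \<in> S" and u_pos: "0 < u p" and \<epsilon>: "\<epsilon> < snd p"
    and grad: "\<And>w. dir_deriv (w, 0) u p = 2 * u p * Re (g w V p)"
    and min: "\<And>q W. q \<in> S \<Longrightarrow> snd q \<le> snd p \<Longrightarrow> barrier \<epsilon> p V \<le> barrier \<epsilon> q W"
begin

lemma smooth_du: "smooth_on S (dir_deriv X u)"
  by (rule smooth_on_dir_deriv[OF u S])

lemma smooth_Re_g: "smooth_on S (\<lambda>p. Re (g v w p))"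
  by (rule smooth_on_Re[OF smooth_g])

text \<open>The second-order test along p + s X with the vector \<open>V + s *\<^sub>R a\<close>.
  Along this line the barrier is a quadratic polynomial in s with smooth coefficient functions, and
  \<tau> is constant because \<open>X\<close> is purely spatial.\<close>

lemma barrier_space:
  fixes X :: "(complex^'m) \<times> real" and a
  defines "\<tau> \<equiv> snd p - \<epsilon>" and "D \<equiv> \<lambda>f :: (complex^'m) \<times> real \<Rightarrow> real. dir_deriv X (dir_deriv X f) p"
    and "N \<equiv> \<lambda>p. Re (g V V p)"
  assumes X: "snd X = 0"
  shows "0 \<le> \<tau> * (D (dir_deriv (0, 1) u) - D (dir_deriv (V, 0) u) + u p * D N
      + 2 * dir_deriv X u p * dir_deriv X N p + D u * N p) + real CARD('m) * D u
    + 2 * \<tau> * (- dir_deriv X (dir_deriv (a, 0) u) p + 2 * (u p * dir_deriv X (\<lambda>p. Re (g V a p)) p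
        + dir_deriv X u p * Re (g V a p)))
    + 2 * \<tau> * (u p * Re (g a a p))"
proof -
  let ?n = "real CARD('m)"
  let ?a1 = "\<lambda>q. dir_deriv (0, 1) u q + ((-1) * dir_deriv (V, 0) u q + u q * N q)"
  let ?a = "\<lambda>q. \<tau> * ?a1 q + ?n * u q"
  let ?b1 = "\<lambda>q. (-1) * dir_deriv (a, 0) u q + 2 * (u q * Re (g V a q))"
  let ?b = "\<lambda>q. \<tau> * ?b1 q"
  let ?c = "\<lambda>q. \<tau> * (u q * Re (g a a q))"
  have smN: "smooth_on S N" unfolding N_def by (rule smooth_Re_g)
  note sm = u smN smooth_du smooth_Re_g
  have a: "smooth_on S ?a" and b: "smooth_on S ?b" and c: "smooth_on S ?c"
    by (intro smooth_on_intros sm)+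
  have "barrier \<epsilon> q (V + s *\<^sub>R a) = ?a q + s * ?b q + s\<^sup>2 * ?c q" if q: "q \<in> S" "snd q = snd p" for q s
  proof -
    have "dir_deriv (V + s *\<^sub>R a, 0) u q = dir_deriv (V, 0) u q + s * dir_deriv (a, 0) u q"
      using linear_add[OF dir_deriv_linear[OF S q(1) u], of "(V, 0)" "s *\<^sub>R (a, 0)"]
        linear_cmul[OF dir_deriv_linear[OF S q(1) u], of s "(a, 0)"] by simp
    moreover have "Re (g (V + s *\<^sub>R a) (V + s *\<^sub>R a) q) = N q + 2 * s * Re (g V a q) + s\<^sup>2 * Re (g a a q)"
      using g_cnj[OF q(1), of a V]
      by (simp add: scaleR_eq_vector_scalar_mult sesq_form_add_left sesq_form_add_right sesq_form_scale_left
          sesq_form_scale_right N_def power2_eq_square algebra_simps)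
    ultimately show ?thesis
      by (simp add: barrier_def q(2) \<tau>_def power2_eq_square algebra_simps)
  qed
  moreover have "barrier \<epsilon> p V = ?a p"
    by (simp add: barrier_def \<tau>_def N_def)
  ultimately have "?a p \<le> ?a (p + s *\<^sub>R X) + s * ?b (p + s *\<^sub>R X) + s\<^sup>2 * ?c (p + s *\<^sub>R X)"
    if "p + s *\<^sub>R X \<in> S" for s
    using min[OF that, of "V + s *\<^sub>R a"] that by (simp add: X)
  from barrier_second_deriv[OF S p a b c this]
  have "0 \<le> D ?a + 2 * dir_deriv X ?b p + 2 * ?c p" unfolding D_def by blast
  moreover have "D ?a = \<tau> * (D (dir_deriv (0, 1) u) - D (dir_deriv (V, 0) u) + (u p * D N
      + 2 * dir_deriv X u p * dir_deriv X N p + D u * N p)) + ?n * D u"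
  proof -
    have a1: "smooth_on S ?a1" by (intro smooth_on_intros sm)
    have "D ?a = D (\<lambda>q. \<tau> * ?a1 q) + D (\<lambda>q. ?n * u q)"
      unfolding D_def by (rule dir_deriv2_add[OF S p]) (intro smooth_on_intros sm)+
    also have "D (\<lambda>q. ?n * u q) = ?n * D u" unfolding D_def by (rule dir_deriv2_cmult[OF S p u])
    also have "D (\<lambda>q. \<tau> * ?a1 q) = \<tau> * D ?a1" unfolding D_def by (rule dir_deriv2_cmult[OF S p a1])
    also have "D ?a1 = D (dir_deriv (0, 1) u) + D (\<lambda>q. (-1) * dir_deriv (V, 0) u q + u q * N q)"
      unfolding D_def by (rule dir_deriv2_add[OF S p]) (intro smooth_on_intros sm)+
    also have "D (\<lambda>q. (-1) * dir_deriv (V, 0) u q + u q * N q)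
        = D (\<lambda>q. (-1) * dir_deriv (V, 0) u q) + D (\<lambda>q. u q * N q)"
      unfolding D_def by (rule dir_deriv2_add[OF S p]) (intro smooth_on_intros sm)+
    also have "D (\<lambda>q. (-1) * dir_deriv (V, 0) u q) = (-1) * D (dir_deriv (V, 0) u)"
      unfolding D_def by (rule dir_deriv2_cmult[OF S p smooth_du])
    also have "D (\<lambda>q. u q * N q) = u p * D N + 2 * dir_deriv X u p * dir_deriv X N p + D u * N p"
      unfolding D_def by (rule dir_deriv2_mult[OF S p u smN])
    finally show ?thesis by simp
  qed
  moreover have "dir_deriv X ?b p = \<tau> * (- dir_deriv X (dir_deriv (a, 0) u) p
      + 2 * (u p * dir_deriv X (\<lambda>p. Re (g V a p)) p + dir_deriv X u p * Re (g V a p)))"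
  proof -
    have c: "dir_deriv X (\<lambda>q. r * f q) p = r * dir_deriv X f p" if "smooth_on S f" for r and f :: "_ \<Rightarrow> real"
      using dir_deriv_mult[OF S p smooth_on_const that, of X r] by (simp add: dir_deriv_const[OF S p])
    have uV: "smooth_on S (\<lambda>q. u q * Re (g V a q))" by (intro smooth_on_intros sm)
    have "dir_deriv X ?b p = \<tau> * dir_deriv X ?b1 p" by (rule c) (intro smooth_on_intros sm)
    also have "dir_deriv X ?b1 p = dir_deriv X (\<lambda>q. (-1) * dir_deriv (a, 0) u q) p
        + dir_deriv X (\<lambda>q. 2 * (u q * Re (g V a q))) p"
      by (rule dir_deriv_add[OF S p]) (intro smooth_on_intros sm)+
    also have "dir_deriv X (\<lambda>q. (-1) * dir_deriv (a, 0) u q) p = (-1) * dir_deriv X (dir_deriv (a, 0) u) p"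
      by (rule c[OF smooth_du])
    also have "dir_deriv X (\<lambda>q. 2 * (u q * Re (g V a q))) p = 2 * dir_deriv X (\<lambda>q. u q * Re (g V a q)) p"
      by (rule c[OF uV])
    also have "dir_deriv X (\<lambda>q. u q * Re (g V a q)) p
        = u p * dir_deriv X (\<lambda>p. Re (g V a p)) p + dir_deriv X u p * Re (g V a p)"
      by (rule dir_deriv_mult[OF S p u smooth_Re_g])
    finally show ?thesis by simp
  qed
  ultimately show ?thesis by (simp add: algebra_simps)
qed

text \<open>The first-order test backwards in time with \<open>V\<close> fixed: a positive time
  derivative would give smaller values just before. The terms without \<tau> come from
  differentiating the factor t - \<epsilon>; there \<open>grad\<close> replaces D_V u by 2 u
  |V|^2.\<close>

lemma barrier_time:
  "dir_deriv (0, 1) u p - 2 * u p * Re (g V V p) + u p * Re (g V V p)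
    + (snd p - \<epsilon>) * (dir_deriv (0, 1) (dir_deriv (0, 1) u) p - dir_deriv (V, 0) (dir_deriv (0, 1) u) p
       + (dir_deriv (0, 1) u p * Re (g V V p) - u p * Re (dz V (dzb V cu) p)))
    + real CARD('m) * dir_deriv (0, 1) u p \<le> 0"
    (is "?l \<le> 0")
proof (rule ccontr)
  let ?n = "real CARD('m)" and ?X = "(0, 1) :: (complex^'m) \<times> real"
  define N where "N q = Re (g V V q)" for q
  let ?B = "\<lambda>q. dir_deriv (0, 1) u q - dir_deriv (V, 0) u q + u q * N q"
  have smN: "smooth_on S N" unfolding N_def[abs_def] by (rule smooth_Re_g)
  have B: "smooth_on S ?B" by (intro smooth_on_intros u smN smooth_du)
  have uN: "smooth_on S (\<lambda>q. u q * N q)" by (intro smooth_on_intros u smN)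
  have "dir_deriv ?X N p = - Re (dz V (dzb V cu) p)"
    unfolding N_def[abs_def] dir_deriv_Re[OF S p smooth_g] flow[OF p] by simp
  then have dB: "dir_deriv ?X ?B p = dir_deriv (0, 1) (dir_deriv (0, 1) u) p
      - dir_deriv (V, 0) (dir_deriv (0, 1) u) p + (dir_deriv (0, 1) u p * N p - u p * Re (dz V (dzb V cu) p))"
    using dir_deriv_add[OF S p smooth_on_diff[OF smooth_du smooth_du] uN, of ?X "(0, 1)" "(V, 0)"]
      dir_deriv_diff[OF S p smooth_du smooth_du, of ?X "(0, 1)" "(V, 0)"]
      dir_deriv_mult[OF S p u smN, of ?X] dir_deriv_commute[OF u S p, of "(V, 0)" ?X] by simp
  let ?f = "\<lambda>s. (snd p + s - \<epsilon>) * ?B (p + s *\<^sub>R ?X) + ?n * u (p + s *\<^sub>R ?X)"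
  have p0: "p + 0 *\<^sub>R ?X \<in> S" using p by (simp add: zero_prod_def[symmetric])
  have line: "((\<lambda>s. h (p + s *\<^sub>R ?X)) has_real_derivative dir_deriv ?X h p) (at 0)" if "smooth_on S h" for h
    using smooth_on_along_line[OF that S p0, of UNIV]
    by (simp add: has_real_derivative_iff_has_vector_derivative zero_prod_def[symmetric])
  have lin: "((\<lambda>s. snd p + s - \<epsilon>) has_real_derivative 1) (at 0)"
    by (auto intro!: derivative_eq_intros)
  have "(?f has_real_derivative (?B p + (snd p - \<epsilon>) * dir_deriv ?X ?B p + ?n * dir_deriv ?X u p)) (at 0)"
    by (rule DERIV_cong[OF DERIV_add[OF DERIV_mult[OF lin line[OF B]] DERIV_cmult[OF line[OF u]]]])
      (simp add: zero_prod_def[symmetric])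
  also have "?B p + (snd p - \<epsilon>) * dir_deriv ?X ?B p + ?n * dir_deriv ?X u p = ?l"
    unfolding dB using grad[of V] by (simp add: N_def)
  finally have f': "(?f has_real_derivative ?l) (at 0)" .
  assume "\<not> ?l \<le> 0"
  then obtain d where d: "0 < d" "\<And>h. 0 < h \<Longrightarrow> h < d \<Longrightarrow> ?f (0 - h) < ?f 0"
    using DERIV_pos_inc_left[OF f'] by auto
  obtain r where r: "0 < r" "ball p r \<subseteq> S" using S p openE by blast
  define h where "h = min d r / 2"
  have h: "0 < h" "h < d" "h < r" using d r by (auto simp: h_def)
  have "p + (0 - h) *\<^sub>R ?X \<in> ball p r" using h by (simp add: dist_norm norm_Pair)
  then have "barrier \<epsilon> p V \<le> barrier \<epsilon> (p + (0 - h) *\<^sub>R ?X) V" using r h by (intro min) auto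
  moreover have "barrier \<epsilon> (p + s *\<^sub>R ?X) V = ?f s" for s
    by (simp add: barrier_def N_def)
  then have "?f (0 - h) = barrier \<epsilon> (p + (0 - h) *\<^sub>R ?X) V" "?f 0 = barrier \<epsilon> (p + 0 *\<^sub>R ?X) V" by metis+
  ultimately show False using d(2)[OF h(1,2)] by (simp add: zero_prod_def[symmetric])
qed

lemma barrier_minimum_nonneg: "0 \<le> barrier \<epsilon> p V"
proof (rule ccontr)
  assume neg: "\<not> 0 \<le> barrier \<epsilon> p V"
  obtain e :: "'m \<Rightarrow> complex^'m" where e: "\<And>i j. sesq_form (G p) (e i) (e j) = (if i = j then 1 else 0)"
    using exists_unitary_frame[OF herm[OF p]] by metis
  define \<tau> U where "\<tau> = snd p - \<epsilon>" and "U = u p"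
  define h where "h i j = dz (e i) (dzb (e j) cu) p" for i j
  define \<gamma> where "\<gamma> i j = dz (e i) (g V (e j)) p" for i j
  define y where "y i = g V (e i) p" for i
  \<comment> \<open>The components of the covariant derivative of \<open>\<nabla>u / u\<close> in the direction \<open>e i\<close>; among all slopes \<open>a\<close>
    of the field along the line, this one gives the strongest second-order inequality.\<close>
  define A where "A i j = h i j / of_real U - \<gamma> i j - cnj (y i) * y j" for i j
  define a where "a i = (\<Sum>j\<in>UNIV. A i j *s e j)" for i
  define N where "N q = Re (g V V q)" for q
  define q where "q i = Re (dz (e i) (dzb (e i) (\<lambda>p. of_real (dir_deriv (0, 1) u p))) p)" for i
  define r where "r i = Re (dz (e i) (dzb (e i) (\<lambda>p. of_real (dir_deriv (V, 0) u p))) p)" for i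
  define k where "k i = Re (dz (e i) (dzb (e i) (g V V)) p)" for i
  have V: "V = (\<Sum>j\<in>UNIV. y j *s e j)"
    unfolding y_def by (rule unitary_frame_expansion[OF e])
  have frame: "sesq_form (G p) (\<Sum>i\<in>UNIV. c i *s e i) (\<Sum>j\<in>UNIV. c' j *s e j) = (\<Sum>j\<in>UNIV. c j * cnj (c' j))" for c c'
    unfolding sesq_form_sum_left sesq_form_sum_right sesq_form_scale_left sesq_form_scale_right e
    by (simp add: if_distrib mult.commute cong: if_cong)
  have gVV: "N p = (\<Sum>j\<in>UNIV. (cmod (y j))\<^sup>2)"
    unfolding N_def by (subst (1 2) V) (simp add: frame complex_norm_square[symmetric] del: of_real_power)
  have gVa: "g V (a i) p = (\<Sum>j\<in>UNIV. cnj (A i j) * y j)" for i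
    unfolding a_def by (subst V) (simp add: frame mult_ac)
  have gaa: "Re (g (a i) (a i) p) = (\<Sum>j\<in>UNIV. (cmod (A i j))\<^sup>2)" for i
    unfolding a_def by (simp add: frame complex_norm_square[symmetric] del: of_real_power)
  have dgVV: "dz (e i) (g V V) p = (\<Sum>j\<in>UNIV. cnj (y j) * \<gamma> i j)" for i
    unfolding \<gamma>_def using dz_g_sum_right[OF p, of "e i" V y e UNIV] V by simp
  have dgVa: "dz (e i) (g V (a i)) p = (\<Sum>j\<in>UNIV. cnj (A i j) * \<gamma> i j)" for i
    unfolding \<gamma>_def a_def by (rule dz_g_sum_right[OF p])
  have hess_a: "dz (a i) (dzb (e i) cu) p = (\<Sum>j\<in>UNIV. A i j * cnj (h i j))" for i
    unfolding a_def dz_linear[OF S p smooth_on_dzb[OF S smooth_cu]] h_def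
    using hess_hermitian[OF p, of _ "e i"] by simp
  have space: "0 \<le> \<tau> * (q i - r i + U * k i + 2 * Re (of_real U * (y i * (\<Sum>j\<in>UNIV. cnj (y j) * \<gamma> i j)))
      + Re (h i i) * N p) + real CARD('m) * Re (h i i)
      + \<tau> * (- 2 * Re (\<Sum>j\<in>UNIV. A i j * cnj (h i j)) + 2 * U * Re (\<Sum>j\<in>UNIV. cnj (A i j) * \<gamma> i j)
      + 2 * Re (of_real U * (cnj (y i) * (\<Sum>j\<in>UNIV. cnj (A i j) * y j))))
      + \<tau> * (U * (\<Sum>j\<in>UNIV. (cmod (A i j))\<^sup>2))" for i
  proof -
    \<comment> \<open>The field V + \<zeta> a on the complex line of \<open>e i\<close> is tested
      along the real and the imaginary axis of \<zeta>, with slopes \<open>a i\<close> and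
      \<open>\<i> *s a i\<close>. Adding the two tests leaves only combinations of type
      \<open>dz\<close> of \<open>dzb\<close>.\<close>
    let ?X = "(e i, 0) :: (complex^'m) \<times> real" and ?Y = "(\<i> *s e i, 0) :: (complex^'m) \<times> real"
    let ?D = "\<lambda>X f. dir_deriv X (dir_deriv X f) p :: real"
    have q: "?D ?X (dir_deriv (0, 1) u) + ?D ?Y (dir_deriv (0, 1) u) = 4 * q i"
      unfolding q_def Re_dz_dzb_of_real[OF smooth_du p] by simp
    have r: "?D ?X (dir_deriv (V, 0) u) + ?D ?Y (dir_deriv (V, 0) u) = 4 * r i"
      unfolding r_def Re_dz_dzb_of_real[OF smooth_du p] by simp
    have h: "?D ?X u + ?D ?Y u = 4 * Re (h i i)"
      unfolding h_def Re_dz_dzb_of_real[OF u p] by simp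
    have k: "?D ?X N + ?D ?Y N = 4 * k i"
      unfolding k_def N_def[abs_def] dir_deriv2_Re[OF S p smooth_g] dz_dzb_same[OF S p smooth_g] by simp
    have ux: "dir_deriv ?X u p = 2 * U * Re (y i)" "dir_deriv ?Y u p = 2 * U * Im (y i)"
      unfolding grad U_def y_def sesq_form_scale_left using g_cnj[OF p, of "e i" V] by simp_all
    have Nx: "dir_deriv ?X N p = 2 * Re (\<Sum>j\<in>UNIV. cnj (y j) * \<gamma> i j)"
      "dir_deriv ?Y N p = - 2 * Im (\<Sum>j\<in>UNIV. cnj (y j) * \<gamma> i j)"
      unfolding N_def[abs_def] dir_deriv_Re[OF S p smooth_g] dir_deriv_i_eq_dz dgVV[symmetric]
      unfolding dir_deriv_eq_dz dzb_g[OF p] by simp_all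
    have Va: "g V (\<i> *s a i) p' = - \<i> * g V (a i) p'" for p' by (simp add: sesq_form_scale_right)
    have rho: "dir_deriv ?X (\<lambda>p. Re (g V (a i) p)) p + dir_deriv ?Y (\<lambda>p. Re (g V (\<i> *s a i) p)) p
        = 2 * Re (\<Sum>j\<in>UNIV. cnj (A i j) * \<gamma> i j)"
      unfolding dir_deriv_Re[OF S p smooth_g] dgVa[symmetric]
      unfolding Va dir_deriv_cmult[OF S p smooth_g] unfolding dir_deriv_i_eq_dz unfolding dir_deriv_eq_dz by simp
    have hess: "dir_deriv ?X (dir_deriv (a i, 0) u) p + dir_deriv ?Y (dir_deriv (\<i> *s a i, 0) u) p
        = 4 * Re (\<Sum>j\<in>UNIV. A i j * cnj (h i j))"
      unfolding hess_a[symmetric] Re_dz_dzb_of_real[OF u p]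
      by (simp add: dir_deriv_commute[OF u S p, of ?X] dir_deriv_commute[OF u S p, of ?Y])
    have aa: "Re (g (\<i> *s a i) (\<i> *s a i) p) = Re (g (a i) (a i) p)"
      by (simp add: sesq_form_scale_left sesq_form_scale_right)
    note s1 = barrier_space[of "(e i, 0)" "a i", OF snd_conv, folded \<tau>_def U_def N_def]
    note s2 = barrier_space[of "(\<i> *s e i, 0)" "\<i> *s a i", OF snd_conv, folded \<tau>_def U_def N_def]
    have "0 \<le> \<tau> * ((?D ?X (dir_deriv (0, 1) u) + ?D ?Y (dir_deriv (0, 1) u))
        - (?D ?X (dir_deriv (V, 0) u) + ?D ?Y (dir_deriv (V, 0) u)) + U * (?D ?X N + ?D ?Y N)
        + 2 * (dir_deriv ?X u p * dir_deriv ?X N p + dir_deriv ?Y u p * dir_deriv ?Y N p)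
        + (?D ?X u + ?D ?Y u) * N p) + real CARD('m) * (?D ?X u + ?D ?Y u)
      + 2 * \<tau> * (- (dir_deriv ?X (dir_deriv (a i, 0) u) p + dir_deriv ?Y (dir_deriv (\<i> *s a i, 0) u) p)
        + 2 * U * (dir_deriv ?X (\<lambda>p. Re (g V (a i) p)) p + dir_deriv ?Y (\<lambda>p. Re (g V (\<i> *s a i) p)) p)
        + 2 * (dir_deriv ?X u p * Re (g V (a i) p) + dir_deriv ?Y u p * Re (g V (\<i> *s a i) p)))
      + 4 * (\<tau> * (U * Re (g (a i) (a i) p)))"
      using add_nonneg_nonneg[OF s1 s2] unfolding aa N_def[abs_def] U_def by (simp add: algebra_simps)
    also have "\<dots> = 4 * (\<tau> * (q i - r i + U * k i + 2 * Re (of_real U * (y i * (\<Sum>j\<in>UNIV. cnj (y j) * \<gamma> i j)))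
      + Re (h i i) * N p) + real CARD('m) * Re (h i i)
      + \<tau> * (- 2 * Re (\<Sum>j\<in>UNIV. A i j * cnj (h i j)) + 2 * U * Re (\<Sum>j\<in>UNIV. cnj (A i j) * \<gamma> i j)
      + 2 * Re (of_real U * (cnj (y i) * (\<Sum>j\<in>UNIV. cnj (A i j) * y j))))
      + \<tau> * (U * (\<Sum>j\<in>UNIV. (cmod (A i j))\<^sup>2)))"
      unfolding q r h k ux Nx rho hess gaa unfolding Va gVa by (simp add: algebra_simps del: Re_sum Im_sum cnj_sum)
    finally show ?thesis by simp
  qed
  show False
  proof (rule minimum_inequalities_inconsistent[where U = U and \<tau> = \<tau> and h = h and \<gamma> = \<gamma> and y = y
        and q = q and r = r and k = k and ut = "dir_deriv (0, 1) u p"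
        and utt = "dir_deriv (0, 1) (dir_deriv (0, 1) u) p" and utV = "dir_deriv (V, 0) (dir_deriv (0, 1) u) p"
        and uVV = "Re (dz V (dzb V cu) p)"])
    show "0 < U" "0 < \<tau>" using u_pos \<epsilon> by (simp_all add: U_def \<tau>_def)
    show "dir_deriv (0, 1) u p = Re (\<Sum>i\<in>UNIV. h i i)" unfolding h_def by (rule heat[OF p e])
    show "(\<Sum>i\<in>UNIV. q i) \<le> dir_deriv (0, 1) (dir_deriv (0, 1) u) p"
      unfolding q_def by (rule heat_deriv_time[OF p e])
    show "dir_deriv (V, 0) (dir_deriv (0, 1) u) p
        = (\<Sum>i\<in>UNIV. r i) - 2 * Re (\<Sum>i\<in>UNIV. \<Sum>j\<in>UNIV. \<gamma> i j * cnj (h i j))"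
      unfolding r_def h_def \<gamma>_def by (rule heat_deriv_space[OF p e])
    show "Re (dz V (dzb V cu) p) = (\<Sum>i\<in>UNIV. \<Sum>j\<in>UNIV. (cmod (\<gamma> i j))\<^sup>2) - (\<Sum>i\<in>UNIV. k i)"
      unfolding k_def \<gamma>_def by (rule hess_eq_ricci[OF p e])
    show "dir_deriv (0, 1) u p - 2 * U * (\<Sum>j\<in>UNIV. (cmod (y j))\<^sup>2) + U * (\<Sum>j\<in>UNIV. (cmod (y j))\<^sup>2)
        + \<tau> * (dir_deriv (0, 1) (dir_deriv (0, 1) u) p - dir_deriv (V, 0) (dir_deriv (0, 1) u) p
        + (dir_deriv (0, 1) u p * (\<Sum>j\<in>UNIV. (cmod (y j))\<^sup>2) - U * Re (dz V (dzb V cu) p)))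
        + real CARD('m) * dir_deriv (0, 1) u p \<le> 0"
      using barrier_time unfolding gVV[symmetric] N_def U_def \<tau>_def .
    show "\<tau> * (dir_deriv (0, 1) u p - U * (\<Sum>j\<in>UNIV. (cmod (y j))\<^sup>2)) + real CARD('m) * U < 0"
      using neg grad[of V] unfolding gVV[symmetric] N_def U_def \<tau>_def barrier_def by (simp add: algebra_simps)
  qed (use space in \<open>simp add: A_def gVV\<close>)
qed

end

end

section \<open>The flow in a chart\<close>

text \<open>\<open>in_chart\<close> with time as an additional coordinate; the value type is
  arbitrary so that functions, metrics and forms are handled alike.\<close>

definition lift :: "('a, 'm::finite) chart \<Rightarrow> ('a \<Rightarrow> real \<Rightarrow> 'b) \<Rightarrow> (complex^'m) \<times> real \<Rightarrow> 'b" where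
  "lift c h p = h (inv_into (fst c) (snd c) (fst p)) (snd p)"

lemma in_chart_eq_lift: "in_chart c (\<lambda>y. h y t) = (\<lambda>z. lift c h (z, t))"
  by (simp add: in_chart_def lift_def fun_eq_iff)

text \<open>The strict lower bound on time makes this set open over a chart, so for nonnegative
  \<epsilon> the one-sided derivatives at time 0 never enter.\<close>

definition slab :: "('a, 'm::finite) chart \<Rightarrow> real \<Rightarrow> ereal \<Rightarrow> ((complex^'m) \<times> real) set" where
  "slab c \<epsilon> T = (snd c ` fst c) \<times> {t. \<epsilon> < t \<and> ereal t < T}"

lemma chart_of_inj: "chart_of M c \<Longrightarrow> inj_on (snd c) (fst c)"
  unfolding chart_of_def homeomorphic_map_def
  by (metis homeomorphic_imp_injective_map homeomorphic_map_def inf.absorb_iff2 openin_subset topspace_subtopology)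

lemma chart_of_inv_into: "chart_of M c \<Longrightarrow> x \<in> fst c \<Longrightarrow> inv_into (fst c) (snd c) (snd c x) = x"
  using chart_of_inj by (metis inv_into_f_f)

lemma open_time: "open {t. \<epsilon> < t \<and> ereal t < T}"
proof (cases T)
  case (real r)
  then have "{t. \<epsilon> < t \<and> ereal t < T} = {\<epsilon><..<r}" by auto
  then show ?thesis by simp
next
  case PInf
  then have "{t. \<epsilon> < t \<and> ereal t < T} = {\<epsilon><..}" by auto
  then show ?thesis by simp
qed simp

lemma open_slab: "chart_of M c \<Longrightarrow> open (slab c \<epsilon> T)"
  unfolding slab_def chart_of_def by (intro open_Times open_time) auto

lemma smooth_on_lift_of_real:
  "smooth_on S (lift c h) \<Longrightarrow> smooth_on S (lift c (\<lambda>y t. complex_of_real (h y t)))"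
  using smooth_on_of_real[of S "lift c h"] by (simp add: lift_def[abs_def])

lemma axis_i: "\<i> *s axis \<alpha> 1 = (axis \<alpha> \<i> :: complex^'m::finite)"
  by (simp add: vec_eq_iff axis_def)

lemma vector_axis_sum: "v = (\<Sum>\<alpha>\<in>UNIV. v $ \<alpha> *s axis \<alpha> (1::complex))"
  by (simp add: vec_eq_iff axis_def if_distrib cong: if_cong)

lemma dzb_linear:
  assumes S: "open S" "p \<in> S" and H: "smooth_on S H"
  shows "dzb (\<Sum>i\<in>I. a i *s v i) H p = (\<Sum>i\<in>I. cnj (a i) * dzb (v i) H p)"
proof -
  have "smooth_on S (\<lambda>p. cnj (H p))" by (rule smooth_on_linear[OF bounded_linear_cnj H])
  note dz_linear[OF S this, of a v I]
  then show ?thesis unfolding dz_cnj[OF S H] by (metis (no_types, lifting) cnj_sum complex_cnj_cnj complex_cnj_mult sum.cong)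
qed

lemma dz_sum_cmult:
  assumes S: "open S" "p \<in> S" and H: "\<And>i. i \<in> I \<Longrightarrow> smooth_on S (H i)"
  shows "dz v (\<lambda>p. \<Sum>i\<in>I. a i * H i p) p = (\<Sum>i\<in>I. a i * dz v (H i) p)"
proof -
  have "dir_deriv X (\<lambda>p. \<Sum>i\<in>I. a i * H i p) p = (\<Sum>i\<in>I. a i * dir_deriv X (H i) p)" for X
    by (subst dir_deriv_sum[OF S]) (auto intro!: smooth_on_intros H simp: dir_deriv_cmult[OF S H])
  then show ?thesis unfolding dz_def
    by (simp add: sum_distrib_left sum_subtractf[symmetric] sum_divide_distrib algebra_simps)
qed

section \<open>Derivatives in a chart as space-time derivatives\<close>

context
  fixes M :: "'a topology" and c :: "('a, 'm::finite) chart" and \<epsilon> T x t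
  assumes c: "chart_of M c" and x: "x \<in> fst c" and t: "\<epsilon> < t" "ereal t < T"
begin

lemma slab_point: "(snd c x, t) \<in> slab c \<epsilon> T"
  using x t by (simp add: slab_def)

lemma lift_has_derivative:
  assumes h: "smooth_on (slab c \<epsilon> T) (lift c h)"
  shows "(in_chart c (\<lambda>y. h y t) has_derivative (\<lambda>v. dir_deriv (v, 0) (lift c h) (snd c x, t))) (at (snd c x))"
proof -
  have "((\<lambda>z. (z, t)) has_derivative (\<lambda>v. (v, 0))) (at (snd c x))"
    by (auto intro!: derivative_eq_intros)
  from has_derivative_compose[OF this smooth_on_has_derivative[OF h open_slab[OF c] slab_point]]
  show ?thesis unfolding in_chart_eq_lift .
qed

lemma chart_deriv_lift:
  assumes h: "smooth_on (slab c \<epsilon> T) (lift c h)"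
  shows "chart_deriv c (\<lambda>y. h y t) x v = dir_deriv (v, 0) (lift c h) (snd c x, t)"
  unfolding chart_deriv_def by (metis frechet_derivative_at[OF lift_has_derivative[OF h]])

lemma d_z_lift:
  "smooth_on (slab c \<epsilon> T) (lift c h) \<Longrightarrow> d_z c \<alpha> (\<lambda>y. h y t) x = dz (axis \<alpha> 1) (lift c h) (snd c x, t)"
  unfolding d_z_def dz_def axis_i by (simp add: chart_deriv_lift)

lemma d_zbar_lift:
  "smooth_on (slab c \<epsilon> T) (lift c h) \<Longrightarrow> d_zbar c \<alpha> (\<lambda>y. h y t) x = dzb (axis \<alpha> 1) (lift c h) (snd c x, t)"
  unfolding d_zbar_def dzb_def axis_i by (simp add: chart_deriv_lift)

lemma time_deriv_lift:
  assumes h: "smooth_on (slab c \<epsilon> T) (lift c h)" and "0 \<le> \<epsilon>"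
  shows "time_deriv T h x t = dir_deriv (0, 1) (lift c h) (snd c x, t)"
proof -
  have "((\<lambda>s. lift c h ((snd c x, 0) + s *\<^sub>R (0, 1))) has_vector_derivative
      dir_deriv (0, 1) (lift c h) ((snd c x, 0) + t *\<^sub>R (0, 1))) (at t)"
    by (rule smooth_on_along_line[OF h open_slab[OF c]]) (use slab_point in simp)
  then have d: "(h x has_vector_derivative dir_deriv (0, 1) (lift c h) (snd c x, t)) (at t)"
    by (simp add: lift_def chart_of_inv_into[OF c x])
  have "at t within time_interval T = at t"
    by (rule at_within_open_subset[OF _ open_time[of \<epsilon> T]]) (use t \<open>0 \<le> \<epsilon>\<close> in \<open>auto simp: time_interval_def\<close>)
  then show ?thesis using vector_derivative_at[OF d] by (simp add: time_deriv_def)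
qed

end

text \<open>At a fixed time the chart derivatives are space-time derivatives in directions
  \<open>(v, 0)\<close>; linearity of \<open>dz\<close> and conjugate linearity of
  \<open>dzb\<close> then lead from the coordinate axes to arbitrary vectors.\<close>

lemma complex_hessian_lift:
  assumes c: "chart_of M c" and x: "x \<in> fst c" and t: "\<epsilon> < t" "ereal t < T"
    and h: "smooth_on (slab c \<epsilon> T) (lift c h)"
  shows "sesq_form (complex_hessian c (\<lambda>y. h y t) x) v w
    = dz v (dzb w (lift c (\<lambda>y t. complex_of_real (h y t)))) (snd c x, t)"
proof -
  let ?S = "slab c \<epsilon> T" and ?H = "lift c (\<lambda>y t. complex_of_real (h y t))"
  note S = open_slab[OF c, of \<epsilon> T] slab_point[OF c x t]
  note H = smooth_on_lift_of_real[OF h]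
  have comp: "complex_hessian c (\<lambda>y. h y t) x $ \<alpha> $ \<beta> = dz (axis \<alpha> 1) (dzb (axis \<beta> 1) ?H) (snd c x, t)" for \<alpha> \<beta>
  proof -
    let ?k = "\<lambda>y t. d_zbar c \<beta> (\<lambda>y. complex_of_real (h y t)) y"
    \<comment> \<open>The inner derivative is identified on the whole slab because the outer one
      differentiates it.\<close>
    have k: "dzb (axis \<beta> 1) ?H p = lift c ?k p" if pS: "p \<in> ?S" for p
    proof -
      obtain y s where "p = (snd c y, s)" "y \<in> fst c" "\<epsilon> < s" "ereal s < T"
        using pS by (auto simp: slab_def)
      then show ?thesis using d_zbar_lift[OF c _ _ _ H, of y s \<beta>]
        by (simp add: lift_def chart_of_inv_into[OF c])
    qed
    have smk: "smooth_on ?S (lift c ?k)"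
      by (rule smooth_on_cong[OF smooth_on_dzb[OF S(1) H] k])
    show ?thesis
      unfolding complex_hessian_def vec_lambda_beta d_z_lift[OF c x t smk]
      by (rule dz_cong[OF S smooth_on_dzb[OF S(1) H] k])
  qed
  have "dz v (dzb w ?H) (snd c x, t) = dz v (\<lambda>p. \<Sum>\<beta>\<in>UNIV. cnj (w $ \<beta>) * dzb (axis \<beta> 1) ?H p) (snd c x, t)"
  proof (rule dz_cong[OF S, symmetric])
    fix p assume "p \<in> ?S"
    then show "dzb w ?H p = (\<Sum>\<beta>\<in>UNIV. cnj (w $ \<beta>) * dzb (axis \<beta> 1) ?H p)"
      using dzb_linear[OF S(1) _ H, of p "\<lambda>\<beta>. w $ \<beta>" "\<lambda>\<beta>. axis \<beta> 1" UNIV] vector_axis_sum[of w] by simp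
  qed (rule smooth_on_dzb[OF S(1) H])
  also have "\<dots> = (\<Sum>\<beta>\<in>UNIV. cnj (w $ \<beta>) * dz v (dzb (axis \<beta> 1) ?H) (snd c x, t))"
    by (rule dz_sum_cmult[OF S]) (rule smooth_on_dzb[OF S(1) H])
  also have "\<dots> = (\<Sum>\<beta>\<in>UNIV. \<Sum>\<alpha>\<in>UNIV. cnj (w $ \<beta>) * (v $ \<alpha> * complex_hessian c (\<lambda>y. h y t) x $ \<alpha> $ \<beta>))"
    using dz_linear[OF S smooth_on_dzb[OF S(1) H], of "\<lambda>\<alpha>. v $ \<alpha>" "\<lambda>\<alpha>. axis \<alpha> 1" UNIV] vector_axis_sum[of v]
    by (simp add: comp sum_distrib_left)
  also have "\<dots> = sesq_form (complex_hessian c (\<lambda>y. h y t) x) v w"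
    unfolding sesq_form_def by (subst sum.swap) (simp add: mult_ac)
  finally show ?thesis ..
qed

text \<open>The \<open>(2,1)\<close>-part of the closedness of the real form: combine the four instances of
  \<open>d\<omega> = 0\<close> at \<open>(a, v, w)\<close>, \<open>(\<i>a, v, w)\<close>, \<open>(a, \<i>v, w)\<close> and \<open>(\<i>a, \<i>v, w)\<close>.\<close>

lemma closed_imp_kahler_identity:
  assumes S: "open S" "p \<in> S" and G: "\<And>v w. smooth_on S (\<lambda>p. sesq_form (G p) v w)"
    and closed: "\<And>a v w. Im (dir_deriv (a, 0) (\<lambda>p. sesq_form (G p) v w) p)
      - Im (dir_deriv (v, 0) (\<lambda>p. sesq_form (G p) a w) p)
      + Im (dir_deriv (w, 0) (\<lambda>p. sesq_form (G p) a v) p) = 0"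
  shows "dz a (\<lambda>p. sesq_form (G p) v w) p = dz v (\<lambda>p. sesq_form (G p) a w) p"
proof -
  note l = sesq_form_scale_left sesq_form_scale_right dir_deriv_cmult[OF S G]
  note eqs = closed[of a v w] closed[of "\<i> *s a" v w, unfolded l] closed[of a "\<i> *s v" w, unfolded l]
    closed[of "\<i> *s a" "\<i> *s v" w, unfolded l]
  have "dir_deriv X (\<lambda>p. \<i> * (cnj \<i> * sesq_form (G p) a v)) p = dir_deriv X (\<lambda>p. sesq_form (G p) a v) p" for X
    by simp
  then show ?thesis using eqs unfolding dz_def by (simp add: complex_eq_iff)
qed

section \<open>The Monge-Ampere flow and its restriction to a chart\<close>

locale kahler_flow_potential =
  fixes M :: "'a topology"
    and A :: "('a, 'm::finite) chart set"
    and g :: "real \<Rightarrow> ('a, 'm) tensor11"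
    and f :: "'a \<Rightarrow> real"
    and \<phi> u :: "'a \<Rightarrow> real \<Rightarrow> real"
    and T :: ereal
  assumes M: "compact_complex_manifold M A"
    and T: "0 < T"
    and kahler_g: "\<And>t. t \<in> time_interval T \<Longrightarrow> kahler_metric A (g t)"
    and smooth_f: "smooth_function A f"
    and hess_f: "\<And>c x. c \<in> A \<Longrightarrow> x \<in> fst c \<Longrightarrow> complex_hessian c f x = - ricci (g 0) c x"
    and smooth_\<phi>: "smooth_in_spacetime A T \<phi>"
    and g_eq: "\<And>t c x. t \<in> time_interval T \<Longrightarrow> c \<in> A \<Longrightarrow> x \<in> fst c \<Longrightarrow>
           g t c x = g 0 c x + complex_hessian c (\<lambda>y. \<phi> y t) x"
    and \<phi>_eq: "\<And>t c x. t \<in> time_interval T \<Longrightarrow> c \<in> A \<Longrightarrow> x \<in> fst c \<Longrightarrow>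
           time_deriv T \<phi> x t = ln (metric_det (g t) c x / metric_det (g 0) c x) + f x"
    and u_eq: "\<And>x t. u x t = - time_deriv T \<phi> x t"
    and u_pos: "\<And>x t. x \<in> topspace M \<Longrightarrow> t \<in> time_interval T \<Longrightarrow> 0 < u x t"
begin

lemma chart: "c \<in> A \<Longrightarrow> chart_of M c"
  using M by (auto simp: compact_complex_manifold_def complex_manifold_def)

lemma zero_time: "0 \<in> time_interval T"
  using T by (simp add: time_interval_def zero_ereal_def)

lemma hermitian_g:
  "t \<in> time_interval T \<Longrightarrow> c \<in> A \<Longrightarrow> x \<in> fst c \<Longrightarrow> hermitian_positive (g t c x)"
  using kahler_g unfolding kahler_metric_def hermitian_metric_def hermitian_positive_def by blast

abbreviation G where "G c \<equiv> lift c (\<lambda>x t. g t c x)"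

context
  fixes c :: "('a, 'm) chart" and \<epsilon> :: real
  assumes c: "c \<in> A" and \<epsilon>: "0 \<le> \<epsilon>"
begin

abbreviation S where "S \<equiv> slab c \<epsilon> T"

lemma slabE:
  assumes "p \<in> S"
  obtains x t where "p = (snd c x, t)" "x \<in> fst c" "\<epsilon> < t" "ereal t < T" "t \<in> time_interval T"
    "inv_into (fst c) (snd c) (snd c x) = x"
proof -
  obtain x t where "p = (snd c x, t)" "x \<in> fst c" "\<epsilon> < t" "ereal t < T"
    using assms by (auto simp: slab_def)
  then show ?thesis using that[of x t] \<epsilon> chart_of_inv_into[OF chart[OF c]]
    by (auto simp: time_interval_def)
qed

lemma smooth_lift_\<phi>: "smooth_on S (lift c \<phi>)"
proof -
  have "smooth_on ((snd c ` fst c) \<times> time_interval T) (\<lambda>(z, t). in_chart c (\<lambda>x. \<phi> x t) z)"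
    using smooth_\<phi> c by (auto simp: smooth_in_spacetime_def)
  moreover have "(\<lambda>(z, t). in_chart c (\<lambda>x. \<phi> x t) z) = lift c \<phi>"
    by (auto simp: in_chart_def lift_def)
  ultimately show ?thesis
    using \<epsilon> by (auto intro: smooth_on_subset simp: slab_def time_interval_def)
qed

lemma smooth_lift_const_time:
  assumes "smooth_in_chart c h"
  shows "smooth_on S (lift c (\<lambda>x t. h x))"
proof -
  have "lift c (\<lambda>x t. h x) = (\<lambda>p. in_chart c h (fst p))"
    by (simp add: lift_def in_chart_def fun_eq_iff)
  moreover have "smooth_on S (\<lambda>p. in_chart c h (fst p))"
    using assms by (intro smooth_on_compose_linear[OF bounded_linear_fst, of S "snd c ` fst c"])
      (auto simp: smooth_in_chart_def slab_def)
  ultimately show ?thesis by simp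
qed

lemma dir_deriv_time_const:
  assumes "smooth_in_chart c h" "p \<in> S"
  shows "dir_deriv (0, 1) (lift c (\<lambda>x t. h x)) p = 0"
proof -
  obtain x t where p: "p = (snd c x, t)" "x \<in> fst c" "\<epsilon> < t" "ereal t < T"
    using slabE[OF assms(2)] by metis
  have "lift c (\<lambda>x t. h x) = (\<lambda>p. in_chart c h (fst p))"
    by (simp add: lift_def in_chart_def fun_eq_iff)
  moreover have "(in_chart c h has_derivative (\<lambda>v. dir_deriv v (in_chart c h) (fst p))) (at (fst p))"
    using assms(1) p chart[OF c]
    by (intro smooth_on_has_derivative[of "snd c ` fst c"]) (auto simp: smooth_in_chart_def chart_of_def)
  then have "((\<lambda>p. in_chart c h (fst p)) has_derivative (\<lambda>X. dir_deriv (fst X) (in_chart c h) (fst p))) (at p)"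
    by (rule has_derivative_compose[OF bounded_linear_imp_has_derivative[OF bounded_linear_fst]])
  moreover have "linear (\<lambda>v. dir_deriv v (in_chart c h) (fst p))"
    using assms(1) p chart[OF c]
    by (intro dir_deriv_linear[of "snd c ` fst c"]) (auto simp: smooth_in_chart_def chart_of_def)
  ultimately show ?thesis using dir_deriv_eq linear_0 by fastforce
qed

lemma smooth_lift_u: "smooth_on S (lift c u)"
  and lift_u: "\<And>p. p \<in> S \<Longrightarrow> lift c u p = - dir_deriv (0, 1) (lift c \<phi>) p"
proof -
  show *: "lift c u p = - dir_deriv (0, 1) (lift c \<phi>) p" if pS: "p \<in> S" for p
  proof -
    obtain x t where x: "p = (snd c x, t)" "x \<in> fst c" "\<epsilon> < t" "ereal t < T" "inv_into (fst c) (snd c) (snd c x) = x"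
      using slabE[OF pS] by blast
    then show ?thesis
      using time_deriv_lift[OF chart[OF c] x(2-4) smooth_lift_\<phi> \<epsilon>] by (simp add: lift_def u_eq)
  qed
  show "smooth_on S (lift c u)"
    by (rule smooth_on_cong[OF smooth_on_minus[OF smooth_on_dir_deriv[OF smooth_lift_\<phi> open_slab[OF chart[OF c]]]]])
      (simp add: *)
qed

lemma smooth_g0: "smooth_in_chart c (g 0 c)"
  using kahler_g[OF zero_time] c by (auto simp: kahler_metric_def hermitian_metric_def)

lemma smooth_in_chart_linear:
  assumes "bounded_linear L" "smooth_in_chart c h"
  shows "smooth_in_chart c (\<lambda>x. L (h x))"
  using smooth_on_linear[OF assms(1) assms(2)[unfolded smooth_in_chart_def]]
  by (simp add: smooth_in_chart_def in_chart_def comp_def)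

lemma bounded_linear_sesq_form: "bounded_linear (\<lambda>H :: complex^'m^'m. sesq_form H v w)"
proof (rule linear_conv_bounded_linear[THEN iffD1], rule linearI)
  fix H K :: "complex^'m^'m" and r :: real
  show "sesq_form (H + K) v w = sesq_form H v w + sesq_form K v w"
    by (simp add: sesq_form_def algebra_simps sum.distrib)
  have "(r *\<^sub>R H) $ \<alpha> $ \<beta> = r *\<^sub>R (H $ \<alpha> $ \<beta>)" for \<alpha> \<beta> by (simp only: vector_scaleR_component)
  then show "sesq_form (r *\<^sub>R H) v w = r *\<^sub>R sesq_form H v w"
    unfolding sesq_form_def scaleR_sum_right by (intro sum.cong refl) (simp only: mult_scaleR_left)
qed

text \<open>\<open>kahler_metric\<close> provides smoothness in space at each fixed time; joint
  smoothness in space and time is drawn from the potential through this formula.\<close>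

lemma G_eq:
  assumes "p \<in> S"
  shows "sesq_form (G c p) v w = lift c (\<lambda>x t. sesq_form (g 0 c x) v w) p
    + dz v (dzb w (lift c (\<lambda>y t. complex_of_real (\<phi> y t)))) p"
proof -
  obtain x t where p: "p = (snd c x, t)" "x \<in> fst c" "\<epsilon> < t" "ereal t < T" "t \<in> time_interval T"
    "inv_into (fst c) (snd c) (snd c x) = x"
    using slabE[OF assms] by blast
  have "G c p = g 0 c x + complex_hessian c (\<lambda>y. \<phi> y t) x"
    using g_eq[OF p(5) c p(2)] by (simp add: lift_def p)
  moreover have "lift c (\<lambda>x t. sesq_form (g 0 c x) v w) p = sesq_form (g 0 c x) v w" by (simp add: lift_def p)
  moreover have "sesq_form (H + K) v w = sesq_form H v w + sesq_form K v w" for H K :: "complex^'m^'m"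
    using linear_add[OF bounded_linear.linear[OF bounded_linear_sesq_form]] .
  ultimately show ?thesis
    using complex_hessian_lift[OF chart[OF c] p(2-4) smooth_lift_\<phi>] by (simp add: p(1))
qed

lemma smooth_G: "smooth_on S (\<lambda>p. sesq_form (G c p) v w)"
proof (rule smooth_on_cong)
  show "smooth_on S (\<lambda>p. lift c (\<lambda>x t. sesq_form (g 0 c x) v w) p
    + dz v (dzb w (lift c (\<lambda>y t. complex_of_real (\<phi> y t)))) p)"
    by (intro smooth_on_add smooth_lift_const_time smooth_in_chart_linear[OF bounded_linear_sesq_form] smooth_g0
        smooth_on_dz smooth_on_dzb open_slab[OF chart[OF c]] smooth_on_lift_of_real smooth_lift_\<phi>)
qed (simp add: G_eq)

lemma smooth_G_component: "smooth_on S (\<lambda>p. G c p $ \<alpha> $ \<beta>)"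
proof -
  have "H $ i $ j * axis \<alpha> 1 $ i * cnj (axis \<beta> 1 $ j) = (if i = \<alpha> then if j = \<beta> then H $ i $ j else 0 else 0)"
    for H :: "complex^'m^'m" and i j by (simp add: axis_def)
  then have "sesq_form H (axis \<alpha> 1) (axis \<beta> 1) = (\<Sum>i\<in>UNIV. if i = \<alpha> then \<Sum>j\<in>UNIV. if j = \<beta> then H $ i $ j else 0 else 0)"
    for H :: "complex^'m^'m" unfolding sesq_form_def by (intro sum.cong refl) auto
  then have "sesq_form H (axis \<alpha> 1) (axis \<beta> 1) = H $ \<alpha> $ \<beta>" for H :: "complex^'m^'m"
    by simp
  then show ?thesis using smooth_G[of "axis \<alpha> 1" "axis \<beta> 1"] by simp
qed

text \<open>\<open>-u\<close> differs from \<open>ln det g\<close> by a time-independent function with vanishing complex Hessian.\<close>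

abbreviation \<psi> where "\<psi> \<equiv> \<lambda>x. f x - ln (metric_det (g 0) c x)"

lemma smooth_ln_det_0: "smooth_in_chart c (\<lambda>x. ln (metric_det (g 0) c x))"
proof -
  let ?H = "in_chart c (g 0 c)" and ?U = "snd c ` fst c"
  have "smooth_on ?U ?H" using smooth_g0 by (simp add: smooth_in_chart_def)
  then have comp: "smooth_on ?U (\<lambda>z. ?H z $ i $ j)" for i j
    by (intro smooth_on_linear[OF bounded_linear_vec_nth] smooth_on_linear[OF bounded_linear_vec_nth, of _ ?H])
  have "(\<chi> i j. ?H z $ i $ j) = ?H z" for z by (simp add: vec_eq_iff)
  then have "smooth_on ?U (\<lambda>z. Re (det (?H z)))"
    using smooth_on_Re[OF smooth_on_det[of ?U "\<lambda>i j z. ?H z $ i $ j", OF comp]] by simp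
  moreover have "0 < Re (det (?H z))" if "z \<in> ?U" for z
    using that Re_det_pos[OF hermitian_g[OF zero_time c]] chart_of_inv_into[OF chart[OF c]] by (auto simp: in_chart_def)
  ultimately have "smooth_on ?U (\<lambda>z. ln (Re (det (?H z))))" by (intro smooth_on_ln)
  then show ?thesis by (simp add: smooth_in_chart_def in_chart_def metric_det_def comp_def)
qed

lemma smooth_f_chart: "smooth_in_chart c f"
  using smooth_f c by (simp add: smooth_function_def)

lemma smooth_\<psi>: "smooth_in_chart c \<psi>"
  using smooth_on_diff[OF smooth_f_chart[unfolded smooth_in_chart_def] smooth_ln_det_0[unfolded smooth_in_chart_def]]
  by (simp add: smooth_in_chart_def in_chart_def comp_def)

lemma lift_u_eq:
  assumes "p \<in> S"
  shows "lift c u p = - ln (Re (det (G c p))) + (- lift c (\<lambda>x t. \<psi> x) p)"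
proof -
  obtain x t where p: "p = (snd c x, t)" "x \<in> fst c" "t \<in> time_interval T" "inv_into (fst c) (snd c) (snd c x) = x"
    using slabE[OF assms] chart_of_inv_into[OF chart[OF c]] by metis
  have "0 < metric_det (g t) c x" "0 < metric_det (g 0) c x"
    using hermitian_g[OF p(3) c p(2)] hermitian_g[OF zero_time c p(2)] by (simp_all add: metric_det_def Re_det_pos)
  then show ?thesis
    unfolding lift_def p(1) fst_conv snd_conv p(4) u_eq \<phi>_eq[OF p(3) c p(2)]
    by (simp add: ln_div metric_det_def)
qed

text \<open>The choice of \<open>f\<close> gives it the same complex Hessian as ln det g(0), since
  the Ricci tensor is minus the Hessian of the latter.\<close>

lemma hess_\<psi>:
  assumes "p \<in> S"
  shows "dir_deriv (v, 0) (dir_deriv (v, 0) (lift c (\<lambda>x t. \<psi> x))) p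
    + dir_deriv (\<i> *s v, 0) (dir_deriv (\<i> *s v, 0) (lift c (\<lambda>x t. \<psi> x))) p = 0"
proof -
  let ?F = "lift c (\<lambda>x t. f x)" and ?L = "lift c (\<lambda>x t. ln (metric_det (g 0) c x))"
  let ?d2 = "\<lambda>h X. dir_deriv X (dir_deriv X h) p :: real"
  obtain x t where p: "p = (snd c x, t)" "x \<in> fst c" "\<epsilon> < t" "ereal t < T"
    using slabE[OF assms] by metis
  note S = open_slab[OF chart[OF c], of \<epsilon> T] assms
  note F = smooth_lift_const_time[OF smooth_f_chart] and L = smooth_lift_const_time[OF smooth_ln_det_0]
  have "complex_hessian c f x = complex_hessian c (\<lambda>y. ln (metric_det (g 0) c y)) x"
    using hess_f[OF c p(2)] by (simp add: ricci_def)
  then have eq: "dz v (dzb v (lift c (\<lambda>y t. complex_of_real (f y)))) p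
      = dz v (dzb v (lift c (\<lambda>y t. complex_of_real (ln (metric_det (g 0) c y))))) p"
    using complex_hessian_lift[OF chart[OF c] p(2-4) F, of v v] complex_hessian_lift[OF chart[OF c] p(2-4) L, of v v]
    by (simp only: p(1))
  have d2: "?d2 h (v, 0) + ?d2 h (\<i> *s v, 0) = 4 * Re (dz v (dzb v (\<lambda>p. complex_of_real (h p))) p)"
    if "smooth_on S h" for h
    unfolding dz_dzb_same[OF S smooth_on_of_real[OF that]] dir_deriv2_of_real[OF S that] by simp
  have fl: "?d2 ?F (v, 0) + ?d2 ?F (\<i> *s v, 0) = ?d2 ?L (v, 0) + ?d2 ?L (\<i> *s v, 0)"
    using eq unfolding d2[OF F] d2[OF L] lift_def by simp
  have "lift c (\<lambda>x t. \<psi> x) = (\<lambda>p. ?F p + (-1) * ?L p)" by (simp add: lift_def fun_eq_iff)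
  then have "?d2 (lift c (\<lambda>x t. \<psi> x)) X = ?d2 ?F X + (-1) * ?d2 ?L X" for X
    by (simp only: dir_deriv2_add[OF S F smooth_on_mult[OF smooth_on_const L]] dir_deriv2_cmult[OF S L])
  then show ?thesis using fl by simp
qed

text \<open>Three sources: closedness of the Kaehler form gives \<open>kahler\<close>, exchanging
  the time derivative with the Hessian of \<phi> gives \<open>flow\<close>, and differentiating
  \<open>lift_u_eq\<close> gives \<open>time\<close> and \<open>ricci\<close>.\<close>

lemma local_flow: "local_kahler_flow S (lift c u) (G c)"
proof
  note oS = open_slab[OF chart[OF c], of \<epsilon> T]
  show "open S" by (rule oS)
  show "smooth_on S (lift c u)" by (rule smooth_lift_u)
  show "smooth_on S (\<lambda>p. G c p $ \<alpha> $ \<beta>)" for \<alpha> \<beta> by (rule smooth_G_component)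
  fix p assume p: "p \<in> S"
  obtain x t where xt: "p = (snd c x, t)" "x \<in> fst c" "\<epsilon> < t" "ereal t < T" "t \<in> time_interval T"
    "inv_into (fst c) (snd c) (snd c x) = x"
    using slabE[OF p] chart_of_inv_into[OF chart[OF c]] by metis
  show herm: "hermitian_positive (G c p)"
    using hermitian_g[OF xt(5) c xt(2)] by (simp add: lift_def xt)
  note S = oS p
  have lin: "smooth_on S (lift c (\<lambda>x t. real_form11 (g t) c x v w))"
    "dir_deriv (a, 0) (lift c (\<lambda>x t. real_form11 (g t) c x v w)) p
      = - 2 * Im (dir_deriv (a, 0) (\<lambda>p. sesq_form (G c p) v w) p)" for a v w
  proof -
    have eq: "lift c (\<lambda>x t. real_form11 (g t) c x v w) = (\<lambda>p. (-2) * Im (sesq_form (G c p) v w))"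
      by (simp add: lift_def real_form11_def fun_eq_iff)
    show "smooth_on S (lift c (\<lambda>x t. real_form11 (g t) c x v w))"
      unfolding eq by (intro smooth_on_intros smooth_G)
    have "bounded_linear (\<lambda>z. (-2) * Im z)"
      by (rule bounded_linear_const_mult[OF bounded_linear_Im])
    from dir_deriv_bounded_linear[OF S this smooth_G]
    show "dir_deriv (a, 0) (lift c (\<lambda>x t. real_form11 (g t) c x v w)) p
      = - 2 * Im (dir_deriv (a, 0) (\<lambda>p. sesq_form (G c p) v w) p)" unfolding eq by simp
  qed
  show "dz a (\<lambda>p. sesq_form (G c p) v w) p = dz v (\<lambda>p. sesq_form (G c p) a w) p" for a v w
  proof (rule closed_imp_kahler_identity[OF S smooth_G])
    fix a v w
    have "ext_deriv2 (real_form11 (g t)) c x a v w = 0"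
      using kahler_g[OF xt(5)] c xt(2) by (simp add: kahler_metric_def closed_two_form_def)
    then have "- 2 * (Im (dir_deriv (a, 0) (\<lambda>p. sesq_form (G c p) v w) p)
      - Im (dir_deriv (v, 0) (\<lambda>p. sesq_form (G c p) a w) p)
      + Im (dir_deriv (w, 0) (\<lambda>p. sesq_form (G c p) a v) p)) = 0"
      unfolding ext_deriv2_def chart_deriv_lift[OF chart[OF c] xt(2-4) lin(1)] xt(1)[symmetric] lin(2)
      by simp
    then show "Im (dir_deriv (a, 0) (\<lambda>p. sesq_form (G c p) v w) p)
      - Im (dir_deriv (v, 0) (\<lambda>p. sesq_form (G c p) a w) p)
      + Im (dir_deriv (w, 0) (\<lambda>p. sesq_form (G c p) a v) p) = 0" by simp
  qed
  let ?\<phi> = "lift c (\<lambda>y t. complex_of_real (\<phi> y t))"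
  note sm\<phi> = smooth_on_lift_of_real[OF smooth_lift_\<phi>]
  show "dir_deriv (0, 1) (\<lambda>p. sesq_form (G c p) v w) p
    = - dz v (dzb w (\<lambda>p. complex_of_real (lift c u p))) p" for v w
  proof -
    let ?g0 = "lift c (\<lambda>x t. sesq_form (g 0 c x) v w)"
    have g0: "smooth_in_chart c (\<lambda>x. sesq_form (g 0 c x) v w)"
      by (rule smooth_in_chart_linear[OF bounded_linear_sesq_form smooth_g0])
    have smd: "smooth_on S (dz v (dzb w ?\<phi>))" by (intro smooth_on_dz smooth_on_dzb oS sm\<phi>)
    have "dir_deriv (0, 1) (\<lambda>p. sesq_form (G c p) v w) p = dir_deriv (0, 1) (\<lambda>p. ?g0 p + dz v (dzb w ?\<phi>) p) p"
      by (rule dir_deriv_cong[OF S smooth_on_add[OF smooth_lift_const_time[OF g0] smd]]) (simp add: G_eq)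
    also have "\<dots> = dir_deriv (0, 1) ?g0 p + dir_deriv (0, 1) (dz v (dzb w ?\<phi>)) p"
      by (rule dir_deriv_add[OF S smooth_lift_const_time[OF g0] smd])
    also have "dir_deriv (0, 1) ?g0 p = 0" by (rule dir_deriv_time_const[OF g0 p])
    also have "dir_deriv (0, 1) (dz v (dzb w ?\<phi>)) p = dz v (dir_deriv (0, 1) (dzb w ?\<phi>)) p"
      by (rule dir_deriv_dz[OF S smooth_on_dzb[OF oS sm\<phi>]])
    also have "\<dots> = dz v (dzb w (dir_deriv (0, 1) ?\<phi>)) p"
      by (rule dz_cong[OF S smooth_on_dzb[OF oS smooth_on_dir_deriv[OF sm\<phi> oS]]])
        (simp add: dir_deriv_dzb[OF oS _ sm\<phi>])
    finally have 1: "dir_deriv (0, 1) (\<lambda>p. sesq_form (G c p) v w) p = dz v (dzb w (dir_deriv (0, 1) ?\<phi>)) p" by simp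
    have cu: "complex_of_real (lift c u q) = - dir_deriv (0, 1) ?\<phi> q" if q: "q \<in> S" for q
      using dir_deriv_of_real[OF oS q smooth_lift_\<phi>, of "(0, 1)"] lift_u[OF q] by (simp add: lift_def[abs_def])
    have smu: "smooth_on S (\<lambda>p. complex_of_real (lift c u p))" by (rule smooth_on_of_real[OF smooth_lift_u])
    have "dzb w (\<lambda>p. complex_of_real (lift c u p)) q = - dzb w (dir_deriv (0, 1) ?\<phi>) q" if q: "q \<in> S" for q
    proof -
      have "dir_deriv X (\<lambda>p. complex_of_real (lift c u p)) q = - dir_deriv X (dir_deriv (0, 1) ?\<phi>) q" for X
        using dir_deriv_cong[OF oS q smooth_on_minus[OF smooth_on_dir_deriv[OF sm\<phi> oS]], of _ "\<lambda>p. complex_of_real (lift c u p)" X]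
          dir_deriv_minus[OF oS q smooth_on_dir_deriv[OF sm\<phi> oS]] cu by simp
      then show ?thesis unfolding dzb_def by (simp add: field_simps)
    qed
    then have "dir_deriv X (dzb w (\<lambda>p. complex_of_real (lift c u p))) p
        = - dir_deriv X (dzb w (dir_deriv (0, 1) ?\<phi>)) p" for X
      using dir_deriv_cong[OF S smooth_on_minus[OF smooth_on_dzb[OF oS smooth_on_dir_deriv[OF sm\<phi> oS]]],
          of _ _ "dzb w (\<lambda>p. complex_of_real (lift c u p))" X]
        dir_deriv_minus[OF S smooth_on_dzb[OF oS smooth_on_dir_deriv[OF sm\<phi> oS]]] by simp
    then have "dz v (dzb w (\<lambda>p. complex_of_real (lift c u p))) p = - dz v (dzb w (dir_deriv (0, 1) ?\<phi>)) p"
      unfolding dz_def by (simp add: field_simps)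
    then show ?thesis using 1 by simp
  qed
  let ?ld = "\<lambda>p. ln (Re (det (G c p)))" and ?\<psi> = "lift c (\<lambda>x t. \<psi> x)"
  note sm\<psi> = smooth_lift_const_time[OF smooth_\<psi>]
  have smld: "smooth_on S ?ld"
    by (rule smooth_on_cong[OF smooth_on_minus[OF smooth_on_add[OF smooth_lift_u sm\<psi>]]]) (simp add: lift_u_eq)
  have dir: "dir_deriv X (lift c u) q = - dir_deriv X ?ld q + - dir_deriv X ?\<psi> q" if q: "q \<in> S" for X q
  proof -
    have "dir_deriv X (lift c u) q = dir_deriv X (\<lambda>p. - ?ld p + - ?\<psi> p) q"
      by (rule dir_deriv_cong[OF oS q smooth_on_add[OF smooth_on_minus[OF smld] smooth_on_minus[OF sm\<psi>]]])
        (simp add: lift_u_eq)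
    then show ?thesis
      unfolding dir_deriv_add[OF oS q smooth_on_minus[OF smld] smooth_on_minus[OF sm\<psi>]]
        dir_deriv_minus[OF oS q smld] dir_deriv_minus[OF oS q sm\<psi>] .
  qed
  show "dir_deriv (0, 1) (lift c u) p = - dir_deriv (0, 1) ?ld p"
    using dir[OF p] dir_deriv_time_const[OF smooth_\<psi> p] by simp
  fix v
  have "dir_deriv X (dir_deriv X (lift c u)) p = - dir_deriv X (dir_deriv X ?ld) p + - dir_deriv X (dir_deriv X ?\<psi>) p" for X
  proof -
    note d1 = smooth_on_dir_deriv[OF smld oS, of X] and d2 = smooth_on_dir_deriv[OF sm\<psi> oS, of X]
    have "dir_deriv X (dir_deriv X (lift c u)) p = dir_deriv X (\<lambda>p. - dir_deriv X ?ld p + - dir_deriv X ?\<psi> p) p"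
      by (rule dir_deriv_cong[OF S smooth_on_add[OF smooth_on_minus[OF d1] smooth_on_minus[OF d2]]])
        (simp add: dir)
    then show ?thesis
      unfolding dir_deriv_add[OF S smooth_on_minus[OF d1] smooth_on_minus[OF d2]]
        dir_deriv_minus[OF S d1] dir_deriv_minus[OF S d2] .
  qed
  then show "dir_deriv (v, 0) (dir_deriv (v, 0) (lift c u)) p + dir_deriv (\<i> *s v, 0) (dir_deriv (\<i> *s v, 0) (lift c u)) p
      = - (dir_deriv (v, 0) (dir_deriv (v, 0) ?ld) p + dir_deriv (\<i> *s v, 0) (dir_deriv (\<i> *s v, 0) ?ld) p)"
    using hess_\<psi>[OF p, of v] by simp
qed

end

end

section \<open>The minimum principle on the manifold\<close>

lemma matrix_inv_unique:
  fixes A B :: "complex^'n^'n::finite"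
  assumes "A ** B = mat 1"
  shows "matrix_inv A = B"
proof -
  have BA: "B ** A = mat 1" using assms matrix_left_right_inverse by blast
  then have ex: "\<exists>A'. A ** A' = mat 1 \<and> A' ** A = mat 1" using assms by blast
  have "A ** matrix_inv A = mat 1" using someI_ex[OF ex] unfolding matrix_inv_def by blast
  then have "B ** (A ** matrix_inv A) = B" by (simp only: matrix_mul_rid)
  then show ?thesis by (simp only: matrix_mul_assoc BA matrix_mul_lid)
qed

lemma matrix_inv_inverse:
  fixes A :: "complex^'n^'n::finite"
  assumes "det A \<noteq> 0"
  shows "A ** matrix_inv A = mat 1"
  using assms matrix_inv_unique by (metis invertible_det_nz invertible_def)

lemma matrix_inv_transpose:
  fixes A :: "complex^'n^'n::finite"
  assumes "det A \<noteq> 0"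
  shows "matrix_inv (transpose A) = transpose (matrix_inv A)"
proof (rule matrix_inv_unique)
  have "matrix_inv A ** A = mat 1" using matrix_inv_inverse[OF assms] matrix_left_right_inverse by blast
  then show "transpose A ** transpose (matrix_inv A) = mat 1"
    by (metis matrix_transpose_mul transpose_mat)
qed

text \<open>Cramer's rule writes the entries of the inverse as quotients of determinants, from which
  their continuity in \<open>A\<close> can be read off.\<close>

lemma matrix_inv_component:
  fixes A :: "complex^'n^'n::finite"
  assumes "det A \<noteq> 0"
  shows "matrix_inv A $ i $ j = det (\<chi> k l. if l = i then axis j 1 $ k else A $ k $ l) / det A"
proof -
  have "A *v (matrix_inv A *v axis j 1) = axis j 1"
    by (simp add: matrix_vector_mul_assoc matrix_inv_inverse[OF assms])
  then have "matrix_inv A *v axis j 1 = (\<chi> i. det (\<chi> k l. if l = i then axis j 1 $ k else A $ k $ l) / det A)"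
    using cramer[OF assms] by blast
  moreover have "(matrix_inv A *v axis j 1) $ i = matrix_inv A $ i $ j"
    by (simp add: matrix_vector_mult_def axis_def if_distrib cong: if_cong)
  ultimately show ?thesis by simp
qed

lemma continuous_on_matrix_inv:
  fixes H :: "'v::topological_space \<Rightarrow> complex^'n^'n::finite"
  assumes H: "\<And>i j. continuous_on S (\<lambda>p. H p $ i $ j)" and nz: "\<And>p. p \<in> S \<Longrightarrow> det (H p) \<noteq> 0"
  shows "continuous_on S (\<lambda>p. matrix_inv (H p) $ i $ j)"
proof -
  have det: "continuous_on S (\<lambda>p. det (\<chi> i j. K i j p))"
    if "\<And>i j. continuous_on S (K i j)" for K :: "'n \<Rightarrow> 'n \<Rightarrow> 'v \<Rightarrow> complex"
    unfolding det_def by (simp, intro continuous_intros that)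
  have eta: "(\<chi> i j. H p $ i $ j) = H p" for p by (simp add: vec_eq_iff)
  have "continuous_on S (\<lambda>p. if l = i then axis j 1 $ k else H p $ k $ l)" for k l
    by (cases "l = i") (auto intro: H)
  then have "continuous_on S (\<lambda>p. det (\<chi> k l. if l = i then axis j 1 $ k else H p $ k $ l) / det (H p))"
    using det[of "\<lambda>k l p. H p $ k $ l", OF H, unfolded eta] nz
    by (intro continuous_on_divide det) auto
  then show ?thesis
    by (rule continuous_on_eq) (simp add: matrix_inv_component[OF nz])
qed

text \<open>Here \<open>d\<close> stands for the derivatives of u in the coordinate directions. The
  gradient is obtained by solving a linear system, and the second claim turns the index formula of
  \<open>grad_norm2\<close> into the squared length of that vector.\<close>

lemma exists_gradient:
  fixes H :: "complex^'m^'m::finite"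
  assumes "hermitian_positive H"
  obtains X where "\<And>w. (\<Sum>\<alpha>\<in>UNIV. w $ \<alpha> * d \<alpha>) = sesq_form H w X"
    "Re (\<Sum>\<alpha>\<in>UNIV. \<Sum>\<beta>\<in>UNIV. matrix_inv (transpose H) $ \<alpha> $ \<beta> * d \<alpha> * cnj (d \<beta>)) = Re (sesq_form H X X)"
proof -
  define D where "D = (\<chi> \<alpha>. d \<alpha>)"
  \<comment> \<open>The conjugation compensates for the conjugate linearity of
    \<open>sesq_form\<close> in its second argument.\<close>
  define X where "X = (\<chi> \<beta>. cnj ((matrix_inv H *v D) $ \<beta>))"
  have nz: "det H \<noteq> 0" using Re_det_pos[OF assms] by auto
  have HX: "H *v (matrix_inv H *v D) = D"
    by (simp add: matrix_vector_mul_assoc matrix_inv_inverse[OF nz])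
  have sesq: "(\<Sum>\<alpha>\<in>UNIV. w $ \<alpha> * d \<alpha>) = sesq_form H w X" for w
  proof -
    have "(\<Sum>\<alpha>\<in>UNIV. w $ \<alpha> * d \<alpha>) = (\<Sum>\<alpha>\<in>UNIV. w $ \<alpha> * (H *v (matrix_inv H *v D)) $ \<alpha>)"
      by (simp add: HX) (simp add: D_def)
    also have "\<dots> = (\<Sum>\<alpha>\<in>UNIV. w $ \<alpha> * (\<Sum>\<beta>\<in>UNIV. H $ \<alpha> $ \<beta> * cnj (X $ \<beta>)))"
      unfolding matrix_vector_mult_def[of H] by (simp add: X_def)
    finally show ?thesis by (simp add: sesq_form_def sum_distrib_left mult_ac)
  qed
  have "sesq_form H X X = (\<Sum>\<beta>\<in>UNIV. cnj (\<Sum>\<alpha>\<in>UNIV. matrix_inv H $ \<beta> $ \<alpha> * d \<alpha>) * d \<beta>)"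
    unfolding sesq[symmetric] by (simp add: X_def matrix_vector_mult_def D_def)
  then have "cnj (sesq_form H X X) = (\<Sum>\<beta>\<in>UNIV. \<Sum>\<alpha>\<in>UNIV. matrix_inv H $ \<beta> $ \<alpha> * d \<alpha> * cnj (d \<beta>))"
    by (simp add: sum_distrib_left sum_distrib_right mult_ac)
  also have "\<dots> = (\<Sum>\<alpha>\<in>UNIV. \<Sum>\<beta>\<in>UNIV. matrix_inv (transpose H) $ \<alpha> $ \<beta> * d \<alpha> * cnj (d \<beta>))"
    unfolding matrix_inv_transpose[OF nz] by (subst sum.swap) (simp add: transpose_def)
  finally have "Re (\<Sum>\<alpha>\<in>UNIV. \<Sum>\<beta>\<in>UNIV. matrix_inv (transpose H) $ \<alpha> $ \<beta> * d \<alpha> * cnj (d \<beta>)) = Re (sesq_form H X X)"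
    by (metis cnj.simps(1))
  then show ?thesis by (rule that[OF sesq])
qed

text \<open>Expand |W - X|^2 >= 0. Equality at \<open>W = X\<close> makes the squared norm of a
  gradient a maximum over tangent vectors.\<close>

lemma sesq_form_variation:
  assumes H: "hermitian_positive H"
  shows "2 * Re (sesq_form H W X) - Re (sesq_form H W W) \<le> Re (sesq_form H X X)"
proof -
  have "0 \<le> Re (sesq_form H (W + (-1) *s X) (W + (-1) *s X))"
    using H unfolding hermitian_positive_def by (cases "W + (-1) *s X = 0") (auto simp: sesq_form_zero_left intro: less_imp_le)
  then show ?thesis
    unfolding sesq_form_add_left sesq_form_add_right sesq_form_scale_left sesq_form_scale_right
    using sesq_form_cnj[OF H, of X W] by simp
qed

section \<open>The Harnack quantity as a function on the manifold and its minimum\<close>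

context kahler_flow_potential
begin

lemma chart_subset: "c \<in> A \<Longrightarrow> fst c \<subseteq> topspace M"
  using chart[of c] openin_subset by (auto simp: chart_of_def)

lemma chart_exists: "x \<in> topspace M \<Longrightarrow> \<exists>c. c \<in> A \<and> x \<in> fst c"
  using M unfolding compact_complex_manifold_def complex_manifold_def by (metis UN_E)

lemma gradient:
  assumes c: "c \<in> A" and x: "x \<in> fst c" and t: "0 < t" "ereal t < T"
  obtains X where "\<And>w. dir_deriv (w, 0) (lift c u) (snd c x, t) = 2 * Re (sesq_form (g t c x) w X)"
    "grad_norm2 (g t) c (\<lambda>y. u y t) x = Re (sesq_form (g t c x) X X)"
proof -
  have t': "t \<in> time_interval T" using t by (simp add: time_interval_def)
  note S = open_slab[OF chart[OF c], of 0 T] slab_point[OF chart[OF c] x t]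
  let ?cu = "lift c (\<lambda>y t. complex_of_real (u y t))"
  note smu = smooth_lift_u[OF c order_refl] and smcu = smooth_on_lift_of_real[OF smooth_lift_u[OF c order_refl]]
  have real: "dir_deriv w ?cu (snd c x, t) = of_real (dir_deriv w (lift c u) (snd c x, t))" for w
    using dir_deriv_of_real[OF S smu] by (simp add: lift_def[abs_def])
  define d where "d \<alpha> = d_z c \<alpha> (\<lambda>y. complex_of_real (u y t)) x" for \<alpha>
  have d: "d \<alpha> = dz (axis \<alpha> 1) ?cu (snd c x, t)" for \<alpha>
    unfolding d_def by (rule d_z_lift[OF chart[OF c] x t smcu])
  have dbar: "d_zbar c \<alpha> (\<lambda>y. complex_of_real (u y t)) x = cnj (d \<alpha>)" for \<alpha>
    unfolding d d_zbar_lift[OF chart[OF c] x t smcu] by (simp add: dz_def dzb_def real)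
  obtain X where X: "\<And>w. (\<Sum>\<alpha>\<in>UNIV. w $ \<alpha> * d \<alpha>) = sesq_form (g t c x) w X"
    "Re (\<Sum>\<alpha>\<in>UNIV. \<Sum>\<beta>\<in>UNIV. matrix_inv (transpose (g t c x)) $ \<alpha> $ \<beta> * d \<alpha> * cnj (d \<beta>))
      = Re (sesq_form (g t c x) X X)"
    by (rule exists_gradient[OF hermitian_g[OF t' c x], of d]) blast
  have "dir_deriv (w, 0) (lift c u) (snd c x, t) = 2 * Re (sesq_form (g t c x) w X)" for w
  proof -
    have "dz w ?cu (snd c x, t) = (\<Sum>\<alpha>\<in>UNIV. w $ \<alpha> * d \<alpha>)"
      using dz_linear[OF S smcu, of "\<lambda>\<alpha>. w $ \<alpha>" "\<lambda>\<alpha>. axis \<alpha> 1" UNIV] vector_axis_sum[of w] by (simp add: d)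
    moreover have "dir_deriv (w, 0) (lift c u) (snd c x, t) = 2 * Re (dz w ?cu (snd c x, t))"
      by (simp add: dz_def real)
    ultimately show ?thesis by (simp add: X(1))
  qed
  moreover have "grad_norm2 (g t) c (\<lambda>y. u y t) x = Re (sesq_form (g t c x) X X)"
    unfolding grad_norm2_def dbar d_def[symmetric] by (rule X(2))
  ultimately show ?thesis using that by blast
qed

lemma grad_norm2_variation:
  assumes c: "c \<in> A" and x: "x \<in> fst c" and t: "0 < t" "ereal t < T"
  shows "dir_deriv (W, 0) (lift c u) (snd c x, t) - Re (sesq_form (g t c x) W W)
    \<le> grad_norm2 (g t) c (\<lambda>y. u y t) x"
proof -
  obtain X where X: "\<And>w. dir_deriv (w, 0) (lift c u) (snd c x, t) = 2 * Re (sesq_form (g t c x) w X)"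
    "grad_norm2 (g t) c (\<lambda>y. u y t) x = Re (sesq_form (g t c x) X X)"
    using gradient[OF assms] by blast
  show ?thesis unfolding X using t by (intro sesq_form_variation hermitian_g c x) (simp add: time_interval_def)
qed

text \<open>Both sides are maxima of D_W u - |W|^2 over tangent vectors, so it suffices to transport
  the maximising vector by the transition map; inverse matrices need no transformation law.
  Exchanging the charts gives equality.\<close>

lemma grad_norm2_le_chart:
  assumes c: "c \<in> A" "x \<in> fst c" and d: "d \<in> A" "x \<in> fst d" and t: "0 < t" "ereal t < T"
  shows "grad_norm2 (g t) c (\<lambda>y. u y t) x \<le> grad_norm2 (g t) d (\<lambda>y. u y t) x"
proof -
  let ?O = "snd c ` (fst c \<inter> fst d)" and ?D = "chart_deriv c (snd d) x"
  have homeo: "homeomorphic_map (subtopology M (fst c)) (top_of_set (snd c ` fst c)) (snd c)" "open (snd c ` fst c)"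
    and "openin M (fst d)"
    using chart[OF c(1)] chart[OF d(1)] by (auto simp: chart_of_def)
  then have "openin (subtopology M (fst c)) (fst c \<inter> fst d)"
    by (metis inf_commute openin_subtopology_Int)
  then have "openin (top_of_set (snd c ` fst c)) ?O"
    using homeomorphic_imp_open_map[OF homeo(1)] by (simp add: open_map_def)
  then have O: "open ?O" using homeo(2) openin_open_trans by blast
  have zO: "snd c x \<in> ?O" using c d by blast
  have "holomorphic_map_on ?O (in_chart c (snd d))"
    using M c d by (auto simp: compact_complex_manifold_def complex_manifold_def)
  then obtain D where D: "(in_chart c (snd d) has_derivative D) (at (snd c x))"
    using zO unfolding holomorphic_map_on_def by blast
  then have DD: "D = ?D" unfolding chart_deriv_def by (rule frechet_derivative_at)
  have "in_chart c (snd d) (snd c x) = snd d x"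
    by (simp add: in_chart_def chart_of_inv_into[OF chart[OF c(1)] c(2)])
  then have "(in_chart d (\<lambda>y. u y t) has_derivative (\<lambda>v. dir_deriv (v, 0) (lift d u) (snd d x, t)))
      (at (in_chart c (snd d) (snd c x)))"
    using lift_has_derivative[OF chart[OF d(1)] d(2) t smooth_lift_u[OF d(1) order_refl]] by simp
  from has_derivative_compose[OF D this]
  have "((\<lambda>z. in_chart d (\<lambda>y. u y t) (in_chart c (snd d) z)) has_derivative
      (\<lambda>v. dir_deriv (D v, 0) (lift d u) (snd d x, t))) (at (snd c x))" .
  then have "(in_chart c (\<lambda>y. u y t) has_derivative
      (\<lambda>v. dir_deriv (D v, 0) (lift d u) (snd d x, t))) (at (snd c x))"
  proof (rule has_derivative_transform_within_open[OF _ O zO])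
    fix z assume "z \<in> ?O"
    then obtain y where "y \<in> fst c" "y \<in> fst d" "z = snd c y" by blast
    then show "in_chart d (\<lambda>y. u y t) (in_chart c (snd d) z) = in_chart c (\<lambda>y. u y t) z"
      by (simp add: in_chart_def chart_of_inv_into[OF chart[OF c(1)]] chart_of_inv_into[OF chart[OF d(1)]])
  qed
  from has_derivative_unique[OF this lift_has_derivative[OF chart[OF c(1)] c(2) t smooth_lift_u[OF c(1) order_refl]]]
  have chain: "dir_deriv (v, 0) (lift c u) (snd c x, t) = dir_deriv (?D v, 0) (lift d u) (snd d x, t)" for v
    unfolding DD by metis
  have "t \<in> time_interval T" using t by (simp add: time_interval_def)
  then have metric: "sesq_form (g t c x) v v = sesq_form (g t d x) (?D v) (?D v)" for v
    using kahler_g c d unfolding kahler_metric_def hermitian_metric_def by blast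
  obtain X where X: "\<And>w. dir_deriv (w, 0) (lift c u) (snd c x, t) = 2 * Re (sesq_form (g t c x) w X)"
    "grad_norm2 (g t) c (\<lambda>y. u y t) x = Re (sesq_form (g t c x) X X)"
    using gradient[OF c t] by blast
  have "grad_norm2 (g t) c (\<lambda>y. u y t) x = dir_deriv (X, 0) (lift c u) (snd c x, t) - Re (sesq_form (g t c x) X X)"
    unfolding X by simp
  also have "\<dots> \<le> grad_norm2 (g t) d (\<lambda>y. u y t) x"
    unfolding chain metric by (rule grad_norm2_variation[OF d t])
  finally show ?thesis .
qed

text \<open>A global minimum requires a function on the manifold itself. By \<open>grad2_eq\<close>
  the chosen chart is immaterial.\<close>

definition grad2 :: "'a \<Rightarrow> real \<Rightarrow> real" where
  "grad2 x t = grad_norm2 (g t) (SOME c. c \<in> A \<and> x \<in> fst c) (\<lambda>y. u y t) x"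

lemma grad2_eq:
  assumes c: "c \<in> A" "x \<in> fst c" and t: "0 < t" "ereal t < T"
  shows "grad2 x t = grad_norm2 (g t) c (\<lambda>y. u y t) x"
proof -
  have "(SOME c. c \<in> A \<and> x \<in> fst c) \<in> A \<and> x \<in> fst (SOME c. c \<in> A \<and> x \<in> fst c)"
    by (rule someI[of _ c]) (use c in blast)
  then show ?thesis unfolding grad2_def by (intro antisym grad_norm2_le_chart t) (use c in auto)
qed

definition harnack :: "real \<Rightarrow> 'a \<Rightarrow> real \<Rightarrow> real" where
  "harnack \<epsilon> x t = (t - \<epsilon>) * (time_deriv T u x t - grad2 x t / u x t) + real CARD('m) * u x t"

text \<open>The variational inequality is used for u W: after division by u it bounds D_W u - u
  |W|^2 by |\<nabla>u|^2 / u.\<close>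

lemma harnack_le_barrier:
  assumes c: "c \<in> A" "x \<in> fst c" and t: "0 < t" "ereal t < T" "\<epsilon> \<le> t"
  shows "harnack \<epsilon> x t \<le> (t - \<epsilon>) * (dir_deriv (0, 1) (lift c u) (snd c x, t)
      - dir_deriv (W, 0) (lift c u) (snd c x, t) + u x t * Re (sesq_form (g t c x) W W)) + real CARD('m) * u x t"
proof -
  let ?p = "(snd c x, t)"
  have u: "0 < u x t"
    using subsetD[OF chart_subset[OF c(1)] c(2)] t by (intro u_pos) (simp_all add: time_interval_def)
  note smu = smooth_lift_u[OF c(1) order_refl]
  have sc: "dir_deriv (of_real (u x t) *s W, 0) (lift c u) ?p = u x t * dir_deriv (W, 0) (lift c u) ?p"
    using linear_cmul[OF dir_deriv_linear[OF open_slab[OF chart[OF c(1)]] slab_point[OF chart[OF c(1)] c(2) t(1,2)] smu],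
        of "u x t" "(W, 0)"] by (simp add: scaleR_eq_vector_scalar_mult)
  have "u x t * (dir_deriv (W, 0) (lift c u) ?p - u x t * Re (sesq_form (g t c x) W W)) \<le> grad2 x t"
    using grad_norm2_variation[OF c t(1,2), of "of_real (u x t) *s W"] unfolding grad2_eq[OF c t(1,2)] sc
    by (simp add: sesq_form_scale_left sesq_form_scale_right algebra_simps)
  then have "dir_deriv (W, 0) (lift c u) ?p - u x t * Re (sesq_form (g t c x) W W) \<le> grad2 x t / u x t"
    using u by (simp add: pos_le_divide_eq mult.commute)
  then have "time_deriv T u x t - grad2 x t / u x t \<le> dir_deriv (0, 1) (lift c u) ?p
      - dir_deriv (W, 0) (lift c u) ?p + u x t * Re (sesq_form (g t c x) W W)"
    using time_deriv_lift[OF chart[OF c(1)] c(2) t(1,2) smu order_refl] by simp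
  then show ?thesis unfolding harnack_def using t(3) by (intro add_right_mono mult_left_mono) auto
qed

lemma harnack_continuous_chart:
  assumes c: "c \<in> A"
  shows "continuous_on (slab c 0 T) (lift c (harnack \<epsilon>))"
proof -
  let ?S = "slab c 0 T" and ?cu = "lift c (\<lambda>y t. complex_of_real (u y t))"
  let ?N = "\<lambda>p. Re (\<Sum>\<alpha>\<in>UNIV. \<Sum>\<beta>\<in>UNIV. matrix_inv (transpose (G c p)) $ \<alpha> $ \<beta> * dz (axis \<alpha> 1) ?cu p * dzb (axis \<beta> 1) ?cu p)"
  note S = open_slab[OF chart[OF c], of 0 T]
  note smu = smooth_lift_u[OF c order_refl] and smcu = smooth_on_lift_of_real[OF smooth_lift_u[OF c order_refl]]
  have pos: "0 < lift c u p" "det (transpose (G c p)) \<noteq> 0" if "p \<in> ?S" for p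
  proof -
    obtain x t where "p = (snd c x, t)" "x \<in> fst c" "t \<in> time_interval T" "inv_into (fst c) (snd c) (snd c x) = x"
      using slabE[OF c order_refl \<open>p \<in> ?S\<close>] by blast
    then show "0 < lift c u p" "det (transpose (G c p)) \<noteq> 0"
      using u_pos[of x t] chart_subset[OF c] Re_det_pos[OF hermitian_g[of t c x]] c by (auto simp: lift_def)
  qed
  have "continuous_on ?S (\<lambda>p. transpose (G c p) $ i $ j)" for i j
    using smooth_on_continuous[OF smooth_G_component[OF c order_refl]] by (simp add: transpose_def)
  note inv = continuous_on_matrix_inv[OF this pos(2)]
  have "continuous_on ?S (\<lambda>p. (snd p - \<epsilon>) * (dir_deriv (0, 1) (lift c u) p - ?N p / lift c u p) + real CARD('m) * lift c u p)"
    using pos(1) by (intro continuous_intros inv smooth_on_continuous smooth_on_dz smooth_on_dzb smooth_on_dir_deriv S smu smcu)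
      (auto dest: pos(1))
  then show ?thesis
  proof (rule continuous_on_eq)
    fix p assume "p \<in> ?S"
    then obtain x t where p: "p = (snd c x, t)" "x \<in> fst c" "0 < t" "ereal t < T" "inv_into (fst c) (snd c) (snd c x) = x"
      using slabE[OF c order_refl] by blast
    have l: "lift c u p = u x t" "lift c (harnack \<epsilon>) p = harnack \<epsilon> x t" by (simp_all add: lift_def p)
    have "?N p = grad2 x t"
      unfolding grad2_eq[OF c p(2-4)] grad_norm2_def
      by (simp add: d_z_lift[OF chart[OF c] p(2-4) smcu] d_zbar_lift[OF chart[OF c] p(2-4) smcu] p(1))
        (simp add: lift_def p(5))
    then show "(snd p - \<epsilon>) * (dir_deriv (0, 1) (lift c u) p - ?N p / lift c u p) + real CARD('m) * lift c u p
        = lift c (harnack \<epsilon>) p"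
      using time_deriv_lift[OF chart[OF c] p(2-4) smu order_refl] by (simp add: l harnack_def) (simp add: p(1))
  qed
qed

text \<open>Continuity is known in charts only; it is pasted along the open cover of the compact
  product of the manifold with the time interval.\<close>

lemma harnack_attains_min:
  assumes \<epsilon>: "0 < \<epsilon>" "\<epsilon> \<le> t1" "ereal t1 < T" and ne: "x \<in> topspace M"
  obtains x0 t0 where "x0 \<in> topspace M" "\<epsilon> \<le> t0" "t0 \<le> t1"
    "\<And>x t. x \<in> topspace M \<Longrightarrow> \<epsilon> \<le> t \<Longrightarrow> t \<le> t1 \<Longrightarrow> harnack \<epsilon> x0 t0 \<le> harnack \<epsilon> x t"
proof -
  let ?I = "{\<epsilon>..t1}" and ?X = "prod_topology M (top_of_set {\<epsilon>..t1})"
  let ?h = "\<lambda>(x, t). harnack \<epsilon> x t"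
  have I: "0 < t \<and> ereal t < T" if "t \<in> ?I" for t
    using that \<epsilon> by (auto intro: le_less_trans[of "ereal t" "ereal t1"])
  have cont: "continuous_map ?X euclideanreal ?h"
  proof (rule pasting_lemma[where I = A and T = "\<lambda>c. fst c \<times> ?I" and f = "\<lambda>c. ?h"])
    fix c assume c: "c \<in> A"
    show "openin ?X (fst c \<times> ?I)"
      using chart[OF c] by (auto simp: openin_prod_Times_iff chart_of_def)
    let ?Y = "prod_topology (subtopology M (fst c)) (top_of_set ?I)"
    have sub: "subtopology ?X (fst c \<times> ?I) = ?Y"
      by (simp add: subtopology_Times subtopology_subtopology)
    have "continuous_map (subtopology M (fst c)) euclidean (snd c)"
      using chart[OF c] homeomorphic_imp_continuous_map[of "subtopology M (fst c)" "top_of_set (snd c ` fst c)" "snd c"]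
      by (simp add: chart_of_def continuous_map_in_subtopology)
    then have "continuous_map ?Y euclidean (\<lambda>q. snd c (fst q))"
      using continuous_map_compose[OF continuous_map_fst] by (fastforce simp: o_def)
    moreover have "continuous_map ?Y euclidean snd"
      using continuous_map_snd continuous_map_in_subtopology by blast
    ultimately have "continuous_map ?Y (prod_topology euclidean euclidean) (\<lambda>q. (snd c (fst q), snd q))"
      by (intro continuous_map_pairedI)
    moreover have "(\<lambda>q. (snd c (fst q), snd q)) \<in> topspace ?Y \<rightarrow> slab c 0 T"
      using I by (auto simp: slab_def)
    ultimately have "continuous_map ?Y (top_of_set (slab c 0 T)) (\<lambda>q. (snd c (fst q), snd q))"
      by (simp add: continuous_map_in_subtopology image_subset_iff_funcset)
    moreover have "continuous_map (top_of_set (slab c 0 T)) euclideanreal (lift c (harnack \<epsilon>))"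
      using harnack_continuous_chart[OF c] by simp
    ultimately have "continuous_map ?Y euclideanreal (lift c (harnack \<epsilon>) \<circ> (\<lambda>q. (snd c (fst q), snd q)))"
      by (rule continuous_map_compose)
    then show "continuous_map (subtopology ?X (fst c \<times> ?I)) euclideanreal ?h"
      unfolding sub
      by (rule continuous_map_eq) (auto simp: lift_def chart_of_inv_into[OF chart[OF c]])
  qed (use chart_exists in \<open>auto simp: Bex_def\<close>)
  have "compactin ?X (topspace ?X)"
    using M unfolding compact_complex_manifold_def
    by (simp add: compactin_Times compact_space_def[symmetric] flip: compact_space_def topspace_prod_topology)
      (simp add: compact_space_prod_topology compact_space_subtopology)
  then have "compact (?h ` topspace ?X)"
    using image_compactin[OF _ cont] by simp
  moreover have "?h ` topspace ?X \<noteq> {}" using ne \<epsilon> by auto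
  ultimately obtain m where m: "m \<in> ?h ` topspace ?X" "\<And>y. y \<in> ?h ` topspace ?X \<Longrightarrow> m \<le> y"
    using compact_attains_inf by metis
  then obtain x0 t0 where "x0 \<in> topspace M" "t0 \<in> ?I" "m = harnack \<epsilon> x0 t0" by auto
  moreover have "m \<le> harnack \<epsilon> x t" if "x \<in> topspace M" "t \<in> ?I" for x t
    using m(2)[of "harnack \<epsilon> x t"] that by force
  ultimately show ?thesis using that by auto
qed

lemma harnack_nonneg:
  assumes \<epsilon>: "0 < \<epsilon>" "\<epsilon> \<le> t1" "ereal t1 < T" and x1: "x1 \<in> topspace M"
  shows "0 \<le> harnack \<epsilon> x1 t1"
proof (rule ccontr)
  assume neg: "\<not> 0 \<le> harnack \<epsilon> x1 t1"
  obtain x t where x: "x \<in> topspace M" "\<epsilon> \<le> t" "t \<le> t1"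
    and min: "\<And>y s. y \<in> topspace M \<Longrightarrow> \<epsilon> \<le> s \<Longrightarrow> s \<le> t1 \<Longrightarrow> harnack \<epsilon> x t \<le> harnack \<epsilon> y s"
    using harnack_attains_min[OF \<epsilon> x1] by blast
  have hneg: "harnack \<epsilon> x t < 0" using min[OF x1] neg \<epsilon> by fastforce
  have t: "0 < t" "ereal t < T" "t \<in> time_interval T"
    using x \<epsilon> by (auto simp: time_interval_def intro: le_less_trans[of "ereal t" "ereal t1"])
  have u: "0 < u x t" by (rule u_pos[OF x(1) t(3)])
  \<comment> \<open>At time \<epsilon> the first term vanishes and the quantity equals m u, which is
    positive.\<close>
  have "t \<noteq> \<epsilon>" using hneg u by (auto simp: harnack_def mult_less_0_iff)
  then have t\<epsilon>: "\<epsilon> < t" using x(2) by simp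
  obtain c where c: "c \<in> A" "x \<in> fst c" using chart_exists[OF x(1)] by blast
  have \<epsilon>0: "0 \<le> \<epsilon>" using \<epsilon> by simp
  interpret L: local_kahler_flow "slab c \<epsilon> T" "lift c u" "G c" by (rule local_flow[OF c(1) \<epsilon>0])
  let ?p = "(snd c x, t)"
  have lp: "lift c u ?p = u x t" "G c ?p = g t c x"
    by (simp_all add: lift_def chart_of_inv_into[OF chart[OF c(1)] c(2)])
  obtain X where X: "\<And>w. dir_deriv (w, 0) (lift c u) ?p = 2 * Re (sesq_form (g t c x) w X)"
    "grad_norm2 (g t) c (\<lambda>y. u y t) x = Re (sesq_form (g t c x) X X)"
    using gradient[OF c t(1,2)] by blast
  define V where "V = of_real (1 / u x t) *s X"
  have grad: "dir_deriv (w, 0) (lift c u) ?p = 2 * u x t * Re (sesq_form (g t c x) w V)" for w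
    unfolding X(1) V_def sesq_form_scale_right using u by simp
  have gVV: "u x t * Re (sesq_form (g t c x) V V) = grad2 x t / u x t"
    unfolding grad2_eq[OF c t(1,2)] X(2) V_def sesq_form_scale_left sesq_form_scale_right using u
    by (simp add: field_simps)
  have bar: "L.barrier \<epsilon> ?p V = harnack \<epsilon> x t"
    using gVV grad[of V] time_deriv_lift[OF chart[OF c(1)] c(2) t(1,2) smooth_lift_u[OF c(1) order_refl] order_refl]
    unfolding L.barrier_def harnack_def lp by simp
  have "0 \<le> L.barrier \<epsilon> ?p V"
  proof (rule L.barrier_minimum_nonneg)
    show "?p \<in> slab c \<epsilon> T" by (rule slab_point[OF chart[OF c(1)] c(2) t\<epsilon> t(2)])
    show "0 < lift c u ?p" "\<epsilon> < snd ?p" using u t\<epsilon> lp by simp_all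
    show "dir_deriv (w, 0) (lift c u) ?p = 2 * lift c u ?p * Re (sesq_form (G c ?p) w V)" for w
      unfolding lp by (rule grad)
    \<comment> \<open>The slab extends beyond \<open>t1\<close>, but times up to that of the minimum
      stay in the interval on which the minimum was taken.\<close>
    fix q W assume q: "q \<in> slab c \<epsilon> T" "snd q \<le> snd ?p"
    obtain y s where y: "q = (snd c y, s)" "y \<in> fst c" "\<epsilon> < s" "ereal s < T" "inv_into (fst c) (snd c) (snd c y) = y"
      using slabE[OF c(1) \<epsilon>0 q(1)] by blast
    have "harnack \<epsilon> x t \<le> harnack \<epsilon> y s"
      using y q(2) x(3) chart_subset[OF c(1)] by (intro min) auto
    also have "\<dots> \<le> L.barrier \<epsilon> q W"
      using harnack_le_barrier[OF c(1) y(2) _ y(4), of \<epsilon> W] \<epsilon> y unfolding L.barrier_def y(1)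
      by (simp add: lift_def[of c u "(snd c y, s)"] lift_def[of c "\<lambda>x t. g t c x"])
    finally show "L.barrier \<epsilon> ?p V \<le> L.barrier \<epsilon> q W" unfolding bar .
  qed
  then show False using hneg bar by simp
qed

lemma harnack_inequality:
  assumes t: "0 < t" "ereal t < T" and c: "c \<in> A" "x \<in> fst c"
  shows "time_deriv T u x t - grad_norm2 (g t) c (\<lambda>y. u y t) x / u x t
           + real CARD('m) / t * u x t \<ge> 0"
proof -
  have x: "x \<in> topspace M" using chart_subset c by blast
  let ?P = "time_deriv T u x t - grad2 x t / u x t"
  \<comment> \<open>For fixed \<open>x\<close> and \<open>t\<close> the quantity is affine in
    \<epsilon>, so the limit is immediate.\<close>
  have "((\<lambda>\<epsilon>. harnack \<epsilon> x t) \<longlongrightarrow> harnack 0 x t) (at_right 0)"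
    unfolding harnack_def by (auto intro!: tendsto_eq_intros)
  moreover have "eventually (\<lambda>\<epsilon>. 0 \<le> harnack \<epsilon> x t) (at_right 0)"
    unfolding eventually_at_right_field using t x by (auto intro!: exI[of _ t] harnack_nonneg)
  ultimately have "0 \<le> harnack 0 x t"
    by (rule tendsto_lowerbound) simp
  then have "0 \<le> (t * ?P + real CARD('m) * u x t) / t"
    using t by (simp add: harnack_def)
  also have "\<dots> = ?P + real CARD('m) / t * u x t" using t by (simp add: field_simps)
  finally show ?thesis unfolding grad2_eq[OF c t] .
qed

end

theorem theorem1p2:
  fixes M :: "'a topology"
    and A :: "('a, 'm::finite) chart set"
    and g :: "real \<Rightarrow> ('a, 'm) tensor11"
    and f :: "'a \<Rightarrow> real"
    and \<phi> u :: "'a \<Rightarrow> real \<Rightarrow> real"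
    and T :: ereal
  assumes "compact_complex_manifold M A"
    and "first_chern_class A = de_rham_class A (\<lambda>c x v w. 0)"
    and "0 < T"
    and "\<And>t. t \<in> time_interval T \<Longrightarrow> kahler_metric A (g t)"
    and "smooth_function A f"
    and "\<And>c x. c \<in> A \<Longrightarrow> x \<in> fst c \<Longrightarrow> complex_hessian c f x = - ricci (g 0) c x"
    and "smooth_in_spacetime A T \<phi>"
    and "\<And>t c x. t \<in> time_interval T \<Longrightarrow> c \<in> A \<Longrightarrow> x \<in> fst c \<Longrightarrow>
           g t c x = g 0 c x + complex_hessian c (\<lambda>y. \<phi> y t) x"
    and "\<And>t c x. t \<in> time_interval T \<Longrightarrow> c \<in> A \<Longrightarrow> x \<in> fst c \<Longrightarrow>
           time_deriv T \<phi> x t = ln (metric_det (g t) c x / metric_det (g 0) c x) + f x"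
    and "\<And>x t. u x t = - time_deriv T \<phi> x t"
    and "\<And>x t. x \<in> topspace M \<Longrightarrow> t \<in> time_interval T \<Longrightarrow> 0 < u x t"
    and "0 < t" "ereal t < T" "c \<in> A" "x \<in> fst c"
  shows "time_deriv T u x t - grad_norm2 (g t) c (\<lambda>y. u y t) x / u x t
           + real CARD('m) / t * u x t \<ge> 0"
proof -
  interpret kahler_flow_potential M A g f \<phi> u T
    by unfold_locales (fact assms)+
  show ?thesis by (rule harnack_inequality[OF assms(12,13,14,15)])
qed

end
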